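(* Let $K$ be an algebraically closed field and let $p,n\ge 1$ be integers. There are only finitely many isomorphism classes of indecomposable representations in $\mathcal{F}(\Delta)=\mathrm{rep}^{\mathrm{inj}}(\widehat{\mathcal{Q}}_{p,n},\widehat{I}_{p,n})$ if and only if $p=1$, or $n\le 2$, or $(p,n)\in\{(2,3),(3,3),(4,3),(2,4),(2,5)\}$.
   Context: $\widehat{\mathcal{Q}}_{p,n}$ is the quiver with vertex set $V=\{1,\dots,n\}\times\{1,\dots,p\}$ (the first entry is the row, increasing from top to bottom; the second the column, increasing from left to right), with horizontal arrows $\alpha_{k,l}\colon(k,l)\to(k,l+1)$ for $1\le l<p$ and vertical arrows $\beta_{k,l}\colon(k,l)\to(k+1,l)$ for $1\le k<n$. $\widehat{I}_{p,n}$ is the ideal generated by all commutativity relations of the squares, $\beta_{k,l+1}\alpha_{k,l}=\alpha_{k+1,l}\beta_{k,l}$ (the further relation that compositions of $n$ vertical arrows vanish is void). $\mathrm{rep}(\widehat{\mathcal{Q}}_{p,n},\widehat{I}_{p,n})$ is the category of finite-dimensional $K$-representations satisfying these relations, and $\mathrm{rep}^{\mathrm{inj}}(\widehat{\mathcal{Q}}_{p,n},\widehat{I}_{p,n})$ is the full subcategory of representations for which all horizontal maps $\alpha_{k,l}$ are injective. It coincides with the category $\mathcal{F}(\Delta)$ of representations $M$ admitting a finite filtration whose successive quotients are isomorphic to modules $D(i,j)$, $(i,j)\in V$, where $D(i,j)_{k,l}=K$ if $k=i$ and $l\ge j$, and $0$ otherwise (with identity maps between the copies of $K$). *)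

theory Defs
  imports "HOL-Computational_Algebra.Polynomial" "HOL-Library.Function_Algebras"
begin

text \<open>
  All vector spaces are subspaces of the infinite-dimensional space of sequences
  over the field. Every finite-dimensional space is isomorphic to such a subspace,
  so every finite-dimensional representation is isomorphic to one considered here.
\<close>

definition seq_scale :: "'k::field \<Rightarrow> (nat \<Rightarrow> 'k) \<Rightarrow> (nat \<Rightarrow> 'k)" (infixr \<open>*\<^sub>s\<close> 75)
  where "c *\<^sub>s x = (\<lambda>i. c * x i)"

lemma seq_scale_apply [simp]: "(c *\<^sub>s x) i = c * x i"
  by (simp add: seq_scale_def)

global_interpretation seqvs: vector_space "seq_scale :: 'k::field \<Rightarrow> _"
  by unfold_locales (auto simp: fun_eq_iff algebra_simps)

definition fin_dim_subspace :: "(nat \<Rightarrow> 'k::field) set \<Rightarrow> bool"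
  where "fin_dim_subspace V \<longleftrightarrow> seqvs.subspace V \<and> (\<exists>B. finite B \<and> V = seqvs.span B)"

definition linear_between ::
    "(nat \<Rightarrow> 'k::field) set \<Rightarrow> (nat \<Rightarrow> 'k) set \<Rightarrow> ((nat \<Rightarrow> 'k) \<Rightarrow> (nat \<Rightarrow> 'k)) \<Rightarrow> bool"
  where "linear_between V W f \<longleftrightarrow>
    (\<forall>x\<in>V. f x \<in> W) \<and>
    (\<forall>x\<in>V. \<forall>y\<in>V. f (x + y) = f x + f y) \<and>
    (\<forall>c. \<forall>x\<in>V. f (c *\<^sub>s x) = c *\<^sub>s f x)"


section \<open>Representations of the grid quiver with commutativity relations\<close>

text \<open>
  A vertex is a pair (row, column); the arrow \<open>hor M (k, l)\<close> goes from \<open>(k, l)\<close> to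
  \<open>(k, l + 1)\<close> and \<open>ver M (k, l)\<close> goes from \<open>(k, l)\<close> to \<open>(k + 1, l)\<close>. Values of the
  fields away from the quiver, and values of the maps outside the spaces they start
  from, are irrelevant: no notion below refers to them.
\<close>

record 'k quiver_rep =
  sp :: "nat \<times> nat \<Rightarrow> (nat \<Rightarrow> 'k) set"
  hor :: "nat \<times> nat \<Rightarrow> (nat \<Rightarrow> 'k) \<Rightarrow> (nat \<Rightarrow> 'k)"
  ver :: "nat \<times> nat \<Rightarrow> (nat \<Rightarrow> 'k) \<Rightarrow> (nat \<Rightarrow> 'k)"

definition vertices :: "nat \<Rightarrow> nat \<Rightarrow> (nat \<times> nat) set"
  where "vertices p n = {1..n} \<times> {1..p}"

definition harrows :: "nat \<Rightarrow> nat \<Rightarrow> (nat \<times> nat) set"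
  where "harrows p n = {1..n} \<times> {1..<p}"

definition varrows :: "nat \<Rightarrow> nat \<Rightarrow> (nat \<times> nat) set"
  where "varrows p n = {1..<n} \<times> {1..p}"

definition rep :: "nat \<Rightarrow> nat \<Rightarrow> 'k::field quiver_rep set"
  where "rep p n = {M.
    (\<forall>v\<in>vertices p n. fin_dim_subspace (sp M v)) \<and>
    (\<forall>(k, l)\<in>harrows p n. linear_between (sp M (k, l)) (sp M (k, l + 1)) (hor M (k, l))) \<and>
    (\<forall>(k, l)\<in>varrows p n. linear_between (sp M (k, l)) (sp M (k + 1, l)) (ver M (k, l))) \<and>
    (\<forall>(k, l)\<in>harrows p n \<inter> varrows p n. \<forall>x\<in>sp M (k, l).
       ver M (k, l + 1) (hor M (k, l) x) = hor M (k + 1, l) (ver M (k, l) x))}"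

definition rep_inj :: "nat \<Rightarrow> nat \<Rightarrow> 'k::field quiver_rep set"
  where "rep_inj p n =
    {M \<in> rep p n. \<forall>(k, l)\<in>harrows p n. inj_on (hor M (k, l)) (sp M (k, l))}"

definition morphism :: "nat \<Rightarrow> nat \<Rightarrow> 'k::field quiver_rep \<Rightarrow> 'k quiver_rep \<Rightarrow>
    (nat \<times> nat \<Rightarrow> (nat \<Rightarrow> 'k) \<Rightarrow> (nat \<Rightarrow> 'k)) \<Rightarrow> bool"
  where "morphism p n M N f \<longleftrightarrow>
    (\<forall>v\<in>vertices p n. linear_between (sp M v) (sp N v) (f v)) \<and>
    (\<forall>(k, l)\<in>harrows p n. \<forall>x\<in>sp M (k, l).
       f (k, l + 1) (hor M (k, l) x) = hor N (k, l) (f (k, l) x)) \<and>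
    (\<forall>(k, l)\<in>varrows p n. \<forall>x\<in>sp M (k, l).
       f (k + 1, l) (ver M (k, l) x) = ver N (k, l) (f (k, l) x))"

definition isomorphic :: "nat \<Rightarrow> nat \<Rightarrow> 'k::field quiver_rep \<Rightarrow> 'k quiver_rep \<Rightarrow> bool"
  where "isomorphic p n M N \<longleftrightarrow>
    (\<exists>f. morphism p n M N f \<and> (\<forall>v\<in>vertices p n. bij_betw (f v) (sp M v) (sp N v)))"

definition iso_rel :: "nat \<Rightarrow> nat \<Rightarrow> ('k::field quiver_rep \<times> 'k quiver_rep) set"
  where "iso_rel p n = {(M, N). M \<in> rep p n \<and> N \<in> rep p n \<and> isomorphic p n M N}"

definition subrep :: "nat \<Rightarrow> nat \<Rightarrow> 'k::field quiver_rep \<Rightarrow>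
    (nat \<times> nat \<Rightarrow> (nat \<Rightarrow> 'k) set) \<Rightarrow> bool"
  where "subrep p n M U \<longleftrightarrow>
    (\<forall>v\<in>vertices p n. seqvs.subspace (U v) \<and> U v \<subseteq> sp M v) \<and>
    (\<forall>(k, l)\<in>harrows p n. hor M (k, l) ` U (k, l) \<subseteq> U (k, l + 1)) \<and>
    (\<forall>(k, l)\<in>varrows p n. ver M (k, l) ` U (k, l) \<subseteq> U (k + 1, l))"

definition nonzero_on :: "nat \<Rightarrow> nat \<Rightarrow> (nat \<times> nat \<Rightarrow> (nat \<Rightarrow> 'k::field) set) \<Rightarrow> bool"
  where "nonzero_on p n U \<longleftrightarrow> (\<exists>v\<in>vertices p n. U v \<noteq> {0})"

definition direct_sum_of :: "nat \<Rightarrow> nat \<Rightarrow> 'k::field quiver_rep \<Rightarrow>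
    (nat \<times> nat \<Rightarrow> (nat \<Rightarrow> 'k) set) \<Rightarrow> (nat \<times> nat \<Rightarrow> (nat \<Rightarrow> 'k) set) \<Rightarrow> bool"
  where "direct_sum_of p n M U W \<longleftrightarrow>
    subrep p n M U \<and> subrep p n M W \<and>
    (\<forall>v\<in>vertices p n. sp M v = {u + w | u w. u \<in> U v \<and> w \<in> W v} \<and> U v \<inter> W v = {0})"

definition indecomposable :: "nat \<Rightarrow> nat \<Rightarrow> 'k::field quiver_rep \<Rightarrow> bool"
  where "indecomposable p n M \<longleftrightarrow>
    nonzero_on p n (sp M) \<and>
    \<not> (\<exists>U W. direct_sum_of p n M U W \<and> nonzero_on p n U \<and> nonzero_on p n W)"


section \<open>Filtrations with quotients of the form \<open>D(i, j)\<close>\<close>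

text \<open>The field itself is realised as the line of sequences supported at \<open>0\<close>.\<close>

definition D_rep :: "nat \<Rightarrow> nat \<Rightarrow> 'k::field quiver_rep"
  where "D_rep i j = \<lparr>
    sp = (\<lambda>(k, l). if k = i \<and> j \<le> l then {x. \<forall>a. a \<noteq> 0 \<longrightarrow> x a = 0} else {0}),
    hor = (\<lambda>_ x. x),
    ver = (\<lambda>_ _. 0)\<rparr>"

text \<open>
  \<open>quotient_iso p n M U' U N\<close> says that the quotient \<open>U' / U\<close> of subrepresentations
  of \<open>M\<close> is isomorphic to \<open>N\<close>, in the form of an epimorphism from \<open>U'\<close> onto \<open>N\<close>
  with kernel \<open>U\<close>.
\<close>

definition quotient_iso :: "nat \<Rightarrow> nat \<Rightarrow> 'k::field quiver_rep \<Rightarrow>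
    (nat \<times> nat \<Rightarrow> (nat \<Rightarrow> 'k) set) \<Rightarrow> (nat \<times> nat \<Rightarrow> (nat \<Rightarrow> 'k) set) \<Rightarrow> 'k quiver_rep \<Rightarrow> bool"
  where "quotient_iso p n M U' U N \<longleftrightarrow>
    (\<exists>f. morphism p n (M\<lparr>sp := U'\<rparr>) N f \<and>
      (\<forall>v\<in>vertices p n. f v ` U' v = sp N v \<and> {x \<in> U' v. f v x = 0} = U v))"

definition D_filtration :: "nat \<Rightarrow> nat \<Rightarrow> 'k::field quiver_rep \<Rightarrow> nat \<Rightarrow>
    (nat \<Rightarrow> nat \<times> nat \<Rightarrow> (nat \<Rightarrow> 'k) set) \<Rightarrow> bool"
  where "D_filtration p n M m F \<longleftrightarrow>
    (\<forall>t\<le>m. subrep p n M (F t)) \<and>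
    (\<forall>v\<in>vertices p n. F 0 v = {0}) \<and>
    (\<forall>v\<in>vertices p n. F m v = sp M v) \<and>
    (\<forall>t<m. \<exists>(i, j)\<in>vertices p n. quotient_iso p n M (F (Suc t)) (F t) (D_rep i j))"

definition F_Delta :: "nat \<Rightarrow> nat \<Rightarrow> 'k::field quiver_rep set"
  where "F_Delta p n = {M \<in> rep p n. \<exists>m F. D_filtration p n M m F}"


section \<open>Isomorphism is an equivalence relation\<close>

lemma linear_between_comp:
  assumes "linear_between U V f" "linear_between V W g"
  shows "linear_between U W (g \<circ> f)"
  using assms by (auto simp: linear_between_def)

lemma linear_between_zero:
  assumes "linear_between V W f" "seqvs.subspace V"
  shows "f 0 = 0"
proof -
  have "0 \<in> V" using assms(2) by (rule seqvs.subspace_0)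
  then have "f (0 *\<^sub>s 0) = 0 *\<^sub>s f 0" using assms(1) unfolding linear_between_def by blast
  then show ?thesis by simp
qed

lemma linear_between_inv:
  assumes f: "linear_between V W f" and b: "bij_betw f V W" and V: "seqvs.subspace V"
  shows "linear_between W V (inv_into V f)"
proof -
  have *: "inv_into V f (f x) = x" if "x \<in> V" for x
    using b that by (simp add: bij_betw_inv_into_left)
  have W: "W = f ` V" using b by (simp add: bij_betw_def)
  show ?thesis unfolding linear_between_def W
  proof (intro conjI ballI allI)
    fix y assume "y \<in> f ` V" then show "inv_into V f y \<in> V" by (auto simp: *)
  next
    fix y z assume "y \<in> f ` V" "z \<in> f ` V"
    then obtain a b where ab: "a \<in> V" "b \<in> V" "y = f a" "z = f b" by auto
    then have "y + z = f (a + b)" using f by (simp add: linear_between_def)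
    moreover have "a + b \<in> V" using V ab by (simp add: seqvs.subspace_add)
    ultimately show "inv_into V f (y + z) = inv_into V f y + inv_into V f z"
      using ab by (simp add: *)
  next
    fix c y assume "y \<in> f ` V"
    then obtain a where a: "a \<in> V" "y = f a" by auto
    then have "c *\<^sub>s y = f (c *\<^sub>s a)" using f by (simp add: linear_between_def)
    moreover have "c *\<^sub>s a \<in> V" using V a by (simp add: seqvs.subspace_scale)
    ultimately show "inv_into V f (c *\<^sub>s y) = c *\<^sub>s inv_into V f y"
      using a by (simp add: *)
  qed
qed

lemma harrows_vertices:
  "(k, l) \<in> harrows p n \<Longrightarrow> (k, l) \<in> vertices p n \<and> (k, l + 1) \<in> vertices p n"
  by (auto simp: harrows_def vertices_def)

lemma varrows_vertices:
  "(k, l) \<in> varrows p n \<Longrightarrow> (k, l) \<in> vertices p n \<and> (k + 1, l) \<in> vertices p n"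
  by (auto simp: varrows_def vertices_def)

lemma repD:
  assumes "M \<in> rep p n"
  shows "v \<in> vertices p n \<Longrightarrow> fin_dim_subspace (sp M v)"
    and "(k, l) \<in> harrows p n \<Longrightarrow>
      linear_between (sp M (k, l)) (sp M (k, l + 1)) (hor M (k, l))"
    and "(k, l) \<in> varrows p n \<Longrightarrow>
      linear_between (sp M (k, l)) (sp M (k + 1, l)) (ver M (k, l))"
  using assms by (auto simp: rep_def)

lemma morphismD:
  assumes "morphism p n M N f"
  shows "v \<in> vertices p n \<Longrightarrow> linear_between (sp M v) (sp N v) (f v)"
    and "(k, l) \<in> harrows p n \<Longrightarrow> x \<in> sp M (k, l) \<Longrightarrow>
       f (k, l + 1) (hor M (k, l) x) = hor N (k, l) (f (k, l) x)"
    and "(k, l) \<in> varrows p n \<Longrightarrow> x \<in> sp M (k, l) \<Longrightarrow>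
       f (k + 1, l) (ver M (k, l) x) = ver N (k, l) (f (k, l) x)"
  using assms by (auto simp: morphism_def)

lemma isomorphic_refl: "isomorphic p n M M"
  unfolding isomorphic_def
  by (rule exI[of _ "\<lambda>_ x. x"])
     (auto simp: morphism_def linear_between_def bij_betw_def inj_on_def)

lemma isomorphic_trans:
  assumes "isomorphic p n L M" "isomorphic p n M N"
  shows "isomorphic p n L N"
proof -
  obtain f where f: "morphism p n L M f" "\<forall>v\<in>vertices p n. bij_betw (f v) (sp L v) (sp M v)"
    using assms(1) unfolding isomorphic_def by blast
  obtain g where g: "morphism p n M N g" "\<forall>v\<in>vertices p n. bij_betw (g v) (sp M v) (sp N v)"
    using assms(2) unfolding isomorphic_def by blast
  have mem: "f v x \<in> sp M v" if "v \<in> vertices p n" "x \<in> sp L v" for v x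
    using morphismD(1)[OF f(1) that(1)] that(2) by (simp add: linear_between_def)
  have "morphism p n L N (\<lambda>v. g v \<circ> f v)"
    unfolding morphism_def
  proof (intro conjI ballI; (clarify)?)
    fix a b assume "(a, b) \<in> vertices p n"
    then show "linear_between (sp L (a, b)) (sp N (a, b)) (g (a, b) \<circ> f (a, b))"
      using linear_between_comp morphismD(1)[OF f(1)] morphismD(1)[OF g(1)] by blast
  next
    fix k l x assume "(k, l) \<in> harrows p n" "x \<in> sp L (k, l)"
    then show "(g (k, l + 1) \<circ> f (k, l + 1)) (hor L (k, l) x) = hor N (k, l) ((g (k, l) \<circ> f (k, l)) x)"
      using harrows_vertices[of k l p n] mem
      by (simp add: morphismD(2)[OF f(1), simplified] morphismD(2)[OF g(1), simplified])
  next
    fix k l x assume "(k, l) \<in> varrows p n" "x \<in> sp L (k, l)"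
    then show "(g (k + 1, l) \<circ> f (k + 1, l)) (ver L (k, l) x) = ver N (k, l) ((g (k, l) \<circ> f (k, l)) x)"
      using varrows_vertices[of k l p n] mem
      by (simp add: morphismD(3)[OF f(1), simplified] morphismD(3)[OF g(1), simplified])
  qed
  moreover have "\<forall>v\<in>vertices p n. bij_betw (g v \<circ> f v) (sp L v) (sp N v)"
    using f(2) g(2) by (blast intro: bij_betw_trans)
  ultimately show ?thesis unfolding isomorphic_def by blast
qed

lemma isomorphic_sym:
  assumes M: "M \<in> rep p n" and N: "N \<in> rep p n" and iso: "isomorphic p n M N"
  shows "isomorphic p n N M"
proof -
  obtain f where f: "morphism p n M N f" "\<And>v. v \<in> vertices p n \<Longrightarrow> bij_betw (f v) (sp M v) (sp N v)"
    using iso unfolding isomorphic_def by blast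
  define g where "g v = inv_into (sp M v) (f v)" for v
  have gf: "g v (f v x) = x" if "v \<in> vertices p n" "x \<in> sp M v" for v x
    using f(2)[OF that(1)] that(2) by (simp add: g_def bij_betw_inv_into_left)
  have img: "\<exists>x\<in>sp M v. y = f v x" if "v \<in> vertices p n" "y \<in> sp N v" for v y
    using f(2)[OF that(1)] that(2) by (auto simp: bij_betw_def)
  have "morphism p n N M g"
    unfolding morphism_def
  proof (intro conjI ballI; (clarify)?)
    fix a b assume v: "(a, b) \<in> vertices p n"
    show "linear_between (sp N (a, b)) (sp M (a, b)) (g (a, b))"
      unfolding g_def
      using linear_between_inv[OF morphismD(1)[OF f(1) v] f(2)[OF v]] repD(1)[OF M v]
      by (simp add: fin_dim_subspace_def)
  next
    fix k l y assume h: "(k, l) \<in> harrows p n" "y \<in> sp N (k, l)"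
    then obtain x where x: "x \<in> sp M (k, l)" "y = f (k, l) x"
      using img harrows_vertices by blast
    have "hor M (k, l) x \<in> sp M (k, l + 1)"
      using repD(2)[OF M h(1)] x(1) by (simp add: linear_between_def)
    then show "g (k, l + 1) (hor N (k, l) y) = hor M (k, l) (g (k, l) y)"
      using harrows_vertices[OF h(1)] x gf morphismD(2)[OF f(1) h(1) x(1)] by metis
  next
    fix k l y assume h: "(k, l) \<in> varrows p n" "y \<in> sp N (k, l)"
    then obtain x where x: "x \<in> sp M (k, l)" "y = f (k, l) x"
      using img varrows_vertices by blast
    have "ver M (k, l) x \<in> sp M (k + 1, l)"
      using repD(3)[OF M h(1)] x(1) by (simp add: linear_between_def)
    then show "g (k + 1, l) (ver N (k, l) y) = ver M (k, l) (g (k, l) y)"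
      using varrows_vertices[OF h(1)] x gf morphismD(3)[OF f(1) h(1) x(1)] by metis
  qed
  moreover have "\<forall>v\<in>vertices p n. bij_betw (g v) (sp N v) (sp M v)"
    using f(2) by (simp add: g_def bij_betw_inv_into)
  ultimately show ?thesis unfolding isomorphic_def by blast
qed

lemma equiv_iso_rel: "equiv (rep p n) (iso_rel p n)"
  by (intro equivI refl_onI symI transI)
     (auto simp: iso_rel_def intro: isomorphic_refl isomorphic_sym isomorphic_trans)


section \<open>The two descriptions of the category agree\<close>

lemma sp_upd_simps [simp]:
  "hor (M\<lparr>sp := U\<rparr>) = hor M" "ver (M\<lparr>sp := U\<rparr>) = ver M" "sp (M\<lparr>sp := U\<rparr>) = U"
  by simp_all

lemma F_Delta_subset: "F_Delta p n \<subseteq> rep_inj p n"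
proof
  fix M :: "'k::field quiver_rep" assume "M \<in> F_Delta p n"
  then obtain m F where M: "M \<in> rep p n" and F: "D_filtration p n M m F"
    by (auto simp: F_Delta_def)
  have ker: "x = 0" if "t \<le> m" "(k, l) \<in> harrows p n" "x \<in> F t (k, l)" "hor M (k, l) x = 0"
    for t k l x using that
  proof (induction t)
    case 0
    then show ?case using F harrows_vertices by (auto simp: D_filtration_def)
  next
    case (Suc t)
    have "t < m" using Suc by simp
    then obtain i j where "quotient_iso p n M (F (Suc t)) (F t) (D_rep i j)"
      using F by (fastforce simp: D_filtration_def)
    then obtain f where f: "morphism p n (M\<lparr>sp := F (Suc t)\<rparr>) (D_rep i j) f"
      and fk: "\<And>v. v \<in> vertices p n \<Longrightarrow> {x \<in> F (Suc t) v. f v x = 0} = F t v"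
      unfolding quotient_iso_def by blast
    have v: "(k, l) \<in> vertices p n" "(k, l + 1) \<in> vertices p n"
      using Suc harrows_vertices by auto
    have "subrep p n M (F (Suc t))" using F Suc by (auto simp: D_filtration_def)
    then have "f (k, l + 1) 0 = 0"
      using linear_between_zero[OF morphismD(1)[OF f v(2)]] v by (auto simp: subrep_def)
    moreover have "f (k, l + 1) (hor M (k, l) x) = f (k, l) x"
      using morphismD(2)[OF f Suc.prems(2)] Suc.prems(3) by (simp add: D_rep_def)
    ultimately have "f (k, l) x = 0" using Suc.prems(4) by metis
    then have "x \<in> F t (k, l)" using fk[OF v(1)] Suc.prems(3) by blast
    moreover have "t \<le> m" using Suc.prems(1) by simp
    ultimately show ?case using Suc.IH Suc.prems(2,4) by blast
  qed
  have "inj_on (hor M (k, l)) (sp M (k, l))" if h: "(k, l) \<in> harrows p n" for k l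
  proof (rule inj_onI)
    fix x y assume xy: "x \<in> sp M (k, l)" "y \<in> sp M (k, l)" "hor M (k, l) x = hor M (k, l) y"
    have V: "seqvs.subspace (sp M (k, l))"
      using repD(1)[OF M] harrows_vertices[OF h] by (simp add: fin_dim_subspace_def)
    have L: "linear_between (sp M (k, l)) (sp M (k, l + 1)) (hor M (k, l))"
      using repD(2)[OF M h] .
    have d: "x - y \<in> sp M (k, l)" using V xy by (simp add: seqvs.subspace_diff)
    have "hor M (k, l) ((x - y) + y) = hor M (k, l) (x - y) + hor M (k, l) y"
      using L d xy(2) unfolding linear_between_def by blast
    then have "hor M (k, l) (x - y) = 0" using xy(3) by simp
    moreover have "x - y \<in> F m (k, l)"
      using F d harrows_vertices[OF h] by (auto simp: D_filtration_def)
    ultimately have "x - y = 0" using ker[OF le_refl h] by blast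
    then show "x = y" by (rule eq_iff_diff_eq_0[THEN iffD2])
  qed
  then show "M \<in> rep_inj p n" using M by (auto simp: rep_inj_def)
qed

lemma dim_strict:
  fixes S T :: "(nat \<Rightarrow> 'k::field) set"
  assumes T: "finite B" "T \<subseteq> seqvs.span B"
    and S: "seqvs.subspace S" and ST: "S \<subset> T"
  shows "seqvs.dim S < seqvs.dim T"
proof -
  obtain A where A: "A \<subseteq> S" "seqvs.independent A" "S \<subseteq> seqvs.span A" "card A = seqvs.dim S"
    using seqvs.basis_exists by blast
  have SA: "seqvs.span A \<subseteq> S" using A(1) S by (rule seqvs.span_minimal)
  obtain t where t: "t \<in> T" "t \<notin> S" using ST by blast
  have "t \<notin> seqvs.span A" using t SA by blast
  then have i: "seqvs.independent (insert t A)"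
    using A(2) by (simp add: seqvs.independent_insert)
  obtain C where C: "insert t A \<subseteq> C" "C \<subseteq> T" "seqvs.independent C" "T \<subseteq> seqvs.span C"
    using seqvs.maximal_independent_subset_extend[of "insert t A" T] i t A(1) ST by blast
  have fC: "finite C"
    using seqvs.independent_span_bound[OF T(1) C(3)] C(2) T(2) by blast
  have "seqvs.dim T = card C" using seqvs.basis_card_eq_dim[OF C(2,4,3)] by simp
  moreover have "card (insert t A) \<le> card C" using fC C(1) by (rule card_mono)
  moreover have "t \<notin> A" "finite A"
    using t A(1) C(1) fC finite_subset by auto
  ultimately show ?thesis using A(4) by simp
qed

fun push :: "'k quiver_rep \<Rightarrow> nat \<Rightarrow> nat \<Rightarrow> nat \<Rightarrow> (nat \<Rightarrow> 'k) \<Rightarrow> (nat \<Rightarrow> 'k)"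
  where "push M k 0 l x = x"
  | "push M k (Suc r) l x = push M k r (Suc l) (hor M (k, l) x)"

lemma subrepD:
  assumes "subrep p n M U"
  shows "v \<in> vertices p n \<Longrightarrow> seqvs.subspace (U v)"
    and "v \<in> vertices p n \<Longrightarrow> U v \<subseteq> sp M v"
    and "(k, l) \<in> harrows p n \<Longrightarrow> x \<in> U (k, l) \<Longrightarrow> hor M (k, l) x \<in> U (k, l + 1)"
    and "(k, l) \<in> varrows p n \<Longrightarrow> x \<in> U (k, l) \<Longrightarrow> ver M (k, l) x \<in> U (k + 1, l)"
  using assms by (fastforce simp: subrep_def)+

lemma subrep_linear:
  assumes M: "M \<in> rep p n" and U: "subrep p n M U"
  shows "(k, l) \<in> harrows p n \<Longrightarrow> linear_between (U (k, l)) (U (k, l + 1)) (hor M (k, l))"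
    and "(k, l) \<in> varrows p n \<Longrightarrow> linear_between (U (k, l)) (U (k + 1, l)) (ver M (k, l))"
  subgoal
    using repD(2)[OF M, of k l] subrepD(2,3)[OF U] harrows_vertices[of k l p n]
    unfolding linear_between_def by (metis subsetD)
  subgoal
    using repD(3)[OF M, of k l] subrepD(2,4)[OF U] varrows_vertices[of k l p n]
    unfolding linear_between_def by (metis subsetD)
  done

lemma push_linear:
  assumes M: "M \<in> rep p n" and U: "subrep p n M U"
  shows "k \<in> {1..n} \<Longrightarrow> 1 \<le> l \<Longrightarrow> l + r \<le> p \<Longrightarrow>
    linear_between (U (k, l)) (U (k, l + r)) (push M k r l)"
proof (induction r arbitrary: l)
  case 0
  have "push M k 0 l = (\<lambda>x. x)" by auto
  then show ?case by (simp add: linear_between_def)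
next
  case (Suc r)
  have "(k, l) \<in> harrows p n" using Suc.prems by (simp add: harrows_def)
  then have "linear_between (U (k, l)) (U (k, Suc l)) (hor M (k, l))"
    using subrep_linear(1)[OF M U] by simp
  moreover have "linear_between (U (k, Suc l)) (U (k, Suc l + r)) (push M k r (Suc l))"
    using Suc.prems by (intro Suc.IH) auto
  ultimately have "linear_between (U (k, l)) (U (k, Suc l + r)) (push M k r (Suc l) \<circ> hor M (k, l))"
    by (rule linear_between_comp)
  moreover have "push M k r (Suc l) \<circ> hor M (k, l) = push M k (Suc r) l" by auto
  ultimately show ?case by (simp only: add_Suc add_Suc_right)
qed

lemma push_nonzero:
  assumes M: "M \<in> rep_inj p n" and U: "subrep p n M U"
  shows "k \<in> {1..n} \<Longrightarrow> 1 \<le> l \<Longrightarrow> l + r \<le> p \<Longrightarrow> x \<in> U (k, l) \<Longrightarrow> x \<noteq> 0 \<Longrightarrow>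
    push M k r l x \<noteq> 0"
proof (induction r arbitrary: l x)
  case (Suc r)
  have h: "(k, l) \<in> harrows p n" using Suc.prems by (simp add: harrows_def)
  have v: "(k, l) \<in> vertices p n" using harrows_vertices[OF h] by simp
  have R: "M \<in> rep p n" using M by (simp add: rep_inj_def)
  have S: "seqvs.subspace (sp M (k, l))"
    using repD(1)[OF R v] by (simp add: fin_dim_subspace_def)
  have "inj_on (hor M (k, l)) (sp M (k, l))" using M h by (auto simp: rep_inj_def)
  moreover have "hor M (k, l) 0 = 0" using linear_between_zero[OF repD(2)[OF R h] S] .
  moreover have "x \<in> sp M (k, l)" using Suc.prems subrepD(2)[OF U v] by blast
  ultimately have "hor M (k, l) x \<noteq> 0"
    using Suc.prems(5) seqvs.subspace_0[OF S] by (metis inj_onD)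
  moreover have "hor M (k, l) x \<in> U (k, Suc l)" using subrepD(3)[OF U h] Suc.prems by simp
  ultimately have "push M k r (Suc l) (hor M (k, l) x) \<noteq> 0"
    using Suc.prems by (intro Suc.IH) auto
  then show ?case by (simp only: push.simps not_False_eq_True)
qed simp

lemma D_quotient_exists:
  assumes M: "M \<in> rep_inj p n" and U: "subrep p n M U" and nz: "nonzero_on p n U"
  shows "\<exists>N. subrep p n M N \<and> (\<forall>v\<in>vertices p n. N v \<subseteq> U v) \<and>
    (\<exists>v\<in>vertices p n. N v \<subset> U v) \<and>
    (\<exists>(i, j)\<in>vertices p n. quotient_iso p n M U N (D_rep i j))"
proof -
  have R: "M \<in> rep p n" using M by (simp add: rep_inj_def)
  define Q where "Q k \<longleftrightarrow> (\<exists>l. (k, l) \<in> vertices p n \<and> U (k, l) \<noteq> {0})" for k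
  have "\<exists>k. Q k" using nz by (auto simp: nonzero_on_def Q_def)
  then obtain k where k: "Q k" and kmin: "\<And>k'. k' < k \<Longrightarrow> \<not> Q k'"
    using LeastI_ex[of Q] not_less_Least[of _ Q] by blast
  obtain l0 where l0: "(k, l0) \<in> vertices p n" "U (k, l0) \<noteq> {0}" using k by (auto simp: Q_def)
  have kn: "k \<in> {1..n}" and l0p: "1 \<le> l0" "l0 \<le> p" using l0 by (auto simp: vertices_def)
  obtain x0 where x0: "x0 \<in> U (k, l0)" "x0 \<noteq> 0"
    using l0(2) seqvs.subspace_0[OF subrepD(1)[OF U l0(1)]] by blast
  have "push M k (p - l0) l0 x0 \<noteq> 0"
    using push_nonzero[OF M U kn l0p(1) _ x0] l0p by simp
  then obtain i where i: "push M k (p - l0) l0 x0 i \<noteq> 0" by (auto simp: fun_eq_iff)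
  define h where "h l x = push M k (p - l) l x i" for l x
  define f where "f v x = (if fst v = k then (\<lambda>a::nat. if a = 0 then h (snd v) x else 0) else 0)"
    for v :: "nat \<times> nat" and x
  define L where "L = {x :: nat \<Rightarrow> 'a. \<forall>a. a \<noteq> 0 \<longrightarrow> x a = 0}"
  have h_add: "h l (x + y) = h l x + h l y" and h_scale: "h l (c *\<^sub>s x) = c * h l x"
    if "(k, l) \<in> vertices p n" "x \<in> U (k, l)" "y \<in> U (k, l)" for l x y c
  proof -
    have "linear_between (U (k, l)) (U (k, l + (p - l))) (push M k (p - l) l)"
      using that(1) by (intro push_linear[OF R U]) (auto simp: vertices_def)
    then show "h l (x + y) = h l x + h l y" "h l (c *\<^sub>s x) = c * h l x"
      using that by (auto simp: linear_between_def h_def)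
  qed
  have h_hor: "h (Suc l) (hor M (k, l) x) = h l x" if "(k, l) \<in> harrows p n" for l x
  proof -
    have "p - l = Suc (p - Suc l)" using that by (auto simp: harrows_def)
    then show ?thesis by (simp add: h_def)
  qed
  have f_add: "f v (x + y) = f v x + f v y" and f_scale: "f v (c *\<^sub>s x) = c *\<^sub>s f v x"
    if "v \<in> vertices p n" "x \<in> U v" "y \<in> U v" for v x y c
    using that h_add[of "snd v" x y] h_scale[of "snd v" x y c]
    by (cases v; auto simp: f_def fun_eq_iff)+
  define J where "J l \<longleftrightarrow> (k, l) \<in> vertices p n \<and> (\<exists>x\<in>U (k, l). h l x \<noteq> 0)" for l
  have "J l0" using l0 x0 i by (auto simp: J_def h_def)
  define j where "j = (LEAST l. J l)"
  have Jj: "J j" unfolding j_def using \<open>J l0\<close> by (rule LeastI)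
  have Jmin: "\<not> J l" if "l < j" for l using that unfolding j_def by (rule not_less_Least)
  have Jup: "J l" if "j \<le> l" "l \<le> p" for l
    using that
  proof (induction l rule: dec_induct)
    case base then show ?case using Jj by simp
  next
    case (step l)
    then have J: "J l" by simp
    then have hl: "(k, l) \<in> harrows p n" using step by (auto simp: J_def harrows_def vertices_def)
    obtain x where x: "x \<in> U (k, l)" "h l x \<noteq> 0" using J by (auto simp: J_def)
    have "hor M (k, l) x \<in> U (k, Suc l)" using subrepD(3)[OF U hl x(1)] by simp
    moreover have "h (Suc l) (hor M (k, l) x) \<noteq> 0" using h_hor[OF hl] x(2) by simp
    ultimately show ?case using harrows_vertices[OF hl] by (auto simp only: J_def Suc_eq_plus1)
  qed
  have img: "f v ` U v = sp (D_rep k j) v" if v: "v \<in> vertices p n" for v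
  proof (cases "fst v = k \<and> j \<le> snd v")
    case True
    then obtain l where vl: "v = (k, l)" "j \<le> l" by (cases v) auto
    then have "J l" using v Jup by (auto simp: vertices_def)
    then obtain x where x: "x \<in> U (k, l)" "h l x \<noteq> 0" by (auto simp: J_def)
    have "y \<in> f v ` U v" if "y \<in> L" for y
    proof
      let ?z = "(y 0 / h l x) *\<^sub>s x"
      show "?z \<in> U v"
        using subrepD(1)[OF U v] x vl by (simp add: seqvs.subspace_scale)
      show "y = f v ?z"
        using that x vl v h_scale[of l x x "y 0 / h l x"]
        by (auto simp: f_def L_def fun_eq_iff)
    qed
    moreover have "f v x \<in> L" for x by (auto simp: f_def L_def)
    ultimately show ?thesis using vl by (auto simp: D_rep_def L_def)
  next
    case False
    have "f v x = 0" if "x \<in> U v" for x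
    proof (cases "fst v = k")
      case True
      then have "\<not> J (snd v)" using False Jmin by auto
      then show ?thesis using True v that by (cases v) (auto simp: J_def f_def fun_eq_iff)
    qed (simp add: f_def)
    moreover have "0 \<in> U v" using seqvs.subspace_0[OF subrepD(1)[OF U v]] .
    moreover have "sp (D_rep k j) v = {0}" using False by (cases v) (auto simp: D_rep_def)
    ultimately show ?thesis by (force simp: image_def)
  qed
  define N where "N v = {x \<in> U v. f v x = 0}" for v
  have fh: "f (a, l + 1) (hor M (a, l) x) = f (a, l) x" if "(a, l) \<in> harrows p n" for a l x
    using that h_hor[of l x] by (auto simp: f_def fun_eq_iff)
  have fv: "f (a + 1, l) (ver M (a, l) x) = 0" if av: "(a, l) \<in> varrows p n" "x \<in> U (a, l)" for a l x
  proof (cases "a + 1 = k")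
    case True
    then have "U (a, l) = {0}"
      using kmin[of a] varrows_vertices[OF av(1)] by (auto simp: Q_def)
    then have x: "x = 0" using av by simp
    have v: "(a + 1, l) \<in> vertices p n" "(a, l) \<in> vertices p n"
      using varrows_vertices[OF av(1)] by auto
    have "ver M (a, l) 0 = 0"
      by (rule linear_between_zero[OF subrep_linear(2)[OF R U av(1)] subrepD(1)[OF U v(2)]])
    moreover have "0 \<in> U (a + 1, l)" using seqvs.subspace_0[OF subrepD(1)[OF U v(1)]] .
    then have "f (a + 1, l) (0 *\<^sub>s 0) = 0 *\<^sub>s f (a + 1, l) 0" by (intro f_scale[OF v(1)])
    ultimately show ?thesis using x by simp
  qed (simp add: f_def)
  have mor: "morphism p n (M\<lparr>sp := U\<rparr>) (D_rep k j) f"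
    unfolding morphism_def sp_upd_simps
  proof (intro conjI ballI; (clarify)?)
    fix a b assume v: "(a, b) \<in> vertices p n"
    show "linear_between (U (a, b)) (sp (D_rep k j) (a, b)) (f (a, b))"
      unfolding linear_between_def using img[OF v] f_add[OF v] f_scale[OF v] by blast
  next
    fix a l x assume "(a, l) \<in> harrows p n"
    then show "f (a, l + 1) (hor M (a, l) x) = hor (D_rep k j) (a, l) (f (a, l) x)"
      using fh by (simp add: D_rep_def)
  next
    fix a l x assume "(a, l) \<in> varrows p n" "x \<in> U (a, l)"
    then show "f (a + 1, l) (ver M (a, l) x) = ver (D_rep k j) (a, l) (f (a, l) x)"
      using fv by (simp add: D_rep_def)
  qed
  have "quotient_iso p n M U N (D_rep k j)"
    unfolding quotient_iso_def using mor img by (auto simp: N_def intro!: exI[of _ f])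
  moreover have "(k, j) \<in> vertices p n" using Jj by (simp add: J_def)
  moreover have "subrep p n M N"
    unfolding subrep_def
  proof (intro conjI ballI; (clarify)?)
    fix a b assume v: "(a, b) \<in> vertices p n"
    have S: "seqvs.subspace (U (a, b))" using subrepD(1)[OF U v] .
    have 0: "0 \<in> U (a, b)" using S by (rule seqvs.subspace_0)
    have "f (a, b) (0 *\<^sub>s 0) = 0 *\<^sub>s f (a, b) 0" by (intro f_scale[OF v 0 0])
    then show "seqvs.subspace (N (a, b))"
      using S f_add[OF v] f_scale[OF v]
      by (auto simp: seqvs.subspace_def N_def)
  next
    fix a b x assume "(a, b) \<in> vertices p n" "x \<in> N (a, b)"
    then show "x \<in> sp M (a, b)" using subrepD(2)[OF U] by (auto simp: N_def)
  next
    fix a l x y assume "(a, l) \<in> harrows p n" "y \<in> N (a, l)"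
    then show "hor M (a, l) y \<in> N (a, l + 1)"
      using fh subrepD(3)[OF U] by (simp add: N_def)
  next
    fix a l x y assume "(a, l) \<in> varrows p n" "y \<in> N (a, l)"
    then show "ver M (a, l) y \<in> N (a + 1, l)"
      using fv subrepD(4)[OF U] by (simp add: N_def)
  qed
  moreover have "N (k, j) \<subset> U (k, j)"
  proof -
    obtain x where "x \<in> U (k, j)" "h j x \<noteq> 0" using Jj by (auto simp: J_def)
    then have "x \<in> U (k, j)" "x \<notin> N (k, j)" by (auto simp: N_def f_def fun_eq_iff)
    then show ?thesis by (auto simp: N_def)
  qed
  moreover have "\<forall>v\<in>vertices p n. N v \<subseteq> U v" by (auto simp: N_def)
  ultimately show ?thesis by blast
qed

lemma filtration_exists:
  assumes M: "M \<in> rep_inj p n"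
  shows "subrep p n M U \<Longrightarrow> \<exists>m F. (\<forall>t\<le>m. subrep p n M (F t)) \<and>
    (\<forall>v\<in>vertices p n. F 0 v = {0}) \<and> (\<forall>v\<in>vertices p n. F m v = U v) \<and>
    (\<forall>t<m. \<exists>(i, j)\<in>vertices p n. quotient_iso p n M (F (Suc t)) (F t) (D_rep i j))"
proof (induction "\<Sum>v\<in>vertices p n. seqvs.dim (U v)" arbitrary: U rule: less_induct)
  case less
  show ?case
  proof (cases "nonzero_on p n U")
    case False
    then show ?thesis using less.prems
      by (intro exI[of _ 0] exI[of _ "\<lambda>_. U"]) (auto simp: nonzero_on_def)
  next
    case True
    from D_quotient_exists[OF M less.prems True] obtain N i j w where
      N: "subrep p n M N" "\<forall>v\<in>vertices p n. N v \<subseteq> U v"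
      and w: "w \<in> vertices p n" "N w \<subset> U w"
      and ij: "(i, j) \<in> vertices p n" "quotient_iso p n M U N (D_rep i j)" by blast
    have R: "M \<in> rep p n" using M by (simp add: rep_inj_def)
    have dim: "seqvs.dim (N v) < seqvs.dim (U v)" if v: "v \<in> vertices p n" and "N v \<subset> U v" for v
    proof -
      obtain B where "finite B" "sp M v = seqvs.span B"
        using repD(1)[OF R v] by (auto simp: fin_dim_subspace_def)
      then show ?thesis
        using dim_strict[of B "U v" "N v"] subrepD(2)[OF less.prems v] subrepD(1)[OF N(1) v] that
        by simp
    qed
    have "(\<Sum>v\<in>vertices p n. seqvs.dim (N v)) < (\<Sum>v\<in>vertices p n. seqvs.dim (U v))"
    proof (rule sum_strict_mono_ex1)
      show "finite (vertices p n)" by (simp add: vertices_def)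
      show "\<forall>v\<in>vertices p n. seqvs.dim (N v) \<le> seqvs.dim (U v)"
        using dim N(2) by (metis less_imp_le order_refl psubsetI)
      show "\<exists>v\<in>vertices p n. seqvs.dim (N v) < seqvs.dim (U v)" using dim w by blast
    qed
    from less.hyps[OF this N(1)] obtain m F where
      F: "\<forall>t\<le>m. subrep p n M (F t)" "\<forall>v\<in>vertices p n. F 0 v = {0}"
        "\<forall>v\<in>vertices p n. F m v = N v"
        "\<forall>t<m. \<exists>(i, j)\<in>vertices p n. quotient_iso p n M (F (Suc t)) (F t) (D_rep i j)"
      by blast
    have last: "quotient_iso p n M U (F m) (D_rep i j)"
      using ij(2) F(3) by (simp add: quotient_iso_def)
    define G where "G t = (if t = Suc m then U else F t)" for t
    have "\<forall>t\<le>Suc m. subrep p n M (G t)" using F(1) less.prems by (auto simp: G_def le_Suc_eq)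
    moreover have "\<forall>v\<in>vertices p n. G 0 v = {0}" using F(2) by (simp add: G_def)
    moreover have "\<forall>v\<in>vertices p n. G (Suc m) v = U v" by (simp add: G_def)
    moreover have "\<exists>(i, j)\<in>vertices p n. quotient_iso p n M (G (Suc t)) (G t) (D_rep i j)"
      if "t < Suc m" for t
    proof (cases "t = m")
      case True
      then show ?thesis using ij(1) last by (auto simp: G_def)
    next
      case False
      then show ?thesis using F(4) that by (simp add: G_def)
    qed
    ultimately show ?thesis by blast
  qed
qed

theorem F_Delta_eq_rep_inj: "F_Delta p n = rep_inj p n"
proof
  show "F_Delta p n \<subseteq> rep_inj p n" by (rule F_Delta_subset)
  show "rep_inj p n \<subseteq> F_Delta p n"
  proof
    fix M :: "'k::field quiver_rep" assume M: "M \<in> rep_inj p n"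
    then have R: "M \<in> rep p n" by (simp add: rep_inj_def)
    have "subrep p n M (sp M)"
      unfolding subrep_def
      using repD[OF R] by (fastforce simp: fin_dim_subspace_def linear_between_def)
    from filtration_exists[OF M this] show "M \<in> F_Delta p n"
      using R by (simp add: F_Delta_def D_filtration_def)
  qed
qed

end

theory Submission
  imports Defs
begin

text \<open>
  A representation \<open>M\<close> with injective horizontal maps is a chain of flagged spaces: row \<open>k\<close> is the
  space \<open>V\<^sub>k = sp M (k, p)\<close> with the flag formed by the images of the spaces \<open>sp M (k, b)\<close>, and the
  vertical maps respect the flags. Both directions of the theorem study subspaces of the \<open>V\<^sub>k\<close> that
  are defined uniformly for all \<open>M\<close> from the flags.

  \<^bold>\<open>Finiteness.\<close> Let \<open>w\<close> be a subspace of \<open>V\<^sub>k\<close> defined in this way. A finite list of such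
  subspaces is full for \<open>w\<close> if every linear map \<open>w M \<rightarrow> w N\<close> that preserves the members of the list
  extends to a morphism \<open>M \<rightarrow> N\<close> (\<open>full_on\<close>). Suppose that a full list consists of two chains. Two
  chains of subspaces have a common adapted basis (\<open>two_chain_basis\<close>), so the projection onto a basis
  vector of \<open>w M\<close> extends to an endomorphism of \<open>M\<close>; by Fitting's lemma, an indecomposable \<open>M\<close> with
  \<open>w M \<noteq> 0\<close> has \<open>w M\<close> of dimension one, and then the isomorphism class of \<open>M\<close> is determined by
  which members of the list vanish. So there are finitely many classes (\<open>finite_if_two_chains\<close>).

  Full lists arise in two ways. From a full list of two chains for \<open>V\<^sub>k\<close>, the images of the meets of
  members of the two chains, together with the flag of row \<open>k + 1\<close>, form a full list for \<open>V\<^sub>k\<^sub>+\<^sub>1\<close>: lift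
  the images of the vectors of an adapted basis one by one (\<open>full_on_next_row\<close>). And if every member of
  a full list for \<open>w\<close> either lies below a subspace \<open>a\<close> or belongs to one of two chains, then the members
  below \<open>a\<close>, together with the meets of \<open>a\<close> with the joins of members of the two chains, form a full
  list for \<open>a\<close> (\<open>full_on_restrict\<close>). This second step is the differentiation of Nazarova and Roiter
  from the theory of representations of partially ordered sets; it loses only those indecomposables on
  which \<open>a\<close> vanishes, and for these the two chains are full. Finiteness in a given case is thereby
  reduced to a finite computation in a lattice of formal terms: exhibit subspaces to restrict to until
  two chains remain. No restriction is needed for \<open>p = 1\<close> or \<open>n \<le> 2\<close>, one is needed for
  \<open>(p, n) = (2, 5)\<close> and for \<open>(3, 3)\<close>, and four are made for \<open>(4, 3)\<close>. Representations whose last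
  row vanishes are handled by induction on the number of rows.

  \<^bold>\<open>Infiniteness.\<close> The remaining pairs \<open>(p, n)\<close> dominate one of \<open>(5, 3)\<close>, \<open>(3, 4)\<close>, \<open>(2, 6)\<close>. In each
  of these cases there is a family of representations, indexed by \<open>c\<close> in the field, with four naturally
  defined lines in a plane, spanned by \<open>e\<^sub>1\<close>, \<open>e\<^sub>2\<close>, \<open>e\<^sub>1 + e\<^sub>2\<close> and \<open>e\<^sub>1 + c e\<^sub>2\<close>. The first three lines
  keep the plane inside a single indecomposable summand, and an isomorphism between the summands for \<open>c\<close>
  and \<open>d\<close> preserves all four lines, whence \<open>c = d\<close> (\<open>infinite_indecs_if_four_lines\<close>). An algebraically
  closed field is infinite.
\<close>

section \<open>Linear algebra in the sequence space\<close>

global_interpretation seqvp: vector_space_pair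
    "seq_scale :: 'k::field \<Rightarrow> _" "seq_scale :: 'k \<Rightarrow> _"
  by unfold_locales

text \<open>
  Vectors are treated abstractly until concrete representations appear in the last section; rewriting
  coordinatewise would break up sums and multiples.
\<close>

declare seq_scale_apply [simp del] zero_fun_apply [simp del] plus_fun_apply [simp del]

abbreviation slin :: "((nat \<Rightarrow> 'k::field) \<Rightarrow> (nat \<Rightarrow> 'k)) \<Rightarrow> bool"
  where "slin \<equiv> Vector_Spaces.linear seq_scale seq_scale"

lemma slin_iff: "slin f \<longleftrightarrow> (\<forall>x y. f (x + y) = f x + f y) \<and> (\<forall>c x. f (c *\<^sub>s x) = c *\<^sub>s f x)"
  by (simp add: Vector_Spaces.linear_iff seqvs.vector_space_axioms)

lemma slin_facts:
  assumes "slin f"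
  shows slin_add: "f (x + y) = f x + f y" and slin_scale: "f (c *\<^sub>s x) = c *\<^sub>s f x"
    and slin_0: "f 0 = 0" and slin_diff: "f (x - y) = f x - f y"
proof -
  interpret f: Vector_Spaces.linear seq_scale seq_scale f by fact
  show "f (x + y) = f x + f y" "f (c *\<^sub>s x) = c *\<^sub>s f x" "f 0 = 0" "f (x - y) = f x - f y"
    by (fact f.add f.scale f.zero f.diff)+
qed

lemma slin_comp: "slin f \<Longrightarrow> slin g \<Longrightarrow> slin (\<lambda>x. g (f x))"
  by (simp add: slin_iff)

lemma slin_sum: "(\<And>b. b \<in> B \<Longrightarrow> slin (f b)) \<Longrightarrow> slin (\<lambda>x. \<Sum>b\<in>B. f b x)"
  by (rule seqvp.linear_compose_sum) simp

lemma slin_image_subspace: "slin f \<Longrightarrow> seqvs.subspace V \<Longrightarrow> seqvs.subspace (f ` V)"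
  by (rule seqvp.linear_subspace_image)

lemma slin_eq_on_span:
  assumes "slin f" "slin g" "\<And>x. x \<in> B \<Longrightarrow> f x = g x" "x \<in> seqvs.span B"
  shows "f x = g x"
  using seqvp.linear_eq_on_span[OF assms(1,2)] assms(3,4) by blast

lemma slin_span_into:
  assumes f: "slin f" and U: "seqvs.subspace U" and B: "\<And>b. b \<in> B \<Longrightarrow> f b \<in> U"
    and x: "x \<in> seqvs.span B"
  shows "f x \<in> U"
proof -
  have "f x \<in> seqvs.span (f ` B)" using seqvp.linear_span_image[OF f, of B] x by blast
  also have "\<dots> \<subseteq> U" using B U by (intro seqvs.span_minimal) auto
  finally show ?thesis .
qed

lemma slin_linear_between: "slin f \<Longrightarrow> f ` V \<subseteq> W \<Longrightarrow> linear_between V W f"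
  by (auto simp: slin_iff linear_between_def)

lemma linear_between_mono:
  "linear_between V W f \<Longrightarrow> V' \<subseteq> V \<Longrightarrow> f ` V' \<subseteq> W' \<Longrightarrow> linear_between V' W' f"
  unfolding linear_between_def by blast

lemma linear_between_extend:
  assumes V: "seqvs.subspace V" and f: "linear_between V W f"
  shows "\<exists>g. slin g \<and> (\<forall>x\<in>V. g x = f x)"
proof -
  obtain B where B: "B \<subseteq> V" "seqvs.independent B" "V \<subseteq> seqvs.span B"
    using seqvs.maximal_independent_subset[of V] by blast
  obtain g where g: "slin g" "\<forall>x\<in>B. g x = f x"
    using seqvp.linear_independent_extend[OF B(2)] by blast
  have "x \<in> V \<and> g x = f x" if "x \<in> seqvs.span B" for x
    using that
  proof (induction rule: seqvs.span_induct_alt)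
    case base
    show ?case using linear_between_zero[OF f V] slin_0[OF g(1)] seqvs.subspace_0[OF V] by simp
  next
    case (step c x y)
    have "x \<in> V" using step(1) B(1) by blast
    moreover have "c *\<^sub>s x \<in> V" using V \<open>x \<in> V\<close> by (rule seqvs.subspace_scale)
    ultimately show ?case
      using step f g V by (auto simp: linear_between_def slin_add slin_scale seqvs.subspace_add)
  qed
  then show ?thesis using g(1) B(3) by blast
qed

lemma linear_between_subspace_image:
  assumes "linear_between V W f" "seqvs.subspace V"
  shows "seqvs.subspace (f ` V)"
proof -
  obtain g where "slin g" "\<forall>x\<in>V. g x = f x" using linear_between_extend[OF assms(2,1)] by blast
  moreover from this have "f ` V = g ` V" by force
  ultimately show ?thesis using slin_image_subspace assms(2) by metis
qed

lemma independent_finite: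
  assumes "fin_dim_subspace W" "seqvs.independent B" "B \<subseteq> W"
  shows "finite B"
  using assms seqvs.independent_span_bound unfolding fin_dim_subspace_def by blast

lemma fin_dim_subset:
  assumes W: "fin_dim_subspace W" and V: "seqvs.subspace V" "V \<subseteq> W"
  shows "fin_dim_subspace V"
proof -
  obtain B where B: "B \<subseteq> V" "seqvs.independent B" "V \<subseteq> seqvs.span B"
    using seqvs.maximal_independent_subset[of V] by blast
  have "finite B" using independent_finite[OF W B(2)] B(1) V(2) by blast
  moreover have "seqvs.span B \<subseteq> V" using seqvs.span_minimal[OF B(1) V(1)] .
  ultimately show ?thesis using B(3) V(1) unfolding fin_dim_subspace_def by blast
qed

lemma fin_dim_psubset:
  assumes "fin_dim_subspace W" "seqvs.subspace V" "V \<subset> W"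
  shows "seqvs.dim V < seqvs.dim W"
  using assms dim_strict unfolding fin_dim_subspace_def by blast

lemma fin_dim_le:
  assumes "fin_dim_subspace W" "seqvs.subspace V" "V \<subseteq> W"
  shows "seqvs.dim V \<le> seqvs.dim W"
  using fin_dim_psubset[OF assms(1,2)] assms(3) by (cases "V = W") (auto simp: psubset_eq)

lemma injective_endo_onto:
  assumes W: "fin_dim_subspace W" and g: "linear_between W W g"
    and inj: "\<And>x. x \<in> W \<Longrightarrow> g x = 0 \<Longrightarrow> x = 0"
  shows "g ` W = W"
proof (rule ccontr)
  assume "g ` W \<noteq> W"
  then have "g ` W \<subset> W" using g by (auto simp: linear_between_def)
  have S: "seqvs.subspace W" using W by (simp add: fin_dim_subspace_def)
  obtain h where h: "slin h" "\<forall>x\<in>W. h x = g x" using linear_between_extend[OF S g] by blast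
  have gh: "g ` W = h ` W" using h(2) by force
  obtain B where B: "B \<subseteq> W" "seqvs.independent B" "W \<subseteq> seqvs.span B"
    using seqvs.maximal_independent_subset[of W] by blast
  have span: "seqvs.span B = W" using B seqvs.span_minimal[OF B(1) S] by blast
  have inj_h: "inj_on h (seqvs.span B)"
  proof (rule inj_onI)
    fix x y assume "x \<in> seqvs.span B" "y \<in> seqvs.span B" "h x = h y"
    then have "x - y \<in> W" "h (x - y) = 0"
      using S span by (auto simp: seqvs.subspace_diff slin_diff[OF h(1)])
    then have "x - y = 0" using inj h(2) by metis
    then show "x = y" by (rule eq_iff_diff_eq_0[THEN iffD2])
  qed
  have "h ` W \<subseteq> seqvs.span (h ` B)" using seqvp.linear_span_image[OF h(1), of B] span by simp
  moreover have "seqvs.independent (h ` B)"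
    using seqvp.linear_independent_injective_image[OF h(1) B(2) inj_h] .
  ultimately have "card (h ` B) = seqvs.dim (h ` W)"
    using B(1) by (intro seqvs.basis_card_eq_dim) auto
  moreover have "card (h ` B) = card B"
    using inj_h seqvs.span_superset by (metis card_image inj_on_subset)
  moreover have "card B = seqvs.dim W" using B by (intro seqvs.basis_card_eq_dim)
  ultimately show False
    using fin_dim_psubset[OF W slin_image_subspace[OF h(1) S]] \<open>g ` W \<subset> W\<close> gh by simp
qed

section \<open>Bases adapted to two chains of subspaces\<close>

text \<open>
  Any basis \<open>B\<close> of \<open>A\<close> that is adapted to the chain \<open>\<beta>\<close> extends to a larger subspace \<open>A'\<close>: go up the
  chain and at each member \<open>V\<close> add only vectors of \<open>A' \<inter> V\<close>. Then the vectors outside \<open>V\<close> all come from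
  \<open>B\<close>, so an element of \<open>A' \<inter> V\<close> differs from the span of the vectors inside \<open>V\<close> by an element of
  \<open>A \<inter> V\<close>, and \<open>B\<close> already takes care of that.
\<close>

lemma chain_extend_aux:
  assumes A: "seqvs.subspace A" "seqvs.independent B" "B \<subseteq> A" "A \<subseteq> seqvs.span B"
    and A': "A \<subseteq> A'" "seqvs.subspace A'"
  shows "sorted_wrt (\<subseteq>) \<beta> \<Longrightarrow> \<forall>V\<in>set \<beta>. seqvs.subspace V \<and> A \<inter> V \<subseteq> seqvs.span (B \<inter> V) \<Longrightarrow>
    \<exists>B'. B \<subseteq> B' \<and> B' \<subseteq> A' \<and> seqvs.independent B' \<and> B' \<subseteq> B \<union> \<Union>(set \<beta>) \<and>
      (\<forall>V\<in>set \<beta>. A' \<inter> V \<subseteq> seqvs.span (B' \<inter> V))"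
proof (induction \<beta> rule: rev_induct)
  case Nil
  then show ?case using A A' by (intro exI[of _ B]) auto
next
  case (snoc V \<beta>)
  then obtain B' where B': "B \<subseteq> B'" "B' \<subseteq> A'" "seqvs.independent B'" "B' \<subseteq> B \<union> \<Union>(set \<beta>)"
    "\<forall>V\<in>set \<beta>. A' \<inter> V \<subseteq> seqvs.span (B' \<inter> V)"
    by (auto simp: sorted_wrt_append)
  have le: "\<Union>(set \<beta>) \<subseteq> V" using snoc.prems by (auto simp: sorted_wrt_append)
  have V: "seqvs.subspace V" "A \<inter> V \<subseteq> seqvs.span (B \<inter> V)" using snoc.prems by auto
  obtain C where C: "B' \<subseteq> C" "C \<subseteq> B' \<union> (A' \<inter> V)" "seqvs.independent C"
    "B' \<union> (A' \<inter> V) \<subseteq> seqvs.span C"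
    using seqvs.maximal_independent_subset_extend[of B' "B' \<union> (A' \<inter> V)"] B'(3) by blast
  have CV: "C \<subseteq> B \<union> V" using C(2) B'(4) le by blast
  have new: "x \<in> seqvs.span (C \<inter> V)" if x: "x \<in> A' \<inter> V" for x
  proof -
    have "C = (C \<inter> V) \<union> (C - V)" by blast
    then have "x \<in> seqvs.span ((C \<inter> V) \<union> (C - V))" using C(4) x by auto
    then obtain u v where uv: "x = u + v" "u \<in> seqvs.span (C \<inter> V)" "v \<in> seqvs.span (C - V)"
      by (auto simp: seqvs.span_Un)
    have "u \<in> V" using uv(2) seqvs.span_minimal[OF _ V(1), of "C \<inter> V"] by blast
    then have "x - u \<in> V" using x V(1) by (simp add: seqvs.subspace_diff)
    moreover have "x - u = v" using uv(1) by simp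
    moreover have "C - V \<subseteq> A" using CV A(3) by blast
    then have "v \<in> A" using uv(3) seqvs.span_minimal[OF _ A(1)] by blast
    ultimately have "v \<in> seqvs.span (B \<inter> V)" using V(2) by auto
    moreover have "B \<inter> V \<subseteq> C \<inter> V" using B'(1) C(1) by blast
    ultimately have "v \<in> seqvs.span (C \<inter> V)" using seqvs.span_mono by blast
    then show ?thesis using uv by (simp add: seqvs.span_add)
  qed
  have old: "A' \<inter> U \<subseteq> seqvs.span (C \<inter> U)" if "U \<in> set \<beta>" for U
    using B'(5) that seqvs.span_mono[of "B' \<inter> U" "C \<inter> U"] C(1) by blast
  show ?case
  proof (intro exI[of _ C] conjI)
    show "C \<subseteq> B \<union> \<Union>(set (\<beta> @ [V]))" using C(2) B'(4) by auto
    show "\<forall>U\<in>set (\<beta> @ [V]). A' \<inter> U \<subseteq> seqvs.span (C \<inter> U)" using new old by auto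
  qed (use C B' in auto)
qed

lemma chain_extend:
  assumes "seqvs.subspace A" "seqvs.independent B" "B \<subseteq> A" "A \<subseteq> seqvs.span B"
    and "A \<subseteq> A'" "seqvs.subspace A'"
    and "sorted_wrt (\<subseteq>) \<beta>" "\<forall>V\<in>set \<beta>. seqvs.subspace V \<and> A \<inter> V \<subseteq> seqvs.span (B \<inter> V)"
  shows "\<exists>B'. B \<subseteq> B' \<and> B' \<subseteq> A' \<and> seqvs.independent B' \<and> A' \<subseteq> seqvs.span B' \<and>
      (\<forall>V\<in>set \<beta>. A' \<inter> V \<subseteq> seqvs.span (B' \<inter> V))"
proof -
  obtain B' where B': "B \<subseteq> B'" "B' \<subseteq> A'" "seqvs.independent B'"
    "\<forall>V\<in>set \<beta>. A' \<inter> V \<subseteq> seqvs.span (B' \<inter> V)"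
    using chain_extend_aux[OF assms] by blast
  obtain C where C: "B' \<subseteq> C" "C \<subseteq> A'" "seqvs.independent C" "A' \<subseteq> seqvs.span C"
    using seqvs.maximal_independent_subset_extend[OF B'(2,3)] by blast
  have "B \<subseteq> C" using B'(1) C(1) by (rule subset_trans)
  moreover have "A' \<inter> V \<subseteq> seqvs.span (C \<inter> V)" if "V \<in> set \<beta>" for V
    using B'(4) that seqvs.span_mono[of "B' \<inter> V" "C \<inter> V"] C(1) by blast
  ultimately show ?thesis using C(2-4) by (intro exI[of _ C] conjI ballI)
qed

lemma two_chain_basis_aux:
  assumes \<beta>: "sorted_wrt (\<subseteq>) \<beta>" "\<forall>V\<in>set \<beta>. seqvs.subspace V"
  shows "sorted_wrt (\<subseteq>) \<alpha> \<Longrightarrow> \<forall>A\<in>set \<alpha>. seqvs.subspace A \<and> A \<subseteq> W \<Longrightarrow> seqvs.subspace W \<Longrightarrow>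
    \<exists>B. B \<subseteq> W \<and> seqvs.independent B \<and> W \<subseteq> seqvs.span B \<and>
      (\<forall>A\<in>set \<alpha>. A \<subseteq> seqvs.span (B \<inter> A)) \<and> (\<forall>V\<in>set \<beta>. W \<inter> V \<subseteq> seqvs.span (B \<inter> V))"
proof (induction \<alpha> arbitrary: W rule: rev_induct)
  case Nil
  have "\<forall>V\<in>set \<beta>. seqvs.subspace V \<and> {0} \<inter> V \<subseteq> seqvs.span ({} \<inter> V)"
    using \<beta>(2) seqvs.span_zero by auto
  then have "\<exists>B'. {} \<subseteq> B' \<and> B' \<subseteq> W \<and> seqvs.independent B' \<and> W \<subseteq> seqvs.span B' \<and>
      (\<forall>V\<in>set \<beta>. W \<inter> V \<subseteq> seqvs.span (B' \<inter> V))"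
    using Nil.prems(3) \<beta>(1) seqvs.subspace_0[OF Nil.prems(3)]
    by (intro chain_extend[of "{0}"]) (auto simp: seqvs.subspace_def seqvs.independent_empty)
  then show ?case by auto
next
  case (snoc A0 \<alpha>)
  have A0: "seqvs.subspace A0" "A0 \<subseteq> W" using snoc.prems by auto
  have "\<exists>B. B \<subseteq> A0 \<and> seqvs.independent B \<and> A0 \<subseteq> seqvs.span B \<and>
      (\<forall>A\<in>set \<alpha>. A \<subseteq> seqvs.span (B \<inter> A)) \<and> (\<forall>V\<in>set \<beta>. A0 \<inter> V \<subseteq> seqvs.span (B \<inter> V))"
    using snoc.prems by (intro snoc.IH) (auto simp: sorted_wrt_append)
  then obtain B where B: "B \<subseteq> A0" "seqvs.independent B" "A0 \<subseteq> seqvs.span B"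
    "\<forall>A\<in>set \<alpha>. A \<subseteq> seqvs.span (B \<inter> A)" "\<forall>V\<in>set \<beta>. A0 \<inter> V \<subseteq> seqvs.span (B \<inter> V)" by blast
  obtain C where C: "B \<subseteq> C" "C \<subseteq> W" "seqvs.independent C" "W \<subseteq> seqvs.span C"
    "\<forall>V\<in>set \<beta>. W \<inter> V \<subseteq> seqvs.span (C \<inter> V)"
    using chain_extend[OF A0(1) B(2,1,3) A0(2) snoc.prems(3) \<beta>(1)] B(5) \<beta>(2) by blast
  have "A \<subseteq> seqvs.span (C \<inter> A)" if "A \<in> set \<alpha>" for A
    using B(4) that seqvs.span_mono[of "B \<inter> A" "C \<inter> A"] C(1) by blast
  moreover have "A0 \<subseteq> seqvs.span (C \<inter> A0)"
    using B(1,3) seqvs.span_mono[of B "C \<inter> A0"] C(1) by blast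
  ultimately have "\<forall>A\<in>set (\<alpha> @ [A0]). A \<subseteq> seqvs.span (C \<inter> A)" by simp
  with C(2-5) have "C \<subseteq> W \<and> seqvs.independent C \<and> W \<subseteq> seqvs.span C \<and>
      (\<forall>A\<in>set (\<alpha> @ [A0]). A \<subseteq> seqvs.span (C \<inter> A)) \<and>
      (\<forall>V\<in>set \<beta>. W \<inter> V \<subseteq> seqvs.span (C \<inter> V))" by (intro conjI)
  then show ?case by (rule exI)
qed

text \<open>
  This is where two chains differ from three: already three lines in a plane have no common adapted
  basis.
\<close>

lemma two_chain_basis:
  assumes "sorted_wrt (\<subseteq>) \<alpha>" "sorted_wrt (\<subseteq>) \<beta>" "seqvs.subspace W"
    and "\<forall>A\<in>set \<alpha> \<union> set \<beta>. seqvs.subspace A \<and> A \<subseteq> W"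
  shows "\<exists>B. B \<subseteq> W \<and> seqvs.independent B \<and> W \<subseteq> seqvs.span B \<and>
      (\<forall>A\<in>set \<alpha> \<union> set \<beta>. A \<subseteq> seqvs.span (B \<inter> A))"
proof -
  obtain B where B: "B \<subseteq> W" "seqvs.independent B" "W \<subseteq> seqvs.span B"
    "\<forall>A\<in>set \<alpha>. A \<subseteq> seqvs.span (B \<inter> A)" "\<forall>V\<in>set \<beta>. W \<inter> V \<subseteq> seqvs.span (B \<inter> V)"
    using two_chain_basis_aux[of \<beta> \<alpha> W] assms by (metis UnCI)
  have "A \<subseteq> seqvs.span (B \<inter> A)" if "A \<in> set \<beta>" for A
  proof -
    have "W \<inter> A = A" using assms(4) that by blast
    then show ?thesis using B(5) that by metis
  qed
  then have "\<forall>A\<in>set \<alpha> \<union> set \<beta>. A \<subseteq> seqvs.span (B \<inter> A)" using B(4) by blast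
  with B(1-3) have "B \<subseteq> W \<and> seqvs.independent B \<and> W \<subseteq> seqvs.span B \<and>
      (\<forall>A\<in>set \<alpha> \<union> set \<beta>. A \<subseteq> seqvs.span (B \<inter> A))" by (intro conjI)
  then show ?thesis by (rule exI)
qed

text \<open>
  The zero map on \<open>Z\<close> and \<open>f\<close> on \<open>Y\<close> agree on \<open>Y \<inter> Z\<close>, so they can be glued along a basis of \<open>W\<close>
  adapted to both.
\<close>

lemma extend_by_zero:
  assumes W: "seqvs.subspace W" and Y: "seqvs.subspace Y" "Y \<subseteq> W" and Z: "seqvs.subspace Z" "Z \<subseteq> W"
    and f: "slin f" and YZ: "\<And>x. x \<in> Y \<Longrightarrow> x \<in> Z \<Longrightarrow> f x = 0"
  shows "\<exists>g. slin g \<and> (\<forall>x\<in>Y. g x = f x) \<and> (\<forall>x\<in>Z. g x = 0) \<and> g ` W \<subseteq> f ` Y"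
proof -
  obtain B where B: "B \<subseteq> W" "seqvs.independent B" "W \<subseteq> seqvs.span B"
    "Y \<subseteq> seqvs.span (B \<inter> Y)" "Z \<subseteq> seqvs.span (B \<inter> Z)"
    using two_chain_basis[of "[Y]" "[Z]" W] W Y Z by auto
  obtain g where g: "slin g" "\<forall>b\<in>B. g b = (if b \<in> Y then f b else 0)"
    using seqvp.linear_independent_extend[OF B(2), of "\<lambda>b. if b \<in> Y then f b else 0"] by blast
  have fY: "seqvs.subspace (f ` Y)" using f Y(1) by (rule slin_image_subspace)
  have "\<forall>x\<in>Y. g x = f x"
    using slin_eq_on_span[OF g(1) f, of "B \<inter> Y"] g(2) B(4) by auto
  moreover have "\<forall>x\<in>Z. g x = 0"
    using slin_span_into[OF g(1) seqvs.subspace_single_0, of "B \<inter> Z"] g(2) B(5) YZ by auto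
  moreover have "g ` W \<subseteq> f ` Y"
    using slin_span_into[OF g(1) fY, of B] g(2) B(3) seqvs.subspace_0[OF fY] by auto
  ultimately show ?thesis using g(1) by (intro exI[of _ g] conjI)
qed

section \<open>Fitting's lemma and isomorphism classes\<close>

lemma repD_comm:
  assumes "M \<in> rep p n" "(k, l) \<in> harrows p n" "(k, l) \<in> varrows p n" "x \<in> sp M (k, l)"
  shows "ver M (k, l + 1) (hor M (k, l) x) = hor M (k + 1, l) (ver M (k, l) x)"
  using assms unfolding rep_def by blast

lemma morphism_in: "morphism p n M N f \<Longrightarrow> v \<in> vertices p n \<Longrightarrow> x \<in> sp M v \<Longrightarrow> f v x \<in> sp N v"
  using morphismD(1) unfolding linear_between_def by blast

lemma morphism_id: "morphism p n M M (\<lambda>_ x. x)"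
  by (auto simp: morphism_def linear_between_def)

lemma morphism_comp:
  assumes f: "morphism p n L M f" and g: "morphism p n M N g"
  shows "morphism p n L N (\<lambda>v x. g v (f v x))"
  unfolding morphism_def
proof (intro conjI ballI; (clarify)?)
  fix a b assume "(a, b) \<in> vertices p n"
  then show "linear_between (sp L (a, b)) (sp N (a, b)) (\<lambda>x. g (a, b) (f (a, b) x))"
    using linear_between_comp morphismD(1)[OF f] morphismD(1)[OF g] unfolding comp_def by blast
next
  fix k l x assume h: "(k, l) \<in> harrows p n" "x \<in> sp L (k, l)"
  then have "f (k, l) x \<in> sp M (k, l)" using morphism_in[OF f] harrows_vertices by blast
  then show "g (k, l + 1) (f (k, l + 1) (hor L (k, l) x)) = hor N (k, l) (g (k, l) (f (k, l) x))"
    using morphismD(2)[OF f h] morphismD(2)[OF g h(1)] by simp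
next
  fix k l x assume h: "(k, l) \<in> varrows p n" "x \<in> sp L (k, l)"
  then have "f (k, l) x \<in> sp M (k, l)" using morphism_in[OF f] varrows_vertices by blast
  then show "g (k + 1, l) (f (k + 1, l) (ver L (k, l) x)) = ver N (k, l) (g (k, l) (f (k, l) x))"
    using morphismD(3)[OF f h] morphismD(3)[OF g h(1)] by simp
qed

lemma morphism_power:
  assumes "morphism p n M M f"
  shows "morphism p n M M (\<lambda>v. f v ^^ m)"
proof (induction m)
  case 0
  then show ?case using morphism_id[of p n M] by (simp add: id_def)
next
  case (Suc m)
  have "(\<lambda>v. f v ^^ Suc m) = (\<lambda>v x. f v ((f v ^^ m) x))" by (simp add: fun_eq_iff)
  then show ?case using morphism_comp[OF Suc assms] by simp
qed

lemma subrep_kernel: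
  assumes M: "M \<in> rep p n" and N: "N \<in> rep p n" and f: "morphism p n M N f"
  shows "subrep p n M (\<lambda>v. {x \<in> sp M v. f v x = 0})"
proof -
  have S: "seqvs.subspace (sp M v)" "seqvs.subspace (sp N v)" if "v \<in> vertices p n" for v
    using repD(1)[OF M that] repD(1)[OF N that] by (auto simp: fin_dim_subspace_def)
  have "seqvs.subspace {x \<in> sp M v. f v x = 0}" if v: "v \<in> vertices p n" for v
    using S(1)[OF v] morphismD(1)[OF f v] linear_between_zero[OF morphismD(1)[OF f v] S(1)[OF v]]
    by (auto simp: seqvs.subspace_def linear_between_def)
  moreover have "f (k, l + 1) (hor M (k, l) x) = 0 \<and> hor M (k, l) x \<in> sp M (k, l + 1)"
    if h: "(k, l) \<in> harrows p n" and x: "x \<in> sp M (k, l)" "f (k, l) x = 0" for k l x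
  proof -
    have "hor N (k, l) 0 = 0"
      using linear_between_zero[OF repD(2)[OF N h]] S(2) harrows_vertices[OF h] by blast
    then show ?thesis
      using morphismD(2)[OF f h x(1)] x repD(2)[OF M h] by (auto simp: linear_between_def)
  qed
  moreover have "f (k + 1, l) (ver M (k, l) x) = 0 \<and> ver M (k, l) x \<in> sp M (k + 1, l)"
    if h: "(k, l) \<in> varrows p n" and x: "x \<in> sp M (k, l)" "f (k, l) x = 0" for k l x
  proof -
    have "ver N (k, l) 0 = 0"
      using linear_between_zero[OF repD(3)[OF N h]] S(2) varrows_vertices[OF h] by blast
    then show ?thesis
      using morphismD(3)[OF f h x(1)] x repD(3)[OF M h] by (auto simp: linear_between_def)
  qed
  ultimately show ?thesis unfolding subrep_def by auto
qed

lemma subrep_image: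
  assumes M: "M \<in> rep p n" and f: "morphism p n M N f"
  shows "subrep p n N (\<lambda>v. f v ` sp M v)"
proof -
  have "seqvs.subspace (f v ` sp M v) \<and> f v ` sp M v \<subseteq> sp N v" if v: "v \<in> vertices p n" for v
    using linear_between_subspace_image[OF morphismD(1)[OF f v]] repD(1)[OF M v]
      morphism_in[OF f v] by (auto simp: fin_dim_subspace_def)
  moreover have "hor N (k, l) (f (k, l) x) \<in> f (k, l + 1) ` sp M (k, l + 1)"
    if h: "(k, l) \<in> harrows p n" and x: "x \<in> sp M (k, l)" for k l x
    using morphismD(2)[OF f h x] repD(2)[OF M h] x by (auto simp: linear_between_def intro: rev_image_eqI)
  moreover have "ver N (k, l) (f (k, l) x) \<in> f (k + 1, l) ` sp M (k + 1, l)"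
    if h: "(k, l) \<in> varrows p n" and x: "x \<in> sp M (k, l)" for k l x
    using morphismD(3)[OF f h x] repD(3)[OF M h] x by (auto simp: linear_between_def intro: rev_image_eqI)
  ultimately show ?thesis unfolding subrep_def by auto
qed

text \<open>
  Fitting's lemma, in the form in which it is used: the kernels of the powers of \<open>f\<close>
  become stationary, so \<open>M\<close> is the sum of the kernel and the image of a high power;
  the image contains the fixed vector \<open>x\<close>, so indecomposability kills the kernel.
\<close>

lemma fixing_endomorphism_bij:
  assumes M: "M \<in> rep p n" and ind: "indecomposable p n M" and f: "morphism p n M M f"
    and x: "v \<in> vertices p n" "x \<in> sp M v" "x \<noteq> 0" "f v x = x"
    and w: "w \<in> vertices p n"
  shows "bij_betw (f w) (sp M w) (sp M w)"
proof -
  define K where "K m v = {x \<in> sp M v. (f v ^^ m) x = 0}" for m v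
  note pow = morphism_power[OF f]
  have subK: "subrep p n M (K m)" for m unfolding K_def by (rule subrep_kernel[OF M M pow])
  have subI: "subrep p n M (\<lambda>v. (f v ^^ m) ` sp M v)" for m by (rule subrep_image[OF M pow])
  have S: "seqvs.subspace (sp M v)" if "v \<in> vertices p n" for v
    using repD(1)[OF M that] by (simp add: fin_dim_subspace_def)
  have f0: "(f v ^^ m) 0 = 0" if "v \<in> vertices p n" for m v
    using linear_between_zero[OF morphismD(1)[OF pow that] S[OF that]] .
  have Kmono: "K m v \<subseteq> K (i + m) v" if "v \<in> vertices p n" for m i v
    using f0[OF that] by (auto simp: K_def funpow_add)
  have fK: "fin_dim_subspace (K m v)" if "v \<in> vertices p n" for m v
    using fin_dim_subset[OF repD(1)[OF M that]] subrepD(1,2)[OF subK that] by blast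
  define d where "d m = (\<Sum>v\<in>vertices p n. seqvs.dim (K m v))" for m
  have "d m \<le> (\<Sum>v\<in>vertices p n. seqvs.dim (sp M v))" for m
    unfolding d_def using fin_dim_le[OF repD(1)[OF M]] subrepD(1,2)[OF subK] by (intro sum_mono) blast
  then obtain m0 where m0: "\<And>m. d m \<le> d m0"
    using ex_has_greatest_nat[of "\<lambda>_. True" 0 d "Suc (\<Sum>v\<in>vertices p n. seqvs.dim (sp M v))"]
    by (auto simp: less_Suc_eq_le)
  \<comment> \<open>The successor makes the exponent positive, so that the kernel of \<open>f\<close> itself is covered.\<close>
  define m where "m = Suc m0"
  have finV: "finite (vertices p n)" by (simp add: vertices_def)
  have Kstat: "K (m + m) v = K m v" if v: "v \<in> vertices p n" for v
  proof (rule ccontr)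
    assume "K (m + m) v \<noteq> K m v"
    then have "K m v \<subset> K (m + m) v" using Kmono[OF v] by blast
    then have lt: "seqvs.dim (K m v) < seqvs.dim (K (m + m) v)"
      using fin_dim_psubset[OF fK[OF v]] subrepD(1)[OF subK v] by blast
    have le: "seqvs.dim (K i u) \<le> seqvs.dim (K (j + i) u)" if "u \<in> vertices p n" for u i j
      using fin_dim_le[OF fK[OF that]] subrepD(1)[OF subK that] Kmono[OF that] by blast
    have "d m < d (m + m)"
      unfolding d_def using finV le lt v by (intro sum_strict_mono_ex1) blast+
    moreover have "d m0 \<le> d m"
      unfolding d_def m_def using le[of _ m0 1] by (intro sum_mono) auto
    ultimately show False using m0[of "m + m"] by simp
  qed
  define I where "I v = (f v ^^ m) ` sp M v" for v
  have mem: "(f v ^^ m) y \<in> sp M v" if "v \<in> vertices p n" "y \<in> sp M v" for v y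
    using morphism_in[OF pow that] .
  have IK: "I v \<inter> K m v = {0}" if v: "v \<in> vertices p n" for v
  proof
    show "I v \<inter> K m v \<subseteq> {0}"
    proof
      fix y assume "y \<in> I v \<inter> K m v"
      then obtain z where z: "z \<in> sp M v" "y = (f v ^^ m) z" "(f v ^^ m) y = 0"
        by (auto simp: I_def K_def)
      then have "z \<in> K (m + m) v" by (simp add: K_def funpow_add)
      then have "z \<in> K m v" using Kstat[OF v] by blast
      then show "y \<in> {0}" using z(2) by (simp add: K_def)
    qed
    show "{0} \<subseteq> I v \<inter> K m v"
      using seqvs.subspace_0[OF subrepD(1)[OF subK v]] seqvs.subspace_0[OF subrepD(1)[OF subI v]]
      by (simp add: I_def)
  qed
  have sum: "sp M v = {u + w | u w. u \<in> K m v \<and> w \<in> I v}" if v: "v \<in> vertices p n" for v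
  proof
    show "{u + w | u w. u \<in> K m v \<and> w \<in> I v} \<subseteq> sp M v"
      using S[OF v] mem[OF v] by (auto simp: K_def I_def seqvs.subspace_add)
    have IM: "I v \<subseteq> sp M v" using mem[OF v] by (auto simp: I_def)
    have "(f v ^^ m) ` I v = I v"
    proof (rule injective_endo_onto)
      show "fin_dim_subspace (I v)"
        using fin_dim_subset[OF repD(1)[OF M v]] subrepD(1,2)[OF subI v] unfolding I_def by blast
      have "(f v ^^ m) ` I v \<subseteq> I v" using image_mono[OF IM, of "f v ^^ m"] by (simp only: I_def)
      then show "linear_between (I v) (I v) (f v ^^ m)"
        by (rule linear_between_mono[OF morphismD(1)[OF pow v] IM])
      show "z = 0" if "z \<in> I v" "(f v ^^ m) z = 0" for z
        using IK[OF v] IM that by (auto simp: K_def)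
    qed
    then have onto: "\<exists>z\<in>I v. (f v ^^ m) y = (f v ^^ m) z" if "y \<in> sp M v" for y
      using that by (metis I_def image_iff)
    show "sp M v \<subseteq> {u + w | u w. u \<in> K m v \<and> w \<in> I v}"
    proof
      fix y assume y: "y \<in> sp M v"
      obtain z where z: "z \<in> I v" "(f v ^^ m) y = (f v ^^ m) z" using onto[OF y] by blast
      have zM: "z \<in> sp M v" using z(1) IM by blast
      have d: "y - z \<in> sp M v" using S[OF v] y zM by (rule seqvs.subspace_diff)
      have "(f v ^^ m) ((y - z) + z) = (f v ^^ m) (y - z) + (f v ^^ m) z"
        using morphismD(1)[OF pow v] d zM unfolding linear_between_def by blast
      then have "(f v ^^ m) (y - z) = 0" using z(2) by simp
      then have "y - z \<in> K m v" using d by (simp add: K_def)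
      moreover have "y = (y - z) + z" by simp
      ultimately show "y \<in> {u + w | u w. u \<in> K m v \<and> w \<in> I v}" using z(1) by blast
    qed
  qed
  have dir: "direct_sum_of p n M (K m) I"
    unfolding direct_sum_of_def using subK subI[of m, folded I_def] sum IK by (simp add: Int_commute)
  have "(f v ^^ i) x = x" for i by (induction i) (simp_all add: x)
  then have "x \<in> I v" using x(2) by (metis I_def image_eqI)
  then have "nonzero_on p n I" using x(1,3) unfolding nonzero_on_def by blast
  then have "\<not> nonzero_on p n (K m)" using ind dir unfolding indecomposable_def by blast
  then have Kw: "K m w = {0}" using w unfolding nonzero_on_def by blast
  have ker: "y = 0" if "y \<in> sp M w" "f w y = 0" for y
  proof -
    have "(f w ^^ m) y = (f w ^^ m0) (f w y)" by (simp add: m_def funpow_swap1)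
    then have "y \<in> K m w" using that f0[OF w] by (simp add: K_def)
    then show ?thesis using Kw by blast
  qed
  have "f w ` sp M w = sp M w"
    using injective_endo_onto[OF repD(1)[OF M w] morphismD(1)[OF f w]] ker by blast
  moreover have "inj_on (f w) (sp M w)"
  proof (rule inj_onI)
    fix y z assume yz: "y \<in> sp M w" "z \<in> sp M w" "f w y = f w z"
    then have d: "y - z \<in> sp M w" using seqvs.subspace_diff[OF S[OF w]] by blast
    have "f w ((y - z) + z) = f w (y - z) + f w z"
      using morphismD(1)[OF f w] d yz(2) unfolding linear_between_def by blast
    then have "f w (y - z) = 0" using yz(3) by simp
    then have "y - z = 0" using ker d by blast
    then show "y = z" by (rule eq_iff_diff_eq_0[THEN iffD2])
  qed
  ultimately show ?thesis by (simp add: bij_betw_def)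
qed

text \<open>
  For indecomposables it is enough that two morphisms are inverse to each other on a single nonzero
  vector.
\<close>

lemma isomorphic_if_mutually_inverse_at:
  assumes M: "M \<in> rep p n" "indecomposable p n M" and N: "N \<in> rep p n" "indecomposable p n N"
    and f: "morphism p n M N f" and g: "morphism p n N M g" and v: "v \<in> vertices p n"
    and x: "x \<in> sp M v" "x \<noteq> 0" "g v (f v x) = x" "f v x \<noteq> 0"
  shows "isomorphic p n M N"
proof -
  have "bij_betw (f u) (sp M u) (sp N u)" if u: "u \<in> vertices p n" for u
  proof -
    have gf: "bij_betw (\<lambda>y. g u (f u y)) (sp M u) (sp M u)"
      using fixing_endomorphism_bij[OF M morphism_comp[OF f g] v x(1,2) _ u] x(3) by simp
    have fg: "bij_betw (\<lambda>y. f u (g u y)) (sp N u) (sp N u)"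
      using fixing_endomorphism_bij[OF N morphism_comp[OF g f] v morphism_in[OF f v x(1)] x(4) _ u]
        x(3) by simp
    have "inj_on (f u) (sp M u)" using gf unfolding bij_betw_def inj_on_def by metis
    moreover have "f u ` sp M u = sp N u"
      using fg morphism_in[OF f u] morphism_in[OF g u] unfolding bij_betw_def by blast
    ultimately show ?thesis by (simp add: bij_betw_def)
  qed
  then show ?thesis using f unfolding isomorphic_def by blast
qed

lemma finite_classes_if_classified:
  assumes A: "A \<subseteq> rep p n" and fin: "finite (c ` A)"
    and iso: "\<And>M N. M \<in> A \<Longrightarrow> N \<in> A \<Longrightarrow> c M = c N \<Longrightarrow> isomorphic p n M N"
  shows "finite (A // iso_rel p n)"
proof -
  define r where "r t = iso_rel p n `` {SOME M. M \<in> A \<and> c M = t}" for t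
  have "iso_rel p n `` {M} = r (c M)" if M: "M \<in> A" for M
  proof -
    have "(SOME N. N \<in> A \<and> c N = c M) \<in> A \<and> c (SOME N. N \<in> A \<and> c N = c M) = c M"
      by (rule someI[of _ M]) (simp add: M)
    then have "(M, SOME N. N \<in> A \<and> c N = c M) \<in> iso_rel p n"
      using iso[OF M] A M unfolding iso_rel_def by auto
    then show ?thesis unfolding r_def by (rule equiv_class_eq[OF equiv_iso_rel])
  qed
  then have "A // iso_rel p n \<subseteq> r ` c ` A" unfolding quotient_def by blast
  then show ?thesis using fin finite_surj by (metis finite_imageI finite_subset)
qed

lemma finite_classes_mono:
  "finite (B // iso_rel p n) \<Longrightarrow> A \<subseteq> B \<Longrightarrow> finite (A // iso_rel p n)"
  by (rule finite_subset[of _ "B // iso_rel p n"]) (auto simp: quotient_def)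

lemma finite_classes_Un:
  "finite (A // iso_rel p n) \<Longrightarrow> finite (B // iso_rel p n) \<Longrightarrow> finite ((A \<union> B) // iso_rel p n)"
  by (simp add: quotient_def)

section \<open>Subspaces of the last column described by lattice terms\<close>

lemma rep_inj_rep: "M \<in> rep_inj p n \<Longrightarrow> M \<in> rep p n"
  by (simp add: rep_inj_def)

lemma subrep_self: "M \<in> rep p n \<Longrightarrow> subrep p n M (sp M)"
  unfolding subrep_def using repD[of M p n] by (fastforce simp: fin_dim_subspace_def linear_between_def)

lemma sp_subspace: "M \<in> rep p n \<Longrightarrow> v \<in> vertices p n \<Longrightarrow> seqvs.subspace (sp M v)"
  using repD(1) unfolding fin_dim_subspace_def by blast

lemma rep_inj_fewer_rows:
  assumes "M \<in> rep_inj p n" "m \<le> n"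
  shows "M \<in> rep_inj p m"
proof -
  have "vertices p m \<subseteq> vertices p n" "harrows p m \<subseteq> harrows p n" "varrows p m \<subseteq> varrows p n"
    using assms(2) by (auto simp: vertices_def harrows_def varrows_def)
  then show ?thesis using assms(1) unfolding rep_inj_def rep_def by blast
qed

definition to_last :: "nat \<Rightarrow> 'k quiver_rep \<Rightarrow> nat \<Rightarrow> nat \<Rightarrow> (nat \<Rightarrow> 'k) \<Rightarrow> (nat \<Rightarrow> 'k)"
  where "to_last p M k l = push M k (p - l) l"

lemma to_last_last [simp]: "to_last p M k p x = x"
  by (simp add: to_last_def)

lemma to_last_hor: "1 \<le> l \<Longrightarrow> l < p \<Longrightarrow> to_last p M k (Suc l) (hor M (k, l) x) = to_last p M k l x"
  by (cases "p - l") (simp_all add: to_last_def Suc_diff_Suc[symmetric])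

context
  fixes p n :: nat and M :: "'k::field quiver_rep" and k :: nat
  assumes M: "M \<in> rep_inj p n" and k: "k \<in> {1..n}"
begin

lemma to_last_linear: "l \<in> {1..p} \<Longrightarrow> linear_between (sp M (k, l)) (sp M (k, p)) (to_last p M k l)"
  using push_linear[OF rep_inj_rep[OF M] subrep_self[OF rep_inj_rep[OF M]] k, of l "p - l"]
  by (simp add: to_last_def)

lemma to_last_in: "l \<in> {1..p} \<Longrightarrow> x \<in> sp M (k, l) \<Longrightarrow> to_last p M k l x \<in> sp M (k, p)"
  using to_last_linear unfolding linear_between_def by blast

lemma to_last_inj:
  assumes l: "l \<in> {1..p}"
  shows "inj_on (to_last p M k l) (sp M (k, l))"
proof (rule inj_onI)
  fix x y assume xy: "x \<in> sp M (k, l)" "y \<in> sp M (k, l)" "to_last p M k l x = to_last p M k l y"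
  have "seqvs.subspace (sp M (k, l))"
    using sp_subspace[OF rep_inj_rep[OF M]] k l by (simp add: vertices_def)
  then have d: "x - y \<in> sp M (k, l)" using xy by (simp add: seqvs.subspace_diff)
  have "to_last p M k l ((x - y) + y) = to_last p M k l (x - y) + to_last p M k l y"
    using to_last_linear[OF l] d xy(2) unfolding linear_between_def by blast
  then have "to_last p M k l (x - y) = 0" using xy(3) by simp
  moreover have "push M k (p - l) l (x - y) \<noteq> 0" if "x - y \<noteq> 0"
    using push_nonzero[OF M subrep_self[OF rep_inj_rep[OF M]] k _ _ d that, of "p - l"] l by simp
  ultimately have "x - y = 0" unfolding to_last_def by blast
  then show "x = y" by (rule eq_iff_diff_eq_0[THEN iffD2])
qed

lemma to_last_ver:
  assumes kn: "k < n" and l: "1 \<le> l" "l \<le> p" and x: "x \<in> sp M (k, l)"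
  shows "ver M (k, p) (to_last p M k l x) = to_last p M (Suc k) l (ver M (k, l) x)"
proof -
  have "\<And>x. x \<in> sp M (k, p - r) \<Longrightarrow> r < p \<Longrightarrow>
      ver M (k, p) (to_last p M k (p - r) x) = to_last p M (Suc k) (p - r) (ver M (k, p - r) x)" for r
  proof (induction r)
    case (Suc r)
    let ?l = "p - Suc r"
    have h: "(k, ?l) \<in> harrows p n" "(k, ?l) \<in> varrows p n" and l: "1 \<le> ?l" "?l < p"
      using k kn Suc.prems by (auto simp: harrows_def varrows_def)
    have s: "Suc ?l = p - r" using Suc.prems by simp
    have "hor M (k, ?l) x \<in> sp M (k, p - r)"
      using repD(2)[OF rep_inj_rep[OF M] h(1)] Suc.prems s by (auto simp: linear_between_def)
    then have "ver M (k, p) (to_last p M k (p - r) (hor M (k, ?l) x)) =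
        to_last p M (Suc k) (p - r) (ver M (k, p - r) (hor M (k, ?l) x))"
      using Suc by simp
    also have "ver M (k, p - r) (hor M (k, ?l) x) = hor M (Suc k, ?l) (ver M (k, ?l) x)"
      using repD_comm[OF rep_inj_rep[OF M] h Suc.prems(1)] s by simp
    finally show ?case using to_last_hor[OF l] s by metis
  qed simp
  from this[of x "p - l"] l x show ?thesis by simp
qed

end

lemma morphism_to_last:
  assumes M: "M \<in> rep p n" and f: "morphism p n M N f" and k: "k \<in> {1..n}"
    and l: "1 \<le> l" "l \<le> p" and x: "x \<in> sp M (k, l)"
  shows "f (k, p) (to_last p M k l x) = to_last p N k l (f (k, l) x)"
proof -
  have "\<And>x. x \<in> sp M (k, p - r) \<Longrightarrow> r < p \<Longrightarrow>
      f (k, p) (to_last p M k (p - r) x) = to_last p N k (p - r) (f (k, p - r) x)" for r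
  proof (induction r)
    case (Suc r)
    let ?l = "p - Suc r"
    have h: "(k, ?l) \<in> harrows p n" and l: "1 \<le> ?l" "?l < p"
      using k Suc.prems by (auto simp: harrows_def)
    have s: "Suc ?l = p - r" using Suc.prems by simp
    have "hor M (k, ?l) x \<in> sp M (k, p - r)"
      using repD(2)[OF M h(1)] Suc.prems s by (auto simp: linear_between_def)
    then have "f (k, p) (to_last p M k (p - r) (hor M (k, ?l) x)) =
        to_last p N k (p - r) (f (k, p - r) (hor M (k, ?l) x))"
      using Suc by simp
    also have "f (k, p - r) (hor M (k, ?l) x) = hor N (k, ?l) (f (k, ?l) x)"
      using morphismD(2)[OF f h Suc.prems(1)] s by simp
    finally show ?case using to_last_hor[OF l] s by metis
  qed simp
  from this[of x "p - l"] l x show ?thesis by simp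
qed

text \<open>
  Formal expressions for subspaces of the last column: members of the flag of the current row, images
  of subspaces of the previous row, meets and joins.
\<close>

datatype lterm = Fl nat | Img lterm | Mt lterm lterm | Jn lterm lterm

text \<open>
  The conventions for degenerate terms (the zero space for \<open>Fl 0\<close> and for images into the first row, the
  whole space for \<open>Fl b\<close> with \<open>b \<ge> p\<close>) make the inclusion test below sound for all terms.
\<close>

fun ev :: "nat \<Rightarrow> 'k::field quiver_rep \<Rightarrow> nat \<Rightarrow> lterm \<Rightarrow> (nat \<Rightarrow> 'k) set" where
  "ev p M k (Fl b) = (if b = 0 then {0} else to_last p M k (min b p) ` sp M (k, min b p))"
| "ev p M k (Img t) = (if k \<le> 1 then {0} else ver M (k - 1, p) ` ev p M (k - 1) t)"
| "ev p M k (Mt s t) = ev p M k s \<inter> ev p M k t"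
| "ev p M k (Jn s t) = {x + y | x y. x \<in> ev p M k s \<and> y \<in> ev p M k t}"

lemma ev_whole: "p \<ge> 1 \<Longrightarrow> ev p M k (Fl p) = sp M (k, p)"
  by (auto simp: image_def)

lemma ev_subspace:
  assumes M: "M \<in> rep_inj p n" and p: "p \<ge> 1"
  shows "k \<in> {1..n} \<Longrightarrow> seqvs.subspace (ev p M k t) \<and> ev p M k t \<subseteq> sp M (k, p)"
proof (induction t arbitrary: k)
  case (Fl b)
  have v: "(k, p) \<in> vertices p n" using Fl p by (simp add: vertices_def)
  show ?case
  proof (cases "b = 0")
    case True
    then show ?thesis
      using seqvs.subspace_0[OF sp_subspace[OF rep_inj_rep[OF M] v]] by (simp add: seqvs.subspace_single_0)
  next
    case False
    define l where "l = min b p"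
    have l: "l \<in> {1..p}" using False p by (simp add: l_def)
    have "seqvs.subspace (sp M (k, l))"
      using sp_subspace[OF rep_inj_rep[OF M]] Fl l by (simp add: vertices_def)
    from linear_between_subspace_image[OF to_last_linear[OF M Fl l] this]
    show ?thesis using False to_last_in[OF M Fl l] by (auto simp: l_def)
  qed
next
  case (Img t)
  have v: "(k, p) \<in> vertices p n" using Img p by (simp add: vertices_def)
  show ?case
  proof (cases "k \<le> 1")
    case True
    then show ?thesis
      using seqvs.subspace_0[OF sp_subspace[OF rep_inj_rep[OF M] v]] by (simp add: seqvs.subspace_single_0)
  next
    case False
    then have k: "k - 1 \<in> {1..n}" and a: "(k - 1, p) \<in> varrows p n"
      using Img.prems p by (auto simp: varrows_def)
    have L: "linear_between (sp M (k - 1, p)) (sp M (k, p)) (ver M (k - 1, p))"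
      using repD(3)[OF rep_inj_rep[OF M] a] False by simp
    have S: "seqvs.subspace (ev p M (k - 1) t)" "ev p M (k - 1) t \<subseteq> sp M (k - 1, p)"
      using Img.IH[OF k] by auto
    have "ver M (k - 1, p) ` ev p M (k - 1) t \<subseteq> sp M (k, p)"
      using L S(2) by (auto simp: linear_between_def)
    then show ?thesis
      using linear_between_subspace_image[OF linear_between_mono[OF L S(2)] S(1)] False by simp
  qed
next
  case (Mt s t)
  then show ?case by (auto intro: seqvs.subspace_inter)
next
  case (Jn s t)
  have "seqvs.subspace (sp M (k, p))"
    using sp_subspace[OF rep_inj_rep[OF M]] Jn.prems p by (simp add: vertices_def)
  then show ?case
    using Jn.IH[OF Jn.prems] by (auto intro: seqvs.subspace_sums seqvs.subspace_add)
qed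

lemma flag_mono:
  assumes M: "M \<in> rep_inj p n" and k: "k \<in> {1..n}" and b: "1 \<le> b" "b \<le> c" "c \<le> p"
  shows "to_last p M k b ` sp M (k, b) \<subseteq> to_last p M k c ` sp M (k, c)"
  using b(2,1,3)
proof (induction c rule: dec_induct)
  case (step d)
  have h: "(k, d) \<in> harrows p n" using step k by (simp add: harrows_def)
  have "to_last p M k d ` sp M (k, d) \<subseteq> to_last p M k (Suc d) ` sp M (k, Suc d)"
  proof
    fix y assume "y \<in> to_last p M k d ` sp M (k, d)"
    then obtain x where x: "x \<in> sp M (k, d)" "y = to_last p M k d x" by blast
    then have "y = to_last p M k (Suc d) (hor M (k, d) x)" using to_last_hor[of d p M k x] step by simp
    moreover have "hor M (k, d) x \<in> sp M (k, Suc d)"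
      using repD(2)[OF rep_inj_rep[OF M] h] x(1) by (simp add: linear_between_def)
    ultimately show "y \<in> to_last p M k (Suc d) ` sp M (k, Suc d)" by blast
  qed
  then show ?case using step by auto
qed simp

text \<open>
  Whitman's procedure for inequalities in a free lattice, with two additional facts: images are
  monotone, and vertical maps preserve flags.
\<close>

fun le :: "lterm \<Rightarrow> lterm \<Rightarrow> bool" where
  "le (Jn s s') t = (le s t \<and> le s' t)"
| "le s (Mt t t') = (le s t \<and> le s t')"
| "le (Mt s s') (Jn t t') =
    (le s (Jn t t') \<or> le s' (Jn t t') \<or> le (Mt s s') t \<or> le (Mt s s') t')"
| "le (Mt s s') t = (le s t \<or> le s' t)"
| "le s (Jn t t') = (le s t \<or> le s t')"
| "le (Fl b) (Fl c) = (b \<le> c)"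
| "le (Fl b) (Img t) = (b = 0)"
| "le (Img s) (Fl c) = le s (Fl c)"
| "le (Img s) (Img t) = le s t"

lemma ev_join_upper:
  assumes "M \<in> rep_inj p n" "p \<ge> 1" "k \<in> {1..n}"
  shows "ev p M k s \<subseteq> ev p M k (Jn s t)" "ev p M k t \<subseteq> ev p M k (Jn s t)"
proof -
  have "0 \<in> ev p M k s" "0 \<in> ev p M k t"
    using ev_subspace[OF assms] seqvs.subspace_0 by blast+
  then show "ev p M k s \<subseteq> ev p M k (Jn s t)" "ev p M k t \<subseteq> ev p M k (Jn s t)"
    by (force, force)
qed

lemma ev_join_least:
  assumes "M \<in> rep_inj p n" "p \<ge> 1" "k \<in> {1..n}"
    and "ev p M k s \<subseteq> ev p M k u" "ev p M k t \<subseteq> ev p M k u"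
  shows "ev p M k (Jn s t) \<subseteq> ev p M k u"
  using ev_subspace[OF assms(1-3), of u] assms(4,5) by (auto intro: seqvs.subspace_add)

lemma le_sound:
  assumes M: "M \<in> rep_inj p n" and p: "p \<ge> 1"
  shows "le s t \<Longrightarrow> k \<in> {1..n} \<Longrightarrow> ev p M k s \<subseteq> ev p M k t"
proof (induction s t arbitrary: k rule: le.induct)
  case (1 s s' t)
  then show ?case by (intro ev_join_least[OF M p]) auto
next
  case (3 s s' t t')
  note upper = ev_join_upper[OF M p "3.prems"(2)]
  from "3.prems"(1) consider "le s (Jn t t')" | "le s' (Jn t t')" | "le (Mt s s') t" | "le (Mt s s') t'"
    by auto
  then show ?case
  proof cases
    case 1
    then show ?thesis using "3.IH"(1)[OF 1 "3.prems"(2)] by auto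
  next
    case 2
    then show ?thesis using "3.IH"(2)[OF 2 "3.prems"(2)] by auto
  next
    case 3
    then show ?thesis using order_trans[OF "3.IH"(3)[OF 3 "3.prems"(2)] upper(1)] by blast
  next
    case 4
    then show ?thesis using order_trans[OF "3.IH"(4)[OF 4 "3.prems"(2)] upper(2)] by blast
  qed
next
  case ("5_1" v t t')
  note upper = ev_join_upper[OF M p "5_1.prems"(2)]
  from "5_1.prems"(1) have "le (Fl v) t \<or> le (Fl v) t'" by simp
  then show ?case
  proof
    assume "le (Fl v) t"
    from order_trans[OF "5_1.IH"(1)[OF this "5_1.prems"(2)] upper(1)] show ?thesis .
  next
    assume "le (Fl v) t'"
    from order_trans[OF "5_1.IH"(2)[OF this "5_1.prems"(2)] upper(2)] show ?thesis .
  qed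
next
  case ("5_2" v t t')
  note upper = ev_join_upper[OF M p "5_2.prems"(2)]
  from "5_2.prems"(1) have "le (Img v) t \<or> le (Img v) t'" by simp
  then show ?case
  proof
    assume "le (Img v) t"
    from order_trans[OF "5_2.IH"(1)[OF this "5_2.prems"(2)] upper(1)] show ?thesis .
  next
    assume "le (Img v) t'"
    from order_trans[OF "5_2.IH"(2)[OF this "5_2.prems"(2)] upper(2)] show ?thesis .
  qed
next
  case (6 b c)
  show ?case
  proof (cases "b = 0")
    case True
    then show ?thesis using ev_subspace[OF M p 6(2), of "Fl c"] by (simp add: seqvs.subspace_0)
  next
    case False
    then show ?thesis using flag_mono[OF M 6(2), of "min b p" "min c p"] 6(1) p by simp
  qed
next
  case (7 b t)
  then show ?case using ev_subspace[OF M p 7(2), of "Img t"] by (simp add: seqvs.subspace_0)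
next
  case (8 s c)
  show ?case
  proof (cases "k \<le> 1")
    case True
    then show ?thesis using ev_subspace[OF M p 8(3), of "Fl c"] by (simp add: seqvs.subspace_0)
  next
    case False
    then have k: "k - 1 \<in> {1..n}" "k - 1 < n" "Suc (k - 1) = k" and a: "(k - 1, p) \<in> varrows p n"
      using 8(3) p by (auto simp: varrows_def)
    have IH: "ev p M (k - 1) s \<subseteq> ev p M (k - 1) (Fl c)" using 8 k by simp
    have "ver M (k - 1, p) ` ev p M (k - 1) (Fl c) \<subseteq> ev p M k (Fl c)"
    proof (cases "c = 0")
      case True
      have "seqvs.subspace (sp M (k - 1, p))"
        using sp_subspace[OF rep_inj_rep[OF M]] k p by (simp add: vertices_def)
      then show ?thesis
        using True linear_between_zero[OF repD(3)[OF rep_inj_rep[OF M] a]] by simp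
    next
      case c: False
      define l where "l = min c p"
      have l: "1 \<le> l" "l \<le> p" using c p by (simp_all add: l_def)
      have a': "(k - 1, l) \<in> varrows p n" using a l by (simp add: varrows_def)
      have "ver M (k - 1, l) x \<in> sp M (k, l)" if "x \<in> sp M (k - 1, l)" for x
        using repD(3)[OF rep_inj_rep[OF M] a'] that k(3) by (simp add: linear_between_def)
      then show ?thesis using c to_last_ver[OF M k(1,2) l] k(3) unfolding l_def by auto
    qed
    with image_mono[OF IH, of "ver M (k - 1, p)"]
    have "ver M (k - 1, p) ` ev p M (k - 1) s \<subseteq> ev p M k (Fl c)" by (rule order_trans)
    then show ?thesis using False by (simp del: ev.simps(1))
  qed
next
  case (9 s t)
  show ?case
  proof (cases "k \<le> 1")
    case False
    then have "k - 1 \<in> {1..n}" using "9.prems" by auto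
    from "9.IH"[OF _ this] "9.prems" have "ev p M (k - 1) s \<subseteq> ev p M (k - 1) t" by simp
    then show ?thesis using False by (auto simp: image_mono)
  qed simp
qed (simp del: ev.simps(1,2); blast)+

section \<open>Lifting linear maps to morphisms\<close>

text \<open>
  The class \<open>X\<close> is a parameter because after a restriction to a subspace the representations on which
  it vanishes have to be treated separately.
\<close>

definition full_on :: "nat \<Rightarrow> nat \<Rightarrow> 'k::field quiver_rep set \<Rightarrow> lterm \<Rightarrow> lterm list \<Rightarrow> bool"
  where "full_on p k X w ts \<longleftrightarrow> (\<forall>M\<in>X. \<forall>N\<in>X. \<forall>\<sigma>. slin \<sigma> \<longrightarrow>
    (\<forall>t\<in>set (w # ts). \<sigma> ` ev p M k t \<subseteq> ev p N k t) \<longrightarrow>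
    (\<exists>f. morphism p k M N f \<and> (\<forall>x\<in>ev p M k w. f (k, p) x = \<sigma> x)))"

lemma full_onD:
  assumes "full_on p k X w ts" "M \<in> X" "N \<in> X" "slin \<sigma>"
    and "\<And>t. t \<in> set (w # ts) \<Longrightarrow> \<sigma> ` ev p M k t \<subseteq> ev p N k t"
  shows "\<exists>f. morphism p k M N f \<and> (\<forall>x\<in>ev p M k w. f (k, p) x = \<sigma> x)"
  using assms unfolding full_on_def by blast

text \<open>
  Horizontal maps are injective, so a map of the last spaces of two rows that respects the flags
  determines the maps in the other columns.
\<close>

lemma lift_to_row:
  assumes M: "M \<in> rep_inj p n" and N: "N \<in> rep_inj p n" and p: "p \<ge> 1" and k: "k \<in> {1..n}"
    and \<sigma>: "slin \<sigma>" and flags: "\<And>b. b \<in> {1..p} \<Longrightarrow> \<sigma> ` ev p M k (Fl b) \<subseteq> ev p N k (Fl b)"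
  shows "\<exists>g. (\<forall>l\<in>{1..p}. linear_between (sp M (k, l)) (sp N (k, l)) (g l)) \<and>
    (\<forall>l\<in>{1..<p}. \<forall>x\<in>sp M (k, l). g (l + 1) (hor M (k, l) x) = hor N (k, l) (g l x)) \<and>
    (\<forall>l\<in>{1..p}. \<forall>x\<in>sp M (k, l). to_last p N k l (g l x) = \<sigma> (to_last p M k l x))"
proof -
  define g where "g l x = inv_into (sp N (k, l)) (to_last p N k l) (\<sigma> (to_last p M k l x))" for l x
  have g: "g l x \<in> sp N (k, l) \<and> to_last p N k l (g l x) = \<sigma> (to_last p M k l x)"
    if l: "l \<in> {1..p}" and x: "x \<in> sp M (k, l)" for l x
  proof -
    have "\<sigma> (to_last p M k l x) \<in> to_last p N k l ` sp N (k, l)"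
      using flags[OF l] x l by (auto simp: min_def)
    then show ?thesis unfolding g_def by (simp add: inv_into_into f_inv_into_f)
  qed
  have eqI: "y = z" if "l \<in> {1..p}" "y \<in> sp N (k, l)" "z \<in> sp N (k, l)"
    "to_last p N k l y = to_last p N k l z" for l y z
    using inj_onD[OF to_last_inj[OF N k that(1)] that(4,2,3)] .
  have "linear_between (sp M (k, l)) (sp N (k, l)) (g l)" if l: "l \<in> {1..p}" for l
  proof -
    have v: "(k, l) \<in> vertices p n" using k l by (simp add: vertices_def)
    have SM: "seqvs.subspace (sp M (k, l))" and SN: "seqvs.subspace (sp N (k, l))"
      using sp_subspace[OF rep_inj_rep v] M N by auto
    note LM = to_last_linear[OF M k l, unfolded linear_between_def]
    note LN = to_last_linear[OF N k l, unfolded linear_between_def]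
    have "g l (x + y) = g l x + g l y" if "x \<in> sp M (k, l)" "y \<in> sp M (k, l)" for x y
    proof (rule eqI[OF l])
      have xy: "x + y \<in> sp M (k, l)" using SM that by (rule seqvs.subspace_add)
      show "g l (x + y) \<in> sp N (k, l)" "g l x + g l y \<in> sp N (k, l)"
        using g[OF l] that xy SN by (auto intro: seqvs.subspace_add)
      show "to_last p N k l (g l (x + y)) = to_last p N k l (g l x + g l y)"
        using g[OF l] that xy LM LN by (simp add: slin_add[OF \<sigma>])
    qed
    moreover have "g l (c *\<^sub>s x) = c *\<^sub>s g l x" if "x \<in> sp M (k, l)" for c x
    proof (rule eqI[OF l])
      have cx: "c *\<^sub>s x \<in> sp M (k, l)" using SM that by (rule seqvs.subspace_scale)
      show "g l (c *\<^sub>s x) \<in> sp N (k, l)" "c *\<^sub>s g l x \<in> sp N (k, l)"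
        using g[OF l] that cx SN by (auto intro: seqvs.subspace_scale)
      show "to_last p N k l (g l (c *\<^sub>s x)) = to_last p N k l (c *\<^sub>s g l x)"
        using g[OF l] that cx LM LN by (simp add: slin_scale[OF \<sigma>])
    qed
    ultimately show ?thesis using g[OF l] by (simp add: linear_between_def)
  qed
  moreover have "g (l + 1) (hor M (k, l) x) = hor N (k, l) (g l x)"
    if l: "l \<in> {1..<p}" and x: "x \<in> sp M (k, l)" for l x
  proof -
    have h: "(k, l) \<in> harrows p n" using k l by (simp add: harrows_def)
    have l': "l \<in> {1..p}" "l + 1 \<in> {1..p}" using l by auto
    have hx: "hor M (k, l) x \<in> sp M (k, l + 1)"
      using repD(2)[OF rep_inj_rep[OF M] h] x by (simp add: linear_between_def)
    have hg: "hor N (k, l) (g l x) \<in> sp N (k, l + 1)"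
      using repD(2)[OF rep_inj_rep[OF N] h] g[OF l'(1) x] by (simp add: linear_between_def)
    show ?thesis
    proof (rule eqI[OF l'(2) _ hg])
      show "g (l + 1) (hor M (k, l) x) \<in> sp N (k, l + 1)" using g[OF l'(2) hx] by simp
      have "to_last p N k (l + 1) (g (l + 1) (hor M (k, l) x)) = \<sigma> (to_last p M k l x)"
        using g[OF l'(2) hx] to_last_hor[of l p M k x] l by simp
      also have "\<dots> = to_last p N k (l + 1) (hor N (k, l) (g l x))"
        using g[OF l'(1) x] to_last_hor[of l p N k "g l x"] l by simp
      finally show "to_last p N k (l + 1) (g (l + 1) (hor M (k, l) x)) =
          to_last p N k (l + 1) (hor N (k, l) (g l x))" .
    qed
  qed
  ultimately show ?thesis using g by (intro exI[of _ g]) blast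
qed

lemma full_on_first_row:
  assumes p: "p \<ge> 1"
  shows "full_on p 1 (rep_inj p 1 :: 'k::field quiver_rep set) (Fl p) (map Fl [1..<p])"
  unfolding full_on_def
proof (intro ballI allI impI)
  fix M N :: "'k quiver_rep" and \<sigma>
  assume M: "M \<in> rep_inj p 1" and N: "N \<in> rep_inj p 1" and \<sigma>: "slin \<sigma>"
    and pres: "\<forall>t\<in>set (Fl p # map Fl [1..<p]). \<sigma> ` ev p M 1 t \<subseteq> ev p N 1 t"
  have k: "1 \<in> {1..1::nat}" by simp
  have flags: "\<sigma> ` ev p M 1 (Fl b) \<subseteq> ev p N 1 (Fl b)" if "b \<in> {1..p}" for b
  proof (cases "b = p")
    case False
    then have "Fl b \<in> set (Fl p # map Fl [1..<p])" using that by auto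
    then show ?thesis using pres by blast
  qed (use pres in simp)
  obtain g where g: "\<forall>l\<in>{1..p}. linear_between (sp M (1, l)) (sp N (1, l)) (g l)"
    "\<forall>l\<in>{1..<p}. \<forall>x\<in>sp M (1, l). g (l + 1) (hor M (1, l) x) = hor N (1, l) (g l x)"
    "\<forall>l\<in>{1..p}. \<forall>x\<in>sp M (1, l). to_last p N 1 l (g l x) = \<sigma> (to_last p M 1 l x)"
    using lift_to_row[OF M N p k \<sigma> flags] by blast
  have "morphism p 1 M N (\<lambda>(k, l). g l)"
    unfolding morphism_def using g(1,2) by (auto simp: vertices_def harrows_def varrows_def)
  moreover have "\<forall>x\<in>ev p M 1 (Fl p). (\<lambda>(k, l). g l) (1, p) x = \<sigma> x"
    using bspec[OF g(3), of p] p by (simp add: ev_whole del: ev.simps)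
  ultimately show "\<exists>f. morphism p 1 M N f \<and> (\<forall>x\<in>ev p M 1 (Fl p). f (1, p) x = \<sigma> x)" by blast
qed

definition covered_by :: "lterm list \<Rightarrow> lterm \<Rightarrow> bool"
  where "covered_by ss t \<longleftrightarrow> (\<exists>s\<in>set ss. le s t \<and> le t s)"

lemma covered_by_preserved:
  assumes M: "M \<in> rep_inj p n" and N: "N \<in> rep_inj p n" and p: "p \<ge> 1" and k: "k \<in> {1..n}"
    and "covered_by ss t" "\<And>s. s \<in> set ss \<Longrightarrow> \<sigma> ` ev p M k s \<subseteq> ev p N k s"
  shows "\<sigma> ` ev p M k t \<subseteq> ev p N k t"
proof -
  obtain s where s: "s \<in> set ss" "le s t" "le t s" using assms(5) unfolding covered_by_def by blast
  have "ev p M k t = ev p M k s" "ev p N k t = ev p N k s"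
    using le_sound[OF M p _ k] le_sound[OF N p _ k] s by blast+
  then show ?thesis using assms(6)[OF s(1)] by simp
qed

lemma chain_sorted:
  assumes "M \<in> rep_inj p n" "p \<ge> 1" "k \<in> {1..n}" "sorted_wrt le ts"
  shows "sorted_wrt (\<subseteq>) (map (ev p M k) ts)"
  using assms(4) le_sound[OF assms(1,2) _ assms(3)]
  by (auto simp: sorted_wrt_map intro: sorted_wrt_mono_rel[rotated])

text \<open>
  The member \<open>w\<close> serves as the default when no member of the chain contains \<open>b\<close>. Membership refers to
  one representation and inclusion to another; that is how the lemma is used when a basis vector of
  the former is sent to the latter.
\<close>

lemma least_member_containing:
  assumes "sorted_wrt (\<lambda>s t. E' s \<subseteq> E' t) ts" "b \<in> E w"
  shows "\<exists>x\<in>set (w # ts). b \<in> E x \<and> (\<forall>s\<in>set ts. b \<in> E s \<longrightarrow> E' x \<subseteq> E' s)"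
  using assms
proof (induction ts)
  case (Cons a ts)
  show ?case
  proof (cases "b \<in> E a")
    case True
    then show ?thesis using Cons.prems(1) by (intro bexI[of _ a]) auto
  next
    case False
    then show ?thesis using Cons by (metis list.set_intros(1,2) set_ConsD sorted_wrt.simps(2))
  qed
qed simp

lemma greatest_member_avoiding:
  assumes "sorted_wrt (\<lambda>s t. E' s \<subseteq> E' t) ts" "b \<notin> E w"
  shows "\<exists>x\<in>set (w # ts). b \<notin> E x \<and> (\<forall>s\<in>set ts. b \<notin> E s \<longrightarrow> E' s \<subseteq> E' x)"
  using assms
proof (induction ts rule: rev_induct)
  case (snoc a ts)
  show ?case
  proof (cases "b \<in> E a")
    case True
    obtain x where "x \<in> set (w # ts)" "b \<notin> E x" "\<forall>s\<in>set ts. b \<notin> E s \<longrightarrow> E' s \<subseteq> E' x"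
      using snoc.IH snoc.prems by (metis sorted_wrt_append)
    then show ?thesis using True by (intro bexI[of _ x]) auto
  next
    case False
    then show ?thesis using snoc.prems(1) by (intro bexI[of _ a]) (auto simp: sorted_wrt_append)
  qed
qed simp

text \<open>
  The whole space \<open>Fl p\<close> is added to both chains, so that the images of their members occur among the
  images of meets.
\<close>

definition next_terms :: "nat \<Rightarrow> lterm list \<Rightarrow> lterm list \<Rightarrow> lterm list"
  where "next_terms p \<alpha> \<beta> =
    [Img (Mt x y). x \<leftarrow> Fl p # \<alpha>, y \<leftarrow> Fl p # \<beta>] @ map Fl [1..<p]"

text \<open>
  Given a map \<open>\<sigma>\<close> of row \<open>k + 1\<close>, a map \<open>\<psi>\<close> of row \<open>k\<close> compatible with it is built on a basis adapted to
  the two chains. If \<open>x\<close> and \<open>z\<close> are the least members of the chains that contain a basis vector \<open>b\<close>, then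
  \<open>\<sigma>\<close> sends the image of \<open>b\<close> into the image of \<open>x \<sqinter> z\<close>, and any preimage there is a value for \<open>\<psi> b\<close> that
  respects both chains. Fullness in row \<open>k\<close> then extends \<open>\<psi>\<close> upwards.
\<close>

lemma full_on_next_row:
  assumes p: "p \<ge> 1" and k: "k \<ge> 1"
    and full: "full_on p k (rep_inj p k :: 'k::field quiver_rep set) (Fl p) ts"
    and \<alpha>: "sorted_wrt le \<alpha>" and \<beta>: "sorted_wrt le \<beta>"
    and ts: "\<forall>t\<in>set ts. covered_by (Fl p # \<alpha> @ \<beta>) t"
  shows "full_on p (Suc k) (rep_inj p (Suc k) :: 'k quiver_rep set) (Fl p) (next_terms p \<alpha> \<beta>)"
  unfolding full_on_def
proof (intro ballI allI impI)
  fix M N :: "'k quiver_rep" and \<sigma>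
  assume M: "M \<in> rep_inj p (Suc k)" and N: "N \<in> rep_inj p (Suc k)" and \<sigma>: "slin \<sigma>"
    and pres: "\<forall>t\<in>set (Fl p # next_terms p \<alpha> \<beta>). \<sigma> ` ev p M (Suc k) t \<subseteq> ev p N (Suc k) t"
  have M': "M \<in> rep_inj p k" and N': "N \<in> rep_inj p k"
    using rep_inj_fewer_rows[of _ p "Suc k" k] M N by auto
  have kk: "k \<in> {1..k}" "k \<in> {1..Suc k}" "Suc k \<in> {1..Suc k}" using k by auto
  have flags: "\<sigma> ` ev p M (Suc k) (Fl b) \<subseteq> ev p N (Suc k) (Fl b)" if "b \<in> {1..p}" for b
  proof (cases "b = p")
    case False
    then have "Fl b \<in> set (Fl p # next_terms p \<alpha> \<beta>)" using that by (auto simp: next_terms_def)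
    then show ?thesis using pres by blast
  qed (use pres in simp)
  obtain g where g: "\<forall>l\<in>{1..p}. linear_between (sp M (Suc k, l)) (sp N (Suc k, l)) (g l)"
    "\<forall>l\<in>{1..<p}. \<forall>x\<in>sp M (Suc k, l). g (l + 1) (hor M (Suc k, l) x) = hor N (Suc k, l) (g l x)"
    "\<forall>l\<in>{1..p}. \<forall>x\<in>sp M (Suc k, l). to_last p N (Suc k) l (g l x) = \<sigma> (to_last p M (Suc k) l x)"
    using lift_to_row[OF M N p kk(3) \<sigma> flags] by blast
  define V where "V = sp M (k, p)"
  have V: "V = ev p M k (Fl p)" using p by (simp add: V_def ev_whole del: ev.simps)
  have sub: "seqvs.subspace (ev p M k t)" "ev p M k t \<subseteq> V" for t
    using ev_subspace[OF M' p kk(1)] by (auto simp: V_def)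
  have subN: "seqvs.subspace (ev p N k t)" for t
    using ev_subspace[OF N' p kk(1)] by blast
  have "\<forall>A\<in>set (map (ev p M k) \<alpha>) \<union> set (map (ev p M k) \<beta>). seqvs.subspace A \<and> A \<subseteq> V"
    using sub by auto
  from two_chain_basis[OF chain_sorted[OF M' p kk(1) \<alpha>] chain_sorted[OF M' p kk(1) \<beta>]
      sub(1)[of "Fl p", folded V] this]
  obtain B where B: "B \<subseteq> V" "seqvs.independent B" "V \<subseteq> seqvs.span B"
    "\<forall>A\<in>set (map (ev p M k) \<alpha>) \<union> set (map (ev p M k) \<beta>). A \<subseteq> seqvs.span (B \<inter> A)"
    by (elim exE conjE)
  have a: "(k, p) \<in> varrows p (Suc k)" using k p by (simp add: varrows_def)
  have "\<exists>y. (\<forall>s\<in>set (Fl p # \<alpha> @ \<beta>). b \<in> ev p M k s \<longrightarrow> y \<in> ev p N k s) \<and>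
      ver N (k, p) y = \<sigma> (ver M (k, p) b)" if b: "b \<in> B" for b
  proof -
    have bV: "b \<in> ev p M k (Fl p)" using b B(1) V by blast
    obtain x where x: "x \<in> set (Fl p # \<alpha>)" "b \<in> ev p M k x"
      "\<forall>s\<in>set \<alpha>. b \<in> ev p M k s \<longrightarrow> ev p N k x \<subseteq> ev p N k s"
      using least_member_containing[of "ev p N k" \<alpha> b "ev p M k" "Fl p", OF _ bV]
        chain_sorted[OF N' p kk(1) \<alpha>] unfolding sorted_wrt_map by blast
    obtain z where z: "z \<in> set (Fl p # \<beta>)" "b \<in> ev p M k z"
      "\<forall>s\<in>set \<beta>. b \<in> ev p M k s \<longrightarrow> ev p N k z \<subseteq> ev p N k s"
      using least_member_containing[of "ev p N k" \<beta> b "ev p M k" "Fl p", OF _ bV]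
        chain_sorted[OF N' p kk(1) \<beta>] unfolding sorted_wrt_map by blast
    have "Img (Mt x z) \<in> set (next_terms p \<alpha> \<beta>)"
      using x(1) z(1) unfolding next_terms_def by auto
    then have "\<sigma> ` ev p M (Suc k) (Img (Mt x z)) \<subseteq> ev p N (Suc k) (Img (Mt x z))"
      using pres by (meson list.set_intros(2))
    moreover have "ver M (k, p) b \<in> ev p M (Suc k) (Img (Mt x z))" using x(2) z(2) k by simp
    ultimately have "\<sigma> (ver M (k, p) b) \<in> ver N (k, p) ` (ev p N k x \<inter> ev p N k z)"
      using k by (auto simp: image_subset_iff)
    then obtain y where y: "y \<in> ev p N k x" "y \<in> ev p N k z" "ver N (k, p) y = \<sigma> (ver M (k, p) b)"
      by auto
    have "y \<in> ev p N k (Fl p)"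
      using y(1) ev_subspace[OF N' p kk(1), of x] p by (auto simp: ev_whole simp del: ev.simps)
    then show ?thesis using x(3) z(3) y by (intro exI[of _ y]) auto
  qed
  then obtain c where c: "\<And>b s. b \<in> B \<Longrightarrow> s \<in> set (Fl p # \<alpha> @ \<beta>) \<Longrightarrow> b \<in> ev p M k s \<Longrightarrow> c b \<in> ev p N k s"
    "\<And>b. b \<in> B \<Longrightarrow> ver N (k, p) (c b) = \<sigma> (ver M (k, p) b)"
    by metis
  obtain \<psi> where \<psi>: "slin \<psi>" "\<forall>b\<in>B. \<psi> b = c b"
    using seqvp.linear_independent_extend[OF B(2), of c] by blast
  have pres_\<psi>: "\<psi> ` ev p M k s \<subseteq> ev p N k s" if s: "s \<in> set (Fl p # \<alpha> @ \<beta>)" for s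
  proof -
    have "ev p M k s \<subseteq> seqvs.span (B \<inter> ev p M k s)"
      using s B V by (cases "s = Fl p") (auto simp: Int_absorb2 simp del: ev.simps)
    then show ?thesis
      using slin_span_into[OF \<psi>(1) subN, of "B \<inter> ev p M k s" s] c(1)[OF _ s] \<psi>(2) by auto
  qed
  have "\<psi> ` ev p M k t \<subseteq> ev p N k t" if t: "t \<in> set (Fl p # ts)" for t
  proof (cases "t = Fl p")
    case False
    then have "covered_by (Fl p # \<alpha> @ \<beta>) t" using t ts by simp
    then show ?thesis by (rule covered_by_preserved[OF M' N' p kk(1) _ pres_\<psi>])
  qed (use pres_\<psi>[of "Fl p"] in simp)
  from full_onD[OF full M' N' \<psi>(1) this]
  obtain f where f: "morphism p k M N f" "\<forall>x\<in>V. f (k, p) x = \<psi> x" unfolding V by blast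
  have ver_\<psi>: "ver N (k, p) (\<psi> x) = \<sigma> (ver M (k, p) x)" if x: "x \<in> V" for x
  proof -
    have SM: "seqvs.subspace (sp M (k, p))" and SN: "seqvs.subspace (sp N (k, p))"
      using ev_subspace[OF M' p kk(1), of "Fl p"] ev_subspace[OF N' p kk(1), of "Fl p"] p
      by (auto simp: ev_whole simp del: ev.simps)
    obtain \<mu> where \<mu>: "slin \<mu>" "\<forall>x\<in>sp M (k, p). \<mu> x = ver M (k, p) x"
      using linear_between_extend[OF SM repD(3)[OF rep_inj_rep[OF M] a]] by blast
    obtain \<nu> where \<nu>: "slin \<nu>" "\<forall>x\<in>sp N (k, p). \<nu> x = ver N (k, p) x"
      using linear_between_extend[OF SN repD(3)[OF rep_inj_rep[OF N] a]] by blast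
    have \<psi>N: "\<psi> x \<in> sp N (k, p)" if "x \<in> V" for x
      using pres_\<psi>[of "Fl p"] that p unfolding V by (auto simp: ev_whole simp del: ev.simps)
    have "\<nu> (\<psi> x) = \<sigma> (\<mu> x)"
    proof (rule slin_eq_on_span[OF slin_comp[OF \<psi>(1) \<nu>(1)] slin_comp[OF \<mu>(1) \<sigma>]])
      show "\<nu> (\<psi> b) = \<sigma> (\<mu> b)" if "b \<in> B" for b
        using that \<psi>(2) c(2) \<nu>(2) \<mu>(2) \<psi>N[of b] B(1) by (auto simp: V_def)
      show "x \<in> seqvs.span B" using x B(3) by blast
    qed
    then show ?thesis using \<mu>(2) \<nu>(2) x \<psi>N[OF x] by (simp add: V_def)
  qed
  define F where "F v = (if fst v \<le> k then f v else g (snd v))" for v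
  have "morphism p (Suc k) M N F"
    unfolding morphism_def
  proof (intro conjI ballI; (clarify)?)
    fix i l assume v: "(i, l) \<in> vertices p (Suc k)"
    show "linear_between (sp M (i, l)) (sp N (i, l)) (F (i, l))"
    proof (cases "i \<le> k")
      case True
      then have "(i, l) \<in> vertices p k" using v by (simp add: vertices_def)
      then show ?thesis using True morphismD(1)[OF f(1)] by (simp add: F_def)
    next
      case False
      then have "i = Suc k" "l \<in> {1..p}" using v by (auto simp: vertices_def)
      then show ?thesis using g(1) by (simp add: F_def)
    qed
  next
    fix i l x assume h: "(i, l) \<in> harrows p (Suc k)" "x \<in> sp M (i, l)"
    show "F (i, l + 1) (hor M (i, l) x) = hor N (i, l) (F (i, l) x)"
    proof (cases "i \<le> k")
      case True
      then have "(i, l) \<in> harrows p k" using h by (simp add: harrows_def)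
      then show ?thesis using True morphismD(2)[OF f(1) _ h(2)] by (simp add: F_def)
    next
      case False
      then have "i = Suc k" "l \<in> {1..<p}" using h by (auto simp: harrows_def)
      then show ?thesis using g(2) h(2) by (simp add: F_def)
    qed
  next
    fix i l x assume h: "(i, l) \<in> varrows p (Suc k)" and x: "x \<in> sp M (i, l)"
    show "F (i + 1, l) (ver M (i, l) x) = ver N (i, l) (F (i, l) x)"
    proof (cases "i < k")
      case True
      then have "(i, l) \<in> varrows p k" using h by (simp add: varrows_def)
      then show ?thesis using True morphismD(3)[OF f(1) _ x] by (simp add: F_def)
    next
      case False
      then have i: "i = k" and l: "l \<in> {1..p}" "1 \<le> l" "l \<le> p" using h by (auto simp: varrows_def)
      have vx: "ver M (k, l) x \<in> sp M (Suc k, l)"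
        using repD(3)[OF rep_inj_rep[OF M] h] x i by (simp add: linear_between_def)
      have fx: "f (k, l) x \<in> sp N (k, l)"
        using morphism_in[OF f(1) _ x] i l k by (simp add: vertices_def)
      have vf: "ver N (k, l) (f (k, l) x) \<in> sp N (Suc k, l)"
        using repD(3)[OF rep_inj_rep[OF N] h] fx i by (simp add: linear_between_def)
      have gv: "g l (ver M (k, l) x) \<in> sp N (Suc k, l)"
        using g(1) l vx by (simp add: linear_between_def)
      have xV: "to_last p M k l x \<in> V"
        using to_last_in[OF M' kk(1) l(1)] x i by (simp add: V_def)
      have comm: "f (k, p) (to_last p M k l x) = to_last p N k l (f (k, l) x)"
        using morphism_to_last[OF rep_inj_rep[OF M'] f(1) kk(1) l(2,3)] x i by simp
      have "to_last p N (Suc k) l (g l (ver M (k, l) x)) = \<sigma> (ver M (k, p) (to_last p M k l x))"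
        using g(3) l vx to_last_ver[OF M kk(2) _ l(2,3)] x i by simp
      also have "\<dots> = ver N (k, p) (to_last p N k l (f (k, l) x))"
        using ver_\<psi>[OF xV] f(2) xV comm by simp
      also have "\<dots> = to_last p N (Suc k) l (ver N (k, l) (f (k, l) x))"
        using to_last_ver[OF N kk(2) _ l(2,3) fx] by simp
      finally have "g l (ver M (k, l) x) = ver N (k, l) (f (k, l) x)"
        using to_last_inj[OF N kk(3) l(1)] gv vf by (meson inj_onD)
      then show ?thesis using i by (simp add: F_def)
    qed
  qed
  moreover have "\<forall>x\<in>ev p M (Suc k) (Fl p). F (Suc k, p) x = \<sigma> x"
    using bspec[OF g(3), of p] p by (simp add: ev_whole F_def del: ev.simps)
  ultimately show "\<exists>f. morphism p (Suc k) M N f \<and> (\<forall>x\<in>ev p M (Suc k) (Fl p). f (Suc k, p) x = \<sigma> x)"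
    by blast
qed

section \<open>Differentiation with respect to a subspace\<close>

text \<open>
  The zero space \<open>Fl 0\<close> is added to both chains, so that the meets of \<open>a\<close> with their members occur
  among the meets with joins.
\<close>

definition restrict_terms :: "lterm \<Rightarrow> lterm list \<Rightarrow> lterm list \<Rightarrow> lterm list \<Rightarrow> lterm list"
  where "restrict_terms a ts \<alpha> \<beta> =
    filter (\<lambda>t. le t a) ts @ [Mt a (Jn x y). x \<leftarrow> Fl 0 # \<alpha>, y \<leftarrow> Fl 0 # \<beta>]"

definition two_chains :: "lterm \<Rightarrow> lterm list \<Rightarrow> lterm list \<Rightarrow> bool"
  where "two_chains w \<alpha> \<beta> \<longleftrightarrow>
    sorted_wrt le \<alpha> \<and> sorted_wrt le \<beta> \<and> (\<forall>s\<in>set (\<alpha> @ \<beta>). le s w)"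

lemma adapted_basis:
  assumes M: "M \<in> rep_inj p k" and p: "p \<ge> 1" and k: "k \<ge> 1" and ch: "two_chains w \<alpha> \<beta>"
  shows "\<exists>B. B \<subseteq> ev p M k w \<and> seqvs.independent B \<and> ev p M k w \<subseteq> seqvs.span B \<and> finite B \<and>
    (\<forall>s\<in>set (w # \<alpha> @ \<beta>). ev p M k s \<subseteq> seqvs.span (B \<inter> ev p M k s))"
proof -
  have kk: "k \<in> {1..k}" using k by simp
  have sorted: "sorted_wrt le \<alpha>" "sorted_wrt le \<beta>" and below: "\<forall>s\<in>set (\<alpha> @ \<beta>). le s w"
    using ch unfolding two_chains_def by blast+
  have sub: "seqvs.subspace (ev p M k t)" "ev p M k t \<subseteq> sp M (k, p)" for t
    using ev_subspace[OF M p kk] by auto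
  have "\<forall>A\<in>set (map (ev p M k) \<alpha>) \<union> set (map (ev p M k) \<beta>). seqvs.subspace A \<and> A \<subseteq> ev p M k w"
    using sub(1) le_sound[OF M p _ kk] below unfolding set_map image_Un[symmetric] set_append[symmetric]
    by blast
  from two_chain_basis[OF chain_sorted[OF M p kk sorted(1)] chain_sorted[OF M p kk sorted(2)]
      sub(1)[of w] this]
  obtain B where B: "B \<subseteq> ev p M k w" "seqvs.independent B" "ev p M k w \<subseteq> seqvs.span B"
    "\<forall>A\<in>set (map (ev p M k) \<alpha>) \<union> set (map (ev p M k) \<beta>). A \<subseteq> seqvs.span (B \<inter> A)"
    by (elim exE conjE)
  have "(k, p) \<in> vertices p k" using k p by (simp add: vertices_def)
  then have "finite B"
    using independent_finite[OF repD(1)[OF rep_inj_rep[OF M]] B(2)] B(1) sub(2)[of w] by blast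
  moreover have "ev p M k s \<subseteq> seqvs.span (B \<inter> ev p M k s)" if "s \<in> set (w # \<alpha> @ \<beta>)" for s
    using that B(1,3,4) by (cases "s = w") (auto simp: Int_absorb2)
  ultimately show ?thesis using B(1-3) by (intro exI[of _ B] conjI ballI)
qed

lemma coordinate_map:
  assumes "seqvs.independent B" "b \<in> B"
  shows "\<exists>\<pi>. slin \<pi> \<and> \<pi> b = b \<and> (\<forall>b'\<in>B - {b}. \<pi> b' = 0)"
  using seqvp.linear_independent_extend[OF assms(1), of "\<lambda>x. if x = b then b else 0"] assms(2)
  by (metis DiffE insertI1)

text \<open>
  A map \<open>\<sigma>\<close> on \<open>a\<close> has to be extended to \<open>w\<close> so that both chains are preserved. With respect to an
  adapted basis \<open>B\<close> of the target this can be done one coordinate at a time: the coordinate at \<open>b \<in> B\<close> has to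
  vanish on the members of the chains that do not contain \<open>b\<close> in the target, that is, on the join of the
  greatest such members \<open>x\<close> and \<open>z\<close>. It does so on the intersection with \<open>a\<close>, because \<open>\<sigma>\<close> preserves
  \<open>a \<sqinter> (x \<squnion> z)\<close>; hence it extends by zero. Members below \<open>a\<close> are preserved as \<open>\<sigma>\<close> is unchanged there.
\<close>

lemma full_on_restrict:
  assumes p: "p \<ge> 1" and k: "k \<ge> 1" and X: "X \<subseteq> (rep_inj p k :: 'k::field quiver_rep set)"
    and full: "full_on p k X w ts" and aw: "le a w" and ch: "two_chains w \<alpha> \<beta>"
    and ts: "\<forall>t\<in>set ts. le t a \<or> covered_by (w # \<alpha> @ \<beta>) t"
  shows "full_on p k X a (restrict_terms a ts \<alpha> \<beta>)"
  unfolding full_on_def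
proof (intro ballI allI impI)
  fix M N :: "'k quiver_rep" and \<sigma>
  assume MN: "M \<in> X" "N \<in> X" and \<sigma>: "slin \<sigma>"
    and pres: "\<forall>t\<in>set (a # restrict_terms a ts \<alpha> \<beta>). \<sigma> ` ev p M k t \<subseteq> ev p N k t"
  have M: "M \<in> rep_inj p k" and N: "N \<in> rep_inj p k" using MN X by auto
  have kk: "k \<in> {1..k}" using k by simp
  have subM: "seqvs.subspace (ev p M k t)" "ev p M k t \<subseteq> sp M (k, p)" for t
    using ev_subspace[OF M p kk] by auto
  have subN: "seqvs.subspace (ev p N k t)" for t using ev_subspace[OF N p kk] by blast
  have V: "seqvs.subspace (sp M (k, p))"
    using sp_subspace[OF rep_inj_rep[OF M]] k p by (simp add: vertices_def)
  obtain B where B: "B \<subseteq> ev p N k w" "seqvs.independent B" "ev p N k w \<subseteq> seqvs.span B" "finite B"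
    "\<forall>s\<in>set (w # \<alpha> @ \<beta>). ev p N k s \<subseteq> seqvs.span (B \<inter> ev p N k s)"
    using adapted_basis[OF N p k ch] by (elim exE conjE)
  have sorted: "sorted_wrt (\<lambda>s t. ev p M k s \<subseteq> ev p M k t) \<alpha>"
      "sorted_wrt (\<lambda>s t. ev p M k s \<subseteq> ev p M k t) \<beta>"
    using chain_sorted[OF M p kk] ch unfolding two_chains_def sorted_wrt_map by blast+
  obtain \<pi> where \<pi>: "\<And>b. b \<in> B \<Longrightarrow> slin (\<pi> b)" "\<And>b. b \<in> B \<Longrightarrow> \<pi> b b = b"
    "\<And>b b'. b \<in> B \<Longrightarrow> b' \<in> B - {b} \<Longrightarrow> \<pi> b b' = 0"
    using coordinate_map[OF B(2)] by metis
  have "\<exists>g. slin g \<and> (\<forall>x\<in>ev p M k a. g x = \<pi> b (\<sigma> x)) \<and>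
      (\<forall>s\<in>set (\<alpha> @ \<beta>). b \<notin> ev p N k s \<longrightarrow> (\<forall>x\<in>ev p M k s. g x = 0)) \<and>
      (\<forall>x\<in>sp M (k, p). g x \<in> seqvs.span {b})" if b: "b \<in> B" for b
  proof -
    have "b \<noteq> 0" using B(2) b seqvs.dependent_zero by blast
    then have b0: "b \<notin> ev p N k (Fl 0)" by simp
    obtain x where x: "x \<in> set (Fl 0 # \<alpha>)" "b \<notin> ev p N k x"
      "\<forall>s\<in>set \<alpha>. b \<notin> ev p N k s \<longrightarrow> ev p M k s \<subseteq> ev p M k x"
      using greatest_member_avoiding[OF sorted(1), of b "ev p N k" "Fl 0"] b0 by blast
    obtain z where z: "z \<in> set (Fl 0 # \<beta>)" "b \<notin> ev p N k z"
      "\<forall>s\<in>set \<beta>. b \<notin> ev p N k s \<longrightarrow> ev p M k s \<subseteq> ev p M k z"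
      using greatest_member_avoiding[OF sorted(2), of b "ev p N k" "Fl 0"] b0 by blast
    have avoid: "ev p N k s \<subseteq> seqvs.span (B - {b})" if s: "s \<in> set (Fl 0 # \<alpha> @ \<beta>)" "b \<notin> ev p N k s" for s
    proof (cases "s = Fl 0")
      case True
      then show ?thesis by (simp add: seqvs.span_zero)
    next
      case False
      then have "ev p N k s \<subseteq> seqvs.span (B \<inter> ev p N k s)" using B(5) s(1) by simp
      also have "\<dots> \<subseteq> seqvs.span (B - {b})" using s(2) by (intro seqvs.span_mono) blast
      finally show ?thesis .
    qed
    have join: "ev p N k (Jn x z) \<subseteq> seqvs.span (B - {b})"
      using avoid[of x] avoid[of z] x(1,2) z(1,2) by (auto intro!: seqvs.span_add)
    have "\<pi> b (\<sigma> u) = 0" if u: "u \<in> ev p M k a" "u \<in> ev p M k (Jn x z)" for u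
    proof -
      have "Mt a (Jn x z) \<in> set (a # restrict_terms a ts \<alpha> \<beta>)"
        using x(1) z(1) unfolding restrict_terms_def by auto
      then have "\<sigma> u \<in> ev p N k (Mt a (Jn x z))" using pres u by (metis IntI ev.simps(3) image_subset_iff)
      then have "\<sigma> u \<in> seqvs.span (B - {b})" using join by auto
      then show ?thesis
        using slin_span_into[OF \<pi>(1)[OF b] seqvs.subspace_single_0, of "B - {b}"] \<pi>(3)[OF b] by blast
    qed
    from extend_by_zero[OF V subM[of a] subM[of "Jn x z"] slin_comp[OF \<sigma> \<pi>(1)[OF b]] this]
    obtain g where g: "slin g" "\<forall>x\<in>ev p M k a. g x = \<pi> b (\<sigma> x)" "\<forall>x\<in>ev p M k (Jn x z). g x = 0"
      "g ` sp M (k, p) \<subseteq> (\<lambda>x. \<pi> b (\<sigma> x)) ` ev p M k a" by blast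
    have "\<pi> b y \<in> seqvs.span {b}" if "y \<in> seqvs.span B" for y
    proof (rule slin_span_into[OF \<pi>(1)[OF b] seqvs.subspace_span _ that])
      show "\<pi> b b' \<in> seqvs.span {b}" if "b' \<in> B" for b'
        using \<pi>(2,3)[OF b] that by (cases "b' = b") (auto simp: seqvs.span_base seqvs.span_zero)
    qed
    moreover have "\<sigma> y \<in> seqvs.span B" if "y \<in> ev p M k a" for y
      using pres le_sound[OF N p aw kk] B(3) that by auto
    ultimately have line: "\<forall>x\<in>sp M (k, p). g x \<in> seqvs.span {b}" using g(4) by auto
    have zero: "g y = 0" if s: "s \<in> set (\<alpha> @ \<beta>)" "b \<notin> ev p N k s" and y: "y \<in> ev p M k s" for s y
    proof -
      have "ev p M k s \<subseteq> ev p M k x \<or> ev p M k s \<subseteq> ev p M k z" using s x(3) z(3) by auto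
      then have "y \<in> ev p M k (Jn x z)" using y ev_join_upper[OF M p kk] by blast
      then show ?thesis using g(3) by blast
    qed
    have "\<forall>s\<in>set (\<alpha> @ \<beta>). b \<notin> ev p N k s \<longrightarrow> (\<forall>x\<in>ev p M k s. g x = 0)"
      by (intro ballI impI zero)
    with g(1,2) line show ?thesis by (intro exI[of _ g] conjI)
  qed
  then have "\<forall>b\<in>B. \<exists>g. slin g \<and> (\<forall>x\<in>ev p M k a. g x = \<pi> b (\<sigma> x)) \<and>
      (\<forall>s\<in>set (\<alpha> @ \<beta>). b \<notin> ev p N k s \<longrightarrow> (\<forall>x\<in>ev p M k s. g x = 0)) \<and>
      (\<forall>x\<in>sp M (k, p). g x \<in> seqvs.span {b})" by (rule ballI)
  from bchoice[OF this]
  obtain g where g': "\<forall>b\<in>B. slin (g b) \<and> (\<forall>x\<in>ev p M k a. g b x = \<pi> b (\<sigma> x)) \<and>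
      (\<forall>s\<in>set (\<alpha> @ \<beta>). b \<notin> ev p N k s \<longrightarrow> (\<forall>x\<in>ev p M k s. g b x = 0)) \<and>
      (\<forall>x\<in>sp M (k, p). g b x \<in> seqvs.span {b})" by (elim exE)
  have g: "\<And>b. b \<in> B \<Longrightarrow> slin (g b)"
    "\<And>b x. b \<in> B \<Longrightarrow> x \<in> ev p M k a \<Longrightarrow> g b x = \<pi> b (\<sigma> x)"
    "\<And>b s x. b \<in> B \<Longrightarrow> s \<in> set (\<alpha> @ \<beta>) \<Longrightarrow> b \<notin> ev p N k s \<Longrightarrow> x \<in> ev p M k s \<Longrightarrow> g b x = 0"
    "\<And>b x. b \<in> B \<Longrightarrow> x \<in> sp M (k, p) \<Longrightarrow> g b x \<in> seqvs.span {b}"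
    using g' by blast+
  define \<psi> where "\<psi> x = (\<Sum>b\<in>B. g b x)" for x
  have \<psi>: "slin \<psi>" unfolding \<psi>_def using g(1) by (rule slin_sum)
  have \<psi>a: "\<psi> x = \<sigma> x" if x: "x \<in> ev p M k a" for x
  proof -
    have "\<sigma> x \<in> seqvs.span B" using pres le_sound[OF N p aw kk] B(3) x by auto
    then have "(\<Sum>b\<in>B. \<pi> b (\<sigma> x)) = \<sigma> x"
    proof (rule slin_eq_on_span[OF slin_sum[OF \<pi>(1)], rotated -1])
      show "(\<Sum>b\<in>B. \<pi> b b') = b'" if b': "b' \<in> B" for b'
      proof -
        have "(\<Sum>b\<in>B - {b'}. \<pi> b b') = 0" using \<pi>(3) b' by (intro sum.neutral) blast
        then show ?thesis using sum.remove[OF B(4) b', of "\<lambda>b. \<pi> b b'"] \<pi>(2)[OF b'] by simp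
      qed
    qed (simp_all add: slin_iff)
    then show ?thesis using g(2) x unfolding \<psi>_def by simp
  qed
  have pres_\<psi>: "\<psi> ` ev p M k s \<subseteq> ev p N k s" if s: "s \<in> set (w # \<alpha> @ \<beta>)" for s
  proof
    fix y assume "y \<in> \<psi> ` ev p M k s"
    then obtain x where x: "x \<in> ev p M k s" "y = \<psi> x" by blast
    have "g b x \<in> ev p N k s" if b: "b \<in> B" for b
    proof (cases "b \<in> ev p N k s")
      case True
      then have "seqvs.span {b} \<subseteq> ev p N k s" using subN by (intro seqvs.span_minimal) auto
      then show ?thesis using g(4)[OF b] x(1) subM(2) by blast
    next
      case False
      then have "s \<in> set (\<alpha> @ \<beta>)" using s B(1) b by auto
      then show ?thesis using g(3)[OF b _ False x(1)] seqvs.subspace_0[OF subN] by simp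
    qed
    then show "y \<in> ev p N k s" unfolding x(2) \<psi>_def by (intro seqvs.subspace_sum[OF subN])
  qed
  have "\<psi> ` ev p M k t \<subseteq> ev p N k t" if t: "t \<in> set (w # ts)" for t
  proof -
    consider "t = w" | "t \<in> set ts" "le t a" | "covered_by (w # \<alpha> @ \<beta>) t" using t ts by auto
    then show ?thesis
    proof cases
      case 2
      have "\<psi> ` ev p M k t = \<sigma> ` ev p M k t"
        using \<psi>a le_sound[OF M p 2(2) kk] by (intro image_cong) auto
      moreover have "t \<in> set (a # restrict_terms a ts \<alpha> \<beta>)" using 2 by (simp add: restrict_terms_def)
      ultimately show ?thesis using pres by metis
    next
      case 3
      then show ?thesis by (rule covered_by_preserved[OF M N p kk _ pres_\<psi>])
    qed (use pres_\<psi>[of w] in simp)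
  qed
  from full_onD[OF full MN \<psi> this]
  obtain f where f: "morphism p k M N f" "\<forall>x\<in>ev p M k w. f (k, p) x = \<psi> x" by blast
  have "\<forall>x\<in>ev p M k a. f (k, p) x = \<sigma> x"
    using f(2) \<psi>a le_sound[OF M p aw kk] by auto
  then show "\<exists>f. morphism p k M N f \<and> (\<forall>x\<in>ev p M k a. f (k, p) x = \<sigma> x)" using f(1) by blast
qed

section \<open>Finiteness when two chains suffice\<close>

lemma subspace_of_line:
  assumes "seqvs.subspace S" "S \<subseteq> seqvs.span {c}" "S \<noteq> {0}"
  shows "seqvs.span {c} \<subseteq> S"
proof -
  have "0 \<in> S" using assms(1) by (rule seqvs.subspace_0)
  then obtain y where y: "y \<in> S" "y \<noteq> 0" using assms(3) by blast
  then obtain d where d: "y = d *\<^sub>s c" using assms(2) by (auto simp: seqvs.span_singleton)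
  then have "d \<noteq> 0" using y(2) by auto
  then have "c = (1 / d) *\<^sub>s y" using d by simp
  then have "c \<in> S" using seqvs.subspace_scale[OF assms(1) y(1)] by metis
  then show ?thesis using assms(1) by (intro seqvs.span_minimal) auto
qed

text \<open>
  The pattern of vanishing members is a complete invariant: on lines, the map sending one spanning
  vector to the other preserves a member as soon as the pattern allows it, and it lifts in both
  directions.
\<close>

lemma finite_if_two_chains:
  assumes p: "p \<ge> 1" and k: "k \<ge> 1" and X: "X \<subseteq> (rep_inj p k :: 'k::field quiver_rep set)"
    and full: "full_on p k X w ts" and ch: "two_chains w \<alpha> \<beta>"
    and ts: "\<forall>t\<in>set ts. covered_by (w # \<alpha> @ \<beta>) t"
  shows "finite ({M \<in> X. indecomposable p k M \<and> ev p M k w \<noteq> {0}} // iso_rel p k)"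
proof -
  have kk: "k \<in> {1..k}" using k by simp
  have v: "(k, p) \<in> vertices p k" using k p by (simp add: vertices_def)
  have lift: "\<exists>f. morphism p k M N f \<and> (\<forall>x\<in>ev p M k w. f (k, p) x = \<sigma> x)"
    if MN: "M \<in> X" "N \<in> X" and \<sigma>: "slin \<sigma>"
      "\<And>s. s \<in> set (w # \<alpha> @ \<beta>) \<Longrightarrow> \<sigma> ` ev p M k s \<subseteq> ev p N k s" for M N \<sigma>
  proof -
    have "\<sigma> ` ev p M k t \<subseteq> ev p N k t" if t: "t \<in> set (w # ts)" for t
    proof (cases "t = w")
      case False
      then have "covered_by (w # \<alpha> @ \<beta>) t" using t ts by simp
      then show ?thesis using MN X by (intro covered_by_preserved[OF _ _ p kk _ \<sigma>(2)]) auto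
    qed (use \<sigma>(2)[of w] in simp)
    from full_onD[OF full MN \<sigma>(1) this] show ?thesis .
  qed
  have line: "\<exists>b. b \<noteq> 0 \<and> ev p M k w = seqvs.span {b}"
    if MX: "M \<in> X" and ind: "indecomposable p k M" and nz: "ev p M k w \<noteq> {0}" for M
  proof -
    have M: "M \<in> rep_inj p k" using MX X by blast
    have sub: "seqvs.subspace (ev p M k t)" "ev p M k t \<subseteq> sp M (k, p)" for t
      using ev_subspace[OF M p kk] by auto
    obtain B where B: "B \<subseteq> ev p M k w" "seqvs.independent B" "ev p M k w \<subseteq> seqvs.span B" "finite B"
      "\<forall>s\<in>set (w # \<alpha> @ \<beta>). ev p M k s \<subseteq> seqvs.span (B \<inter> ev p M k s)"
      using adapted_basis[OF M p k ch] by (elim exE conjE)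
    have "B \<noteq> {}" using B(3) nz seqvs.subspace_0[OF sub(1)] by auto
    then obtain b where b: "b \<in> B" by blast
    have nonzero: "b' \<noteq> 0" if "b' \<in> B" for b' using B(2) that seqvs.dependent_zero by blast
    obtain e where e: "slin e" "e b = b" "\<forall>b'\<in>B - {b}. e b' = 0"
      using coordinate_map[OF B(2) b] by blast
    have "e ` ev p M k s \<subseteq> ev p M k s" if s: "s \<in> set (w # \<alpha> @ \<beta>)" for s
    proof -
      have "e b' \<in> ev p M k s" if "b' \<in> B \<inter> ev p M k s" for b'
        using e(2,3) that seqvs.subspace_0[OF sub(1)] by (cases "b' = b") auto
      then show ?thesis using slin_span_into[OF e(1) sub(1), of "B \<inter> ev p M k s" s] B(5) s by blast
    qed
    from lift[OF MX MX e(1) this]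
    obtain f where f: "morphism p k M M f" "\<forall>x\<in>ev p M k w. f (k, p) x = e x" by blast
    have bM: "b' \<in> sp M (k, p)" if "b' \<in> B" for b' using that B(1) sub(2) by blast
    have "f (k, p) b = b" using f(2) e(2) b B(1) by auto
    from fixing_endomorphism_bij[OF rep_inj_rep[OF M] ind f(1) v bM[OF b] nonzero[OF b] this v]
    have inj: "inj_on (f (k, p)) (sp M (k, p))" by (simp add: bij_betw_def)
    have SV: "seqvs.subspace (sp M (k, p))" using sp_subspace[OF rep_inj_rep[OF M] v] .
    have "b' = b" if b': "b' \<in> B" for b'
    proof (rule ccontr)
      assume "b' \<noteq> b"
      then have "f (k, p) b' = 0" using f(2) e(3) b' B(1) by auto
      also have "0 = f (k, p) 0" using linear_between_zero[OF morphismD(1)[OF f(1) v] SV] by simp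
      finally have "b' = 0" using inj bM[OF b'] seqvs.subspace_0[OF SV] by (meson inj_onD)
      then show False using nonzero[OF b'] by simp
    qed
    then have "B = {b}" using b by blast
    then have "ev p M k w = seqvs.span {b}"
      using B(1,3) seqvs.span_minimal[OF B(1) sub(1)] by blast
    then show ?thesis using nonzero[OF b] by blast
  qed
  let ?A = "{M \<in> X. indecomposable p k M \<and> ev p M k w \<noteq> {0}}"
  define c where "c M = {s \<in> set (\<alpha> @ \<beta>). ev p M k s \<noteq> {0}}" for M :: "'k quiver_rep"
  have map_line: "\<sigma> ` ev p M k s \<subseteq> ev p N k s"
    if MN: "M \<in> X" "N \<in> X" "c M = c N" and b: "ev p M k w = seqvs.span {b}"
      and d: "ev p N k w = seqvs.span {d}" and \<sigma>: "slin \<sigma>" "\<sigma> b = d" and s: "s \<in> set (w # \<alpha> @ \<beta>)"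
    for M N b d \<sigma> s
  proof -
    have M: "M \<in> rep_inj p k" and N: "N \<in> rep_inj p k" using MN X by auto
    have subN: "seqvs.subspace (ev p N k t)" for t using ev_subspace[OF N p kk] by blast
    have w: "\<sigma> ` ev p M k w \<subseteq> ev p N k w"
      unfolding b d using slin_span_into[OF \<sigma>(1) seqvs.subspace_span, of "{b}" "{d}"] \<sigma>(2)
      by (auto simp: seqvs.span_base)
    show ?thesis
    proof (cases "s = w \<or> ev p M k s = {0}")
      case True
      then show ?thesis using w slin_0[OF \<sigma>(1)] seqvs.subspace_0[OF subN] by auto
    next
      case False
      then have s': "s \<in> set (\<alpha> @ \<beta>)" "le s w" using s ch unfolding two_chains_def by auto
      then have "ev p N k s \<noteq> {0}" using False MN(3) unfolding c_def by blast
      then have "ev p N k w \<subseteq> ev p N k s"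
        using subspace_of_line[OF subN] le_sound[OF N p s'(2) kk] d by metis
      then show ?thesis using w le_sound[OF M p s'(2) kk] by blast
    qed
  qed
  show ?thesis
  proof (rule finite_classes_if_classified[of _ _ _ c])
    show "?A \<subseteq> rep p k" using X rep_inj_rep by blast
    show "finite (c ` ?A)" by (rule finite_subset[of _ "Pow (set (\<alpha> @ \<beta>))"]) (auto simp: c_def)
    fix M N assume MN: "M \<in> ?A" "N \<in> ?A" "c M = c N"
    obtain b where b: "b \<noteq> 0" "ev p M k w = seqvs.span {b}" using line MN(1) by blast
    obtain d where d: "d \<noteq> 0" "ev p N k w = seqvs.span {d}" using line MN(2) by blast
    have ind: "seqvs.independent {b}" "seqvs.independent {d}" using b(1) d(1) by simp_all
    obtain \<sigma> where \<sigma>: "slin \<sigma>" "\<sigma> b = d" using seqvp.linear_independent_extend[OF ind(1), of "\<lambda>_. d"] by auto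
    obtain \<tau> where \<tau>: "slin \<tau>" "\<tau> d = b" using seqvp.linear_independent_extend[OF ind(2), of "\<lambda>_. b"] by auto
    obtain f where f: "morphism p k M N f" "\<forall>x\<in>ev p M k w. f (k, p) x = \<sigma> x"
      using lift[OF _ _ \<sigma>(1) map_line[OF _ _ MN(3) b(2) d(2) \<sigma>]] MN(1,2) by blast
    obtain g where g: "morphism p k N M g" "\<forall>x\<in>ev p N k w. g (k, p) x = \<tau> x"
      using lift[OF _ _ \<tau>(1) map_line[OF _ _ MN(3)[symmetric] d(2) b(2) \<tau>]] MN(1,2) by blast
    have bM: "b \<in> ev p M k w" and dN: "d \<in> ev p N k w" using b(2) d(2) by (auto simp: seqvs.span_base)
    show "isomorphic p k M N"
    proof (rule isomorphic_if_mutually_inverse_at[OF _ _ _ _ f(1) g(1) v])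
      show "M \<in> rep p k" "N \<in> rep p k" using MN(1,2) X rep_inj_rep by auto
      show "indecomposable p k M" "indecomposable p k N" using MN(1,2) by auto
      show "b \<in> sp M (k, p)" using bM ev_subspace[OF _ p kk, of M w] MN(1) X by blast
      show "b \<noteq> 0" by fact
      show "g (k, p) (f (k, p) b) = b" "f (k, p) b \<noteq> 0" using f(2) g(2) bM dN \<sigma>(2) \<tau>(2) d(1) by auto
    qed
  qed
qed

text \<open>
  Each entry \<open>(a, \<gamma>, \<delta>)\<close> is a restriction to \<open>a\<close> in which the chains \<open>\<gamma>\<close>, \<open>\<delta>\<close> contain all terms not below
  \<open>a\<close>; the chains \<open>\<alpha>\<close>, \<open>\<beta>\<close> contain all terms that are left at the end. Up to equivalence of terms all of
  this is decidable by \<open>le\<close>.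
\<close>

fun reduces :: "lterm \<Rightarrow> lterm list \<Rightarrow> (lterm \<times> lterm list \<times> lterm list) list \<Rightarrow>
    lterm list \<Rightarrow> lterm list \<Rightarrow> bool" where
  "reduces w ts [] \<alpha> \<beta> \<longleftrightarrow> two_chains w \<alpha> \<beta> \<and> (\<forall>t\<in>set ts. covered_by (w # \<alpha> @ \<beta>) t)"
| "reduces w ts ((a, \<gamma>, \<delta>) # cs) \<alpha> \<beta> \<longleftrightarrow> le a w \<and> two_chains w \<gamma> \<delta> \<and>
    (\<forall>t\<in>set ts. le t a \<or> covered_by (w # \<gamma> @ \<delta>) t) \<and>
    reduces a (restrict_terms a ts \<gamma> \<delta>) cs \<alpha> \<beta>"

text \<open>
  A restriction to \<open>a\<close> splits the indecomposables with \<open>w \<noteq> 0\<close> in two: those with \<open>a \<noteq> 0\<close> are left to the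
  remaining restrictions, and on those with \<open>a = 0\<close> all terms below \<open>a\<close> vanish, so that two chains
  suffice.
\<close>

lemma finite_if_reduces:
  assumes p: "p \<ge> 1" and k: "k \<ge> 1"
  shows "full_on p k (rep_inj p k :: 'k::field quiver_rep set) w ts \<Longrightarrow> reduces w ts cs \<alpha> \<beta> \<Longrightarrow>
    finite ({M \<in> (rep_inj p k :: 'k quiver_rep set). indecomposable p k M \<and> ev p M k w \<noteq> {0}} // iso_rel p k)"
proof (induction cs arbitrary: w ts)
  case Nil
  then show ?case by (intro finite_if_two_chains[OF p k subset_refl, of w ts \<alpha> \<beta>]) auto
next
  case (Cons c cs)
  obtain a \<gamma> \<delta> where c: "c = (a, \<gamma>, \<delta>)" by (cases c)
  have red: "le a w" "two_chains w \<gamma> \<delta>" "\<forall>t\<in>set ts. le t a \<or> covered_by (w # \<gamma> @ \<delta>) t"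
    "reduces a (restrict_terms a ts \<gamma> \<delta>) cs \<alpha> \<beta>"
    using Cons.prems(2) unfolding c by auto
  let ?X = "{M \<in> rep_inj p k :: 'k quiver_rep set. ev p M k a = {0}}"
  have kk: "k \<in> {1..k}" using k by simp
  have "full_on p k ?X w (filter (\<lambda>t. \<not> le t a) ts)"
    unfolding full_on_def
  proof (intro ballI allI impI)
    fix M N :: "'k quiver_rep" and \<sigma>
    assume M: "M \<in> ?X" and N: "N \<in> ?X" and \<sigma>: "slin \<sigma>"
      and pres: "\<forall>t\<in>set (w # filter (\<lambda>t. \<not> le t a) ts). \<sigma> ` ev p M k t \<subseteq> ev p N k t"
    have "\<sigma> ` ev p M k t \<subseteq> ev p N k t" if t: "t \<in> set (w # ts)" for t
    proof (cases "t \<in> set (w # filter (\<lambda>t. \<not> le t a) ts)")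
      case False
      then have "le t a" using t by auto
      then have "ev p M k t \<subseteq> {0}" using le_sound[of M p k t a k] M p kk by auto
      moreover have "0 \<in> ev p N k t" using ev_subspace[of N p k k t] N p kk seqvs.subspace_0 by blast
      ultimately show ?thesis using slin_0[OF \<sigma>] by auto
    qed (use pres in blast)
    from full_onD[OF Cons.prems(1) _ _ \<sigma> this]
    show "\<exists>f. morphism p k M N f \<and> (\<forall>x\<in>ev p M k w. f (k, p) x = \<sigma> x)" using M N by blast
  qed
  from finite_if_two_chains[OF p k _ this red(2)] red(3)
  have "finite ({M \<in> ?X. indecomposable p k M \<and> ev p M k w \<noteq> {0}} // iso_rel p k)" by auto
  moreover have "finite ({M \<in> rep_inj p k :: 'k quiver_rep set. indecomposable p k M \<and> ev p M k a \<noteq> {0}} // iso_rel p k)"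
    by (rule Cons.IH[OF full_on_restrict[OF p k subset_refl Cons.prems(1) red(1-3)] red(4)])
  ultimately have "finite (({M \<in> ?X. indecomposable p k M \<and> ev p M k w \<noteq> {0}} \<union>
      {M \<in> rep_inj p k. indecomposable p k M \<and> ev p M k a \<noteq> {0}}) // iso_rel p k)"
    by (rule finite_classes_Un)
  then show ?case by (rule finite_classes_mono) auto
qed

section \<open>The finite cases\<close>

abbreviation indecs :: "nat \<Rightarrow> nat \<Rightarrow> 'k::field quiver_rep set"
  where "indecs p n \<equiv> {M \<in> rep_inj p n. indecomposable p n M}"

text \<open>
  Fullness for the whole last space of row \<open>k\<close> controls the indecomposables that do not vanish there; the
  others are controlled by finiteness for \<open>k - 1\<close> rows, starting with the empty quiver.
\<close>

definition good_row :: "'k::field itself \<Rightarrow> nat \<Rightarrow> nat \<Rightarrow> lterm list \<Rightarrow> bool"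
  where "good_row _ p k ts \<longleftrightarrow> full_on p k (rep_inj p k :: 'k quiver_rep set) (Fl p) ts \<and>
    finite ((indecs p (k - 1) :: 'k quiver_rep set) // iso_rel p (k - 1))"

lemma indecomposable_drop_row:
  assumes M: "M \<in> rep p (Suc n)" and ind: "indecomposable p (Suc n) M"
    and zero: "\<And>l. l \<in> {1..p} \<Longrightarrow> sp M (Suc n, l) = {0}"
  shows "indecomposable p n M"
proof -
  have vert: "v \<in> vertices p n \<or> (\<exists>l\<in>{1..p}. v = (Suc n, l))" if "v \<in> vertices p (Suc n)" for v
    using that by (auto simp: vertices_def)
  have sub: "vertices p n \<subseteq> vertices p (Suc n)" by (auto simp: vertices_def)
  have nz: "nonzero_on p n (sp M)"
    using ind vert zero unfolding indecomposable_def nonzero_on_def by blast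
  have False if dir: "direct_sum_of p n M U W" and nzU: "nonzero_on p n U" and nzW: "nonzero_on p n W" for U W
  proof -
    define ext where "ext A v = (if fst v = Suc n then {0} else A v)"
      for A :: "nat \<times> nat \<Rightarrow> (nat \<Rightarrow> 'a) set" and v
    have ext: "ext A v = A v" if "v \<in> vertices p n" for A v
      using that by (auto simp: ext_def vertices_def)
    have ext': "ext A (Suc n, l) = {0}" for A l by (simp add: ext_def)
    have subrep_ext: "subrep p (Suc n) M (ext A)" if A: "subrep p n M A" for A
      unfolding subrep_def
    proof (intro conjI ballI; (clarify)?)
      fix k l assume v: "(k, l) \<in> vertices p (Suc n)"
      show "seqvs.subspace (ext A (k, l))"
        using vert[OF v] subrepD(1)[OF A] ext by (auto simp: ext_def seqvs.subspace_single_0)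
    next
      fix k l x assume v: "(k, l) \<in> vertices p (Suc n)" "x \<in> ext A (k, l)"
      then show "x \<in> sp M (k, l)"
        using vert[OF v(1)] subrepD(2)[OF A] ext zero ext' by (metis subsetD)
    next
      fix k l x y assume h: "(k, l) \<in> harrows p (Suc n)" "y \<in> ext A (k, l)"
      show "hor M (k, l) y \<in> ext A (k, l + 1)"
      proof (cases "k = Suc n")
        case True
        have "seqvs.subspace (sp M (k, l))" using sp_subspace[OF M] harrows_vertices[OF h(1)] by blast
        then show ?thesis
          using h(2) True linear_between_zero[OF repD(2)[OF M h(1)]] by (simp add: ext_def)
      next
        case False
        then have "(k, l) \<in> harrows p n" using h(1) by (auto simp: harrows_def)
        then show ?thesis using subrepD(3)[OF A] h(2) False by (simp add: ext_def)
      qed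
    next
      fix k l x y assume h: "(k, l) \<in> varrows p (Suc n)" "y \<in> ext A (k, l)"
      show "ver M (k, l) y \<in> ext A (k + 1, l)"
      proof (cases "k = n")
        case True
        then have v: "(n, l) \<in> vertices p n" and l: "l \<in> {1..p}"
          using h(1) by (auto simp: varrows_def vertices_def)
        have "y \<in> sp M (n, l)" using h(2) True ext[OF v] subrepD(2)[OF A v] by auto
        then have "ver M (k, l) y \<in> sp M (Suc n, l)"
          using repD(3)[OF M h(1)] True by (simp add: linear_between_def)
        then show ?thesis using zero[OF l] True by (simp add: ext_def)
      next
        case False
        then have "(k, l) \<in> varrows p n" "k \<noteq> Suc n" using h(1) by (auto simp: varrows_def)
        then show ?thesis using subrepD(4)[OF A] h(2) False by (simp add: ext_def)
      qed
    qed
    have "direct_sum_of p (Suc n) M (ext U) (ext W)"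
      unfolding direct_sum_of_def
    proof (intro conjI ballI)
      show "subrep p (Suc n) M (ext U)" "subrep p (Suc n) M (ext W)"
        using dir subrep_ext unfolding direct_sum_of_def by blast+
      fix v assume v: "v \<in> vertices p (Suc n)"
      have "sp M v = {u + w | u w. u \<in> ext U v \<and> w \<in> ext W v} \<and> ext U v \<inter> ext W v = {0}"
      proof (cases "v \<in> vertices p n")
        case True
        then have "sp M v = {u + w | u w. u \<in> U v \<and> w \<in> W v} \<and> U v \<inter> W v = {0}"
          using dir unfolding direct_sum_of_def by blast
        then show ?thesis by (simp only: ext[OF True])
      next
        case False
        then obtain l where "v = (Suc n, l)" "l \<in> {1..p}" using vert[OF v] by blast
        then show ?thesis using zero by (simp add: ext')
      qed
      then show "sp M v = {u + w | u w. u \<in> ext U v \<and> w \<in> ext W v}" "ext U v \<inter> ext W v = {0}"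
        by blast+
    qed
    moreover have "nonzero_on p (Suc n) (ext U)" "nonzero_on p (Suc n) (ext W)"
      using nzU nzW sub ext unfolding nonzero_on_def by (metis subsetD)+
    ultimately show False using ind unfolding indecomposable_def by blast
  qed
  then show ?thesis using nz unfolding indecomposable_def by blast
qed

lemma isomorphic_add_zero_row:
  assumes M: "M \<in> rep p (Suc n)" and N: "N \<in> rep p (Suc n)"
    and zero: "\<And>l. l \<in> {1..p} \<Longrightarrow> sp M (Suc n, l) = {0} \<and> sp N (Suc n, l) = {0}"
    and iso: "isomorphic p n M N"
  shows "isomorphic p (Suc n) M N"
proof -
  obtain f where f: "morphism p n M N f" "\<forall>v\<in>vertices p n. bij_betw (f v) (sp M v) (sp N v)"
    using iso unfolding isomorphic_def by blast
  define F where "F v = (if fst v = Suc n then (\<lambda>x. x) else f v)" for v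
  have vert: "v \<in> vertices p n \<and> fst v \<noteq> Suc n \<or> (\<exists>l\<in>{1..p}. v = (Suc n, l))"
    if "v \<in> vertices p (Suc n)" for v
    using that by (auto simp: vertices_def)
  have lin: "linear_between (sp M v) (sp N v) (F v)" if "v \<in> vertices p (Suc n)" for v
    using vert[OF that]
  proof
    assume "v \<in> vertices p n \<and> fst v \<noteq> Suc n"
    then show ?thesis using morphismD(1)[OF f(1)] by (simp add: F_def)
  next
    assume "\<exists>l\<in>{1..p}. v = (Suc n, l)"
    then show ?thesis using zero by (auto simp: F_def linear_between_def)
  qed
  have bij: "bij_betw (F v) (sp M v) (sp N v)" if "v \<in> vertices p (Suc n)" for v
    using vert[OF that] f(2) zero by (auto simp: F_def bij_betw_def)
  have "morphism p (Suc n) M N F"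
    unfolding morphism_def
  proof (intro conjI ballI; (clarify)?)
    fix k l assume "(k, l) \<in> vertices p (Suc n)"
    then show "linear_between (sp M (k, l)) (sp N (k, l)) (F (k, l))" by (rule lin)
  next
    fix k l x assume h: "(k, l) \<in> harrows p (Suc n)" "x \<in> sp M (k, l)"
    show "F (k, l + 1) (hor M (k, l) x) = hor N (k, l) (F (k, l) x)"
    proof (cases "k = Suc n")
      case True
      have "seqvs.subspace (sp M (k, l))" "seqvs.subspace (sp N (k, l))"
        using sp_subspace[OF M] sp_subspace[OF N] harrows_vertices[OF h(1)] by blast+
      moreover have "x = 0" using zero[of l] h True by (auto simp: harrows_def)
      ultimately show ?thesis
        using linear_between_zero[OF repD(2)[OF M h(1)]] linear_between_zero[OF repD(2)[OF N h(1)]] True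
        by (simp add: F_def)
    next
      case False
      then have "(k, l) \<in> harrows p n" using h(1) by (auto simp: harrows_def)
      then show ?thesis using morphismD(2)[OF f(1) _ h(2)] False by (simp add: F_def)
    qed
  next
    fix k l x assume h: "(k, l) \<in> varrows p (Suc n)" "x \<in> sp M (k, l)"
    show "F (k + 1, l) (ver M (k, l) x) = ver N (k, l) (F (k, l) x)"
    proof (cases "k = n")
      case True
      have v: "(k, l) \<in> vertices p (Suc n)" and l: "l \<in> {1..p}"
        using h(1) by (auto simp: varrows_def vertices_def)
      have "F (k, l) x \<in> sp N (k, l)" using lin[OF v] h(2) by (simp add: linear_between_def)
      then have "ver N (k, l) (F (k, l) x) \<in> sp N (Suc n, l)"
        using repD(3)[OF N h(1)] True by (simp add: linear_between_def)
      moreover have "ver M (k, l) x \<in> sp M (Suc n, l)"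
        using repD(3)[OF M h(1)] h(2) True by (simp add: linear_between_def)
      ultimately show ?thesis using zero[OF l] True by (simp add: F_def)
    next
      case False
      then have "(k, l) \<in> varrows p n" "k \<noteq> Suc n" using h(1) by (auto simp: varrows_def)
      then show ?thesis using morphismD(3)[OF f(1) _ h(2)] False by (simp add: F_def)
    qed
  qed
  then show ?thesis using bij unfolding isomorphic_def by blast
qed

lemma zero_row:
  assumes M: "M \<in> rep_inj p n" and k: "k \<in> {1..n}" and zero: "sp M (k, p) = {0}" and l: "l \<in> {1..p}"
  shows "sp M (k, l) = {0}"
proof -
  have S: "seqvs.subspace (sp M (k, l))"
    using sp_subspace[OF rep_inj_rep[OF M]] k l by (simp add: vertices_def)
  have "x = 0" if x: "x \<in> sp M (k, l)" for x
  proof -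
    have "to_last p M k l x = 0" "to_last p M k l 0 = 0"
      using to_last_in[OF M k l] x seqvs.subspace_0[OF S] zero by auto
    then show ?thesis using to_last_inj[OF M k l] x seqvs.subspace_0[OF S] by (metis inj_onD)
  qed
  then show ?thesis using seqvs.subspace_0[OF S] by blast
qed

lemma finite_indecs_if_reduces:
  assumes p: "p \<ge> 1" and k: "k \<ge> 1" and good: "good_row TYPE('k::field) p k ts"
    and red: "reduces (Fl p) ts cs \<alpha> \<beta>"
  shows "finite ((indecs p k :: 'k quiver_rep set) // iso_rel p k)"
proof -
  obtain n where n: "k = Suc n" using k by (cases k) auto
  have kk: "k \<in> {1..k}" using k by simp
  \<comment> \<open>Indecomposables with zero last row are indecomposable with one row fewer.\<close>
  let ?Z = "{M \<in> indecs p k :: 'k quiver_rep set. sp M (k, p) = {0}}"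
  have Z: "M \<in> indecs p n" "\<And>l. l \<in> {1..p} \<Longrightarrow> sp M (Suc n, l) = {0}" if M: "M \<in> ?Z" for M
  proof -
    show zero: "sp M (Suc n, l) = {0}" if "l \<in> {1..p}" for l
      using zero_row[of M p k k l] M kk that n by auto
    show "M \<in> indecs p n"
      using rep_inj_fewer_rows[of M p k n] indecomposable_drop_row[of M p n] zero
        rep_inj_rep[of M p "Suc n"] M n by auto
  qed
  have "finite (?Z // iso_rel p k)"
  proof (rule finite_classes_if_classified[of _ _ _ "\<lambda>M. iso_rel p n `` {M}"])
    show "?Z \<subseteq> rep p k" using rep_inj_rep by blast
    have "(\<lambda>M. iso_rel p n `` {M}) ` ?Z \<subseteq> (indecs p n :: 'k quiver_rep set) // iso_rel p n"
      using Z(1) unfolding quotient_def by blast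
    then show "finite ((\<lambda>M. iso_rel p n `` {M}) ` ?Z)"
      using good n unfolding good_row_def by (simp add: finite_subset)
    fix M N assume MN: "M \<in> ?Z" "N \<in> ?Z" "iso_rel p n `` {M} = iso_rel p n `` {N}"
    have "N \<in> rep p n" using Z(1)[OF MN(2)] rep_inj_rep by blast
    then have "(M, N) \<in> iso_rel p n" using eq_equiv_class[OF MN(3) equiv_iso_rel] by blast
    then have "isomorphic p n M N" unfolding iso_rel_def by blast
    then have "isomorphic p (Suc n) M N"
    proof (rule isomorphic_add_zero_row[rotated -1])
      show "M \<in> rep p (Suc n)" "N \<in> rep p (Suc n)" using MN(1,2) rep_inj_rep n by auto
      show "sp M (Suc n, l) = {0} \<and> sp N (Suc n, l) = {0}" if "l \<in> {1..p}" for l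
        using Z(2)[OF MN(1) that] Z(2)[OF MN(2) that] by simp
    qed
    then show "isomorphic p k M N" using n by simp
  qed
  moreover have "finite ({M \<in> rep_inj p k :: 'k quiver_rep set. indecomposable p k M \<and>
      ev p M k (Fl p) \<noteq> {0}} // iso_rel p k)"
    using good red unfolding good_row_def by (intro finite_if_reduces[OF p k]) auto
  ultimately have "finite ((?Z \<union> {M \<in> rep_inj p k :: 'k quiver_rep set. indecomposable p k M \<and>
      ev p M k (Fl p) \<noteq> {0}}) // iso_rel p k)"
    by (rule finite_classes_Un)
  then show ?thesis
    by (rule finite_classes_mono) (use ev_whole[OF p] in \<open>auto simp del: ev.simps\<close>)
qed

lemma good_row_first: "p \<ge> 1 \<Longrightarrow> good_row TYPE('k::field) p 1 (map Fl [1..<p])"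
  using full_on_first_row[of p] by (simp add: good_row_def indecomposable_def nonzero_on_def vertices_def)

lemma good_row_next:
  assumes p: "p \<ge> 1" and k: "k \<ge> 1" and good: "good_row TYPE('k::field) p k ts"
    and red: "reduces (Fl p) ts [] \<alpha> \<beta>"
  shows "good_row TYPE('k) p (Suc k) (next_terms p \<alpha> \<beta>)"
  using full_on_next_row[where 'k = 'k, OF p k, of ts \<alpha> \<beta>] finite_indecs_if_reduces[OF p k good red] good red
  by (simp add: good_row_def two_chains_def)

text \<open>
  For a single column the images of the earlier spaces form one chain.
\<close>

lemma finite_one_column:
  assumes "n \<ge> 1"
  shows "finite ((indecs 1 n :: 'k::field quiver_rep set) // iso_rel 1 n)"
proof -
  \<comment> \<open>The image of the space of the row \<open>i\<close> steps above.\<close>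
  define pw where "pw i = (Img ^^ i) (Fl 1)" for i
  define \<alpha> where "\<alpha> k = map pw (rev [1..<k])" for k
  have le_pw: "le (pw i) (pw j)" if "j \<le> i" for i j
    using that
  proof (induction j arbitrary: i)
    case 0
    show ?case by (induction i) (simp_all add: pw_def)
  next
    case (Suc j)
    then obtain i' where "i = Suc i'" "j \<le> i'" by (cases i) auto
    then show ?case using Suc.IH by (simp add: pw_def)
  qed
  have pw_cases: "pw i = Fl 1 \<or> (\<exists>t. pw i = Img t)" for i by (cases i) (auto simp: pw_def)
  have chain: "two_chains (Fl 1) (\<alpha> k) []" for k
    unfolding two_chains_def \<alpha>_def using le_pw le_pw[of 0]
    by (auto simp: sorted_wrt_map sorted_wrt_rev pw_def intro: sorted_wrt_mono_rel[OF _ sorted_wrt_upt])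
  have next_covered: "\<forall>t\<in>set (next_terms 1 (\<alpha> k) []). covered_by (Fl 1 # \<alpha> (Suc k) @ []) t" if "k \<ge> 1" for k
  proof
    fix t assume "t \<in> set (next_terms 1 (\<alpha> k) [])"
    then obtain x where x: "x \<in> set (Fl 1 # \<alpha> k)" "t = Img (Mt x (Fl 1))"
      by (auto simp: next_terms_def)
    have "\<exists>i<k. x = pw i"
    proof (cases "x = Fl 1")
      case True
      then show ?thesis using that by (intro exI[of _ 0]) (simp add: pw_def)
    qed (use x(1) in \<open>auto simp: \<alpha>_def\<close>)
    then obtain i where i: "i < k" "t = Img (Mt (pw i) (Fl 1))" using x(2) by blast
    have "le (Mt (pw i) (Fl 1)) (pw i)" "le (pw i) (Mt (pw i) (Fl 1))"
      using pw_cases[of i] le_pw[of i i] le_pw[of 0 i] by (auto simp: pw_def)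
    then have "le (pw (Suc i)) t" "le t (pw (Suc i))" using i by (simp_all add: pw_def)
    moreover have "Suc i \<in> set [1..<Suc k]" using i(1) by auto
    then have "pw (Suc i) \<in> set (\<alpha> (Suc k))" unfolding \<alpha>_def set_map set_rev by (rule imageI)
    ultimately show "covered_by (Fl 1 # \<alpha> (Suc k) @ []) t" unfolding covered_by_def by auto
  qed
  have "\<exists>ts. good_row TYPE('k) 1 k ts \<and> reduces (Fl 1) ts [] (\<alpha> k) []" if "k \<ge> 1" for k
    using that
  proof (induction k rule: dec_induct)
    case base
    have "good_row TYPE('k) 1 1 []" using good_row_first[of 1] by simp
    then show ?case using chain by auto
  next
    case (step k)
    then obtain ts where "good_row TYPE('k) 1 k ts" "reduces (Fl 1) ts [] (\<alpha> k) []" by blast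
    from good_row_next[OF order_refl step(1) this]
    show ?case using chain next_covered[OF step(1)] by (intro exI[of _ "next_terms 1 (\<alpha> k) []"]) simp
  qed
  then show ?thesis using finite_indecs_if_reduces[OF order_refl assms] assms by blast
qed

text \<open>
  The two chains in the second row are its own flag and the image of the flag of the first row.
\<close>

lemma finite_two_rows:
  assumes p: "p \<ge> 1" and n: "n \<in> {1, 2}"
  shows "finite ((indecs p n :: 'k::field quiver_rep set) // iso_rel p n)"
proof -
  define \<alpha> where "\<alpha> = map Fl [1..<p]"
  define \<beta> where "\<beta> = map (\<lambda>b. Img (Fl b)) [1..<Suc p]"
  have sorted: "sorted_wrt le \<alpha>" "sorted_wrt le \<beta>"
    unfolding \<alpha>_def \<beta>_def sorted_wrt_map
    by (rule sorted_wrt_mono_rel[OF _ sorted_wrt_upt]; simp)+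
  have row1: "reduces (Fl p) (map Fl [1..<p]) [] \<alpha> []"
    using sorted by (auto simp: two_chains_def covered_by_def \<alpha>_def)
  have row2: "reduces (Fl p) (next_terms p \<alpha> []) [] \<alpha> \<beta>"
  proof -
    have "covered_by (Fl p # \<alpha> @ \<beta>) t" if t: "t \<in> set (next_terms p \<alpha> [])" for t
    proof -
      consider b where "b \<in> {1..p}" "t = Img (Mt (Fl b) (Fl p))" | "t \<in> set \<alpha>"
        using t p by (auto simp: next_terms_def \<alpha>_def)
      then show ?thesis
      proof cases
        case 1
        then have "Img (Fl b) \<in> set \<beta>" "le (Img (Fl b)) t" "le t (Img (Fl b))" by (auto simp: \<beta>_def)
        then show ?thesis unfolding covered_by_def by auto
      next
        case 2
        then have "le t t" by (auto simp: \<alpha>_def)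
        then show ?thesis using 2 unfolding covered_by_def by auto
      qed
    qed
    then show ?thesis using sorted by (auto simp: two_chains_def \<alpha>_def \<beta>_def)
  qed
  note first = good_row_first[OF p, where 'k = 'k]
  have "finite ((indecs p 1 :: 'k quiver_rep set) // iso_rel p 1)"
    by (rule finite_indecs_if_reduces[OF p order_refl first row1])
  moreover have "finite ((indecs p (Suc 1) :: 'k quiver_rep set) // iso_rel p (Suc 1))"
    by (rule finite_indecs_if_reduces[OF p _ good_row_next[OF p order_refl first row1] row2]) simp
  ultimately show ?thesis using n by (auto simp: numeral_2_eq_2)
qed

text \<open>
  Two chains suffice in the first four rows. In the fifth row the subspaces are indexed by a partially
  ordered set of width three with 21 elements, and restriction to one of them, the image of
  \<open>Img (Img (Fl 2)) \<sqinter> Fl 1\<close>, brings the width down to two.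
\<close>

lemma finite_two_columns:
  assumes n: "n \<in> {1..5}"
  shows "finite ((indecs 2 n :: 'k::field quiver_rep set) // iso_rel 2 n)"
proof -
  have p: "(2::nat) \<ge> 1" by simp
  note first = good_row_first[OF p, where 'k = 'k]
  let ?a1 = "[Fl 1]"
  let ?b1 = "[]"
  have r1: "reduces (Fl 2) (map Fl [1..<2]) [] ?a1 ?b1" by code_simp
  note g2 = good_row_next[OF p _ first r1]
  let ?a2 = "[Img (Fl 1), Fl 1]"
  let ?b2 = "[Img (Fl 2)]"
  have r2: "reduces (Fl 2) (next_terms 2 ?a1 ?b1) [] ?a2 ?b2" by code_simp
  note g3 = good_row_next[OF p _ g2 r2]
  let ?a3 = "[Img (Img (Fl 1)), Img (Img (Fl 2)), Img (Fl 2)]"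
  let ?b3 = "[Img (Mt (Fl 1) (Img (Fl 2))), Img (Fl 1), Fl 1]"
  have r3: "reduces (Fl 2) (next_terms 2 ?a2 ?b2) [] ?a3 ?b3" by code_simp
  note g4 = good_row_next[OF p _ g3 r3]
  let ?a4 = "[Img (Img (Img (Fl 1))), Img (Img (Mt (Fl 1) (Img (Fl 2)))),
               Img (Mt (Img (Img (Fl 2))) (Fl 1)), Img (Img (Img (Fl 2))), Img (Img (Fl 2)),
               Img (Fl 2)]"
  let ?b4 = "[Img (Mt (Img (Img (Fl 2))) (Img (Fl 1))), Img (Img (Fl 1)),
               Img (Mt (Img (Fl 2)) (Fl 1)), Img (Fl 1), Fl 1]"
  have r4: "reduces (Fl 2) (next_terms 2 ?a3 ?b3) [] ?a4 ?b4" by code_simp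
  note g5 = good_row_next[OF p _ g4 r4]
  let ?cs = "[
      (Img (Mt (Img (Img (Fl 2))) (Fl 1)),
       [Img (Img (Fl 1)), Img (Mt (Img (Fl 2)) (Fl 1)), Img (Fl 1), Fl 1],
       [Img (Img (Img (Img (Fl 2)))), Img (Img (Img (Fl 2))), Img (Img (Fl 2)), Img (Fl 2)])]"
  let ?a = "[Fl 0, Img (Img (Img (Img (Fl 1)))), Img (Img (Img (Mt (Fl 1) (Img (Fl 2))))),
              Img (Img (Mt (Img (Img (Fl 2))) (Img (Fl 1)))),
              Img (Mt (Img (Img (Img (Fl 2)))) (Img (Img (Fl 1)))), Img (Img (Img (Fl 1))),
              Img (Img (Mt (Img (Fl 2)) (Fl 1))), Img (Mt (Img (Img (Fl 2))) (Img (Fl 1))),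
              Mt (Img (Mt (Img (Img (Fl 2))) (Fl 1))) (Img (Img (Fl 1))),
              Mt (Img (Mt (Img (Img (Fl 2))) (Fl 1))) (Jn (Img (Img (Fl 1))) (Img (Img (Img (Img (Fl 2))))))]"
  let ?b = "[Img (Mt (Img (Mt (Img (Img (Fl 2))) (Fl 1))) (Img (Img (Fl 1)))),
              Img (Img (Mt (Img (Img (Fl 2))) (Fl 1))),
              Img (Mt (Img (Img (Img (Fl 2)))) (Img (Mt (Img (Fl 2)) (Fl 1)))),
              Img (Mt (Img (Img (Img (Fl 2)))) (Img (Fl 1))),
              Img (Mt (Img (Img (Img (Fl 2)))) (Fl 1)),
              Mt (Img (Mt (Img (Img (Fl 2))) (Fl 1))) (Img (Img (Img (Img (Fl 2)))))]"
  have r5: "reduces (Fl 2) (next_terms 2 ?a4 ?b4) ?cs ?a ?b" by code_simp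
  consider "n = 1" | "n = Suc 1" | "n = Suc (Suc 1)" | "n = Suc (Suc (Suc 1))" | "n = Suc (Suc (Suc (Suc 1)))"
    using n by fastforce
  then show ?thesis
  proof cases
    case 1
    then show ?thesis using finite_indecs_if_reduces[OF p _ first r1] by simp
  next
    case 2
    then show ?thesis using finite_indecs_if_reduces[OF p _ g2 r2] by simp
  next
    case 3
    then show ?thesis using finite_indecs_if_reduces[OF p _ g3 r3] by simp
  next
    case 4
    then show ?thesis using finite_indecs_if_reduces[OF p _ g4 r4] by simp
  next
    case 5
    then show ?thesis using finite_indecs_if_reduces[OF p _ g5 r5] by simp
  qed
qed

text \<open>
  In the third row there are 11 subspaces, of width three; restriction to the image of the second member
  of the flag of row 2 brings the width down to two.
\<close>

lemma finite_three_columns: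
  assumes n: "n \<in> {1..3}"
  shows "finite ((indecs 3 n :: 'k::field quiver_rep set) // iso_rel 3 n)"
proof -
  have p: "(3::nat) \<ge> 1" by simp
  note first = good_row_first[OF p, where 'k = 'k]
  let ?a1 = "[Fl 1, Fl 2]"
  let ?b1 = "[]"
  have r1: "reduces (Fl 3) (map Fl [1..<3]) [] ?a1 ?b1" by code_simp
  note g2 = good_row_next[OF p _ first r1]
  let ?a2 = "[Img (Fl 1), Fl 1, Fl 2]"
  let ?b2 = "[Img (Fl 2), Img (Fl 3)]"
  have r2: "reduces (Fl 3) (next_terms 3 ?a1 ?b1) [] ?a2 ?b2" by code_simp
  note g3 = good_row_next[OF p _ g2 r2]
  let ?cs = "[
      (Img (Fl 2),
       [Fl 1, Fl 2],
       [Img (Img (Fl 3)), Img (Fl 3)])]"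
  let ?a = "[Fl 0, Img (Img (Fl 1)), Img (Mt (Fl 1) (Img (Fl 2))), Img (Img (Fl 2)),
              Img (Mt (Fl 2) (Img (Fl 3))), Mt (Img (Fl 2)) (Img (Img (Fl 3)))]"
  let ?b = "[Img (Mt (Fl 1) (Img (Fl 3))), Img (Fl 1), Mt (Img (Fl 2)) (Fl 1),
              Mt (Img (Fl 2)) (Jn (Fl 1) (Img (Img (Fl 3))))]"
  have r3: "reduces (Fl 3) (next_terms 3 ?a2 ?b2) ?cs ?a ?b" by code_simp
  consider "n = 1" | "n = Suc 1" | "n = Suc (Suc 1)"
    using n by fastforce
  then show ?thesis
  proof cases
    case 1
    then show ?thesis using finite_indecs_if_reduces[OF p _ first r1] by simp
  next
    case 2
    then show ?thesis using finite_indecs_if_reduces[OF p _ g2 r2] by simp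
  next
    case 3
    then show ?thesis using finite_indecs_if_reduces[OF p _ g3 r3] by simp
  qed
qed

text \<open>
  In the third row there are 17 subspaces, of width three. The width stays three under the first three
  restrictions and drops to two with the fourth.
\<close>

lemma finite_four_columns:
  assumes n: "n \<in> {1..3}"
  shows "finite ((indecs 4 n :: 'k::field quiver_rep set) // iso_rel 4 n)"
proof -
  have p: "(4::nat) \<ge> 1" by simp
  note first = good_row_first[OF p, where 'k = 'k]
  let ?a1 = "[Fl 1, Fl 2, Fl 3]"
  let ?b1 = "[]"
  have r1: "reduces (Fl 4) (map Fl [1..<4]) [] ?a1 ?b1" by code_simp
  note g2 = good_row_next[OF p _ first r1]
  let ?a2 = "[Img (Fl 1), Fl 1, Fl 2, Fl 3]"
  let ?b2 = "[Img (Fl 2), Img (Fl 3), Img (Fl 4)]"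
  have r2: "reduces (Fl 4) (next_terms 4 ?a1 ?b1) [] ?a2 ?b2" by code_simp
  note g3 = good_row_next[OF p _ g2 r2]
  let ?cs = "[
      (Fl 2,
       [Img (Img (Fl 3)), Img (Img (Fl 4)), Img (Fl 4)],
       [Img (Mt (Fl 3) (Img (Fl 4))), Img (Fl 3), Fl 3]),
      (Mt (Fl 2) (Img (Fl 3)),
       [Fl 1],
       [Mt (Fl 2) (Img (Img (Fl 4))), Mt (Fl 2) (Jn (Img (Img (Fl 4))) (Img (Fl 3))),
        Mt (Fl 2) (Img (Fl 4))]),
      (Img (Fl 2),
       [Mt (Fl 2) (Img (Img (Fl 3))), Mt (Fl 2) (Img (Mt (Fl 3) (Img (Fl 4)))),
        Mt (Mt (Fl 2) (Img (Fl 3))) (Img (Img (Fl 4)))],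
       [Mt (Mt (Fl 2) (Img (Fl 3))) (Fl 1),
        Mt (Mt (Fl 2) (Img (Fl 3))) (Jn (Fl 1) (Mt (Fl 2) (Img (Img (Fl 4)))))]),
      (Mt (Img (Fl 2)) (Img (Img (Fl 3))),
       [Img (Mt (Fl 1) (Img (Fl 4))), Img (Fl 1), Mt (Img (Fl 2)) (Fl 1),
        Mt (Img (Fl 2)) (Jn (Mt (Fl 2) (Img (Img (Fl 3)))) (Mt (Mt (Fl 2) (Img (Fl 3))) (Fl 1))),
        Mt (Img (Fl 2)) (Jn (Mt (Fl 2) (Img (Mt (Fl 3) (Img (Fl 4))))) (Mt (Mt (Fl 2) (Img (Fl 3))) (Fl 1))),
        Mt (Img (Fl 2)) (Jn (Fl 1) (Mt (Fl 2) (Img (Img (Fl 4)))))],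
       [Img (Mt (Fl 2) (Img (Fl 4))), Mt (Img (Fl 2)) (Img (Mt (Fl 3) (Img (Fl 4)))),
        Mt (Img (Fl 2)) (Img (Img (Fl 4))),
        Mt (Img (Fl 2)) (Jn (Mt (Mt (Fl 2) (Img (Fl 3))) (Img (Img (Fl 4)))) (Mt (Mt (Fl 2) (Img (Fl 3))) (Fl 1)))])]"
  let ?a = "[Fl 0, Img (Img (Fl 1)), Img (Mt (Fl 1) (Img (Fl 2))), Img (Img (Fl 2)),
              Img (Mt (Fl 2) (Img (Fl 3))),
              Mt (Mt (Img (Fl 2)) (Img (Img (Fl 3)))) (Img (Mt (Fl 2) (Img (Fl 4)))),
              Mt (Mt (Img (Fl 2)) (Img (Img (Fl 3)))) (Jn (Img (Fl 1)) (Img (Mt (Fl 2) (Img (Fl 4)))))]"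
  let ?b = "[Img (Mt (Fl 1) (Img (Fl 3))),
              Mt (Mt (Img (Fl 2)) (Img (Img (Fl 3)))) (Img (Mt (Fl 1) (Img (Fl 4)))),
              Mt (Mt (Img (Fl 2)) (Img (Img (Fl 3)))) (Img (Fl 1)),
              Mt (Mt (Img (Fl 2)) (Img (Img (Fl 3)))) (Fl 1),
              Mt (Mt (Img (Fl 2)) (Img (Img (Fl 3)))) (Jn (Mt (Img (Fl 2)) (Fl 1)) (Img (Mt (Fl 2) (Img (Fl 4)))))]"
  have r3: "reduces (Fl 4) (next_terms 4 ?a2 ?b2) ?cs ?a ?b" by code_simp
  consider "n = 1" | "n = Suc 1" | "n = Suc (Suc 1)"
    using n by fastforce
  then show ?thesis
  proof cases
    case 1
    then show ?thesis using finite_indecs_if_reduces[OF p _ first r1] by simp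
  next
    case 2
    then show ?thesis using finite_indecs_if_reduces[OF p _ g2 r2] by simp
  next
    case 3
    then show ?thesis using finite_indecs_if_reduces[OF p _ g3 r3] by simp
  qed
qed

section \<open>Natural subspaces\<close>

lemma infinite_alg_closed_field: "infinite (UNIV :: 'k::alg_closed_field set)"
proof
  assume fin: "finite (UNIV :: 'k set)"
  define q where "q = (\<Prod>a\<in>(UNIV :: 'k set). [:- a, 1:])"
  have "degree q = (\<Sum>a\<in>(UNIV :: 'k set). degree [:- a, 1:])"
    unfolding q_def by (rule degree_prod_eq_sum_degree) simp
  then have "degree q > 0" using fin by (simp add: card_gt_0_iff)
  then have "degree (q + 1) > 0" by (simp add: degree_add_eq_left)
  then obtain x where "poly (q + 1) x = 0" using alg_closed_imp_poly_has_root by blast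
  moreover have "poly q x = 0"
    unfolding q_def poly_prod using fin by (intro prod_zero bexI[of _ x]) auto
  ultimately show False by simp
qed

text \<open>
  Subspaces at the vertex \<open>v\<close> that are preserved by all morphisms. In contrast to the terms above they may
  also be preimages under vertical maps, which look at later rows.
\<close>

definition natural :: "nat \<Rightarrow> nat \<Rightarrow> nat \<times> nat \<Rightarrow> ('k::field quiver_rep \<Rightarrow> (nat \<Rightarrow> 'k) set) \<Rightarrow> bool"
  where "natural p n v T \<longleftrightarrow> (\<forall>M\<in>rep_inj p n. T M \<subseteq> sp M v \<and>
    (\<forall>N\<in>rep_inj p n. \<forall>f. morphism p n M N f \<longrightarrow> f v ` T M \<subseteq> T N))"

lemma naturalI:
  assumes "\<And>M x. M \<in> rep_inj p n \<Longrightarrow> x \<in> T M \<Longrightarrow> x \<in> sp M v"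
    and "\<And>M N f x. M \<in> rep_inj p n \<Longrightarrow> N \<in> rep_inj p n \<Longrightarrow> morphism p n M N f \<Longrightarrow> x \<in> T M \<Longrightarrow> f v x \<in> T N"
  shows "natural p n v T"
  using assms unfolding natural_def by blast

lemma naturalD:
  assumes "natural p n v T" "M \<in> rep_inj p n" "x \<in> T M"
  shows "x \<in> sp M v"
    and "N \<in> rep_inj p n \<Longrightarrow> morphism p n M N f \<Longrightarrow> f v x \<in> T N"
  using assms unfolding natural_def by blast+

lemma natural_flag:
  assumes "k \<in> {1..n}" "l \<in> {1..p}"
  shows "natural p n (k, p) (\<lambda>M. to_last p M k l ` sp M (k, l))"
proof (rule naturalI)
  fix M N :: "'a quiver_rep" and f x
  assume M: "M \<in> rep_inj p n" and f: "morphism p n M N f" and "x \<in> to_last p M k l ` sp M (k, l)"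
  then obtain y where y: "y \<in> sp M (k, l)" "x = to_last p M k l y" by blast
  moreover have "f (k, l) y \<in> sp N (k, l)"
    using morphism_in[OF f _ y(1)] assms by (simp add: vertices_def)
  ultimately show "f (k, p) x \<in> to_last p N k l ` sp N (k, l)"
    using morphism_to_last[OF rep_inj_rep[OF M] f assms(1) _ _ y(1)] assms(2) by simp
qed (use to_last_in[OF _ assms(1,2)] in blast)

lemma natural_image:
  assumes T: "natural p n (k, p) T" and k: "1 \<le> k" "k < n" "1 \<le> p"
  shows "natural p n (Suc k, p) (\<lambda>M. ver M (k, p) ` T M)"
proof -
  have a: "(k, p) \<in> varrows p n" using k by (simp add: varrows_def)
  show ?thesis
  proof (rule naturalI)
    fix M :: "'a quiver_rep" and x assume "M \<in> rep_inj p n" "x \<in> ver M (k, p) ` T M"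
    then show "x \<in> sp M (Suc k, p)"
      using repD(3)[OF rep_inj_rep a] naturalD(1)[OF T] by (force simp: linear_between_def)
  next
    fix M N :: "'a quiver_rep" and f x
    assume M: "M \<in> rep_inj p n" "N \<in> rep_inj p n" "morphism p n M N f" and "x \<in> ver M (k, p) ` T M"
    then obtain y where y: "y \<in> T M" "x = ver M (k, p) y" by blast
    then have "f (Suc k, p) x = ver N (k, p) (f (k, p) y)"
      using morphismD(3)[OF M(3) a] naturalD(1)[OF T M(1)] by simp
    then show "f (Suc k, p) x \<in> ver N (k, p) ` T N" using naturalD(2)[OF T M(1) y(1) M(2,3)] by blast
  qed
qed

lemma natural_preimage:
  assumes T: "natural p n (Suc k, p) T" and k: "1 \<le> k" "k < n" "1 \<le> p"
  shows "natural p n (k, p) (\<lambda>M. {x \<in> sp M (k, p). ver M (k, p) x \<in> T M})"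
proof -
  have a: "(k, p) \<in> varrows p n" using k by (simp add: varrows_def)
  show ?thesis
  proof (rule naturalI)
    fix M N :: "'a quiver_rep" and f x
    assume M: "M \<in> rep_inj p n" "N \<in> rep_inj p n" "morphism p n M N f"
      and x: "x \<in> {x \<in> sp M (k, p). ver M (k, p) x \<in> T M}"
    have "f (k, p) x \<in> sp N (k, p)"
      using morphism_in[OF M(3)] varrows_vertices[OF a] x by blast
    moreover have "ver N (k, p) (f (k, p) x) = f (Suc k, p) (ver M (k, p) x)"
      using morphismD(3)[OF M(3) a] x by simp
    ultimately show "f (k, p) x \<in> {x \<in> sp N (k, p). ver N (k, p) x \<in> T N}"
      using naturalD(2)[OF T M(1) _ M(2,3)] x by simp
  qed simp
qed

lemma natural_zero:
  assumes v: "v \<in> vertices p n"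
  shows "natural p n v (\<lambda>M. {0})"
proof (rule naturalI)
  fix M :: "'a quiver_rep" and x :: "nat \<Rightarrow> 'a" assume M: "M \<in> rep_inj p n" "x \<in> {0}"
  then show "x \<in> sp M v" using seqvs.subspace_0[OF sp_subspace[OF rep_inj_rep v]] by blast
next
  fix M N :: "'a quiver_rep" and f and x :: "nat \<Rightarrow> 'a"
  assume "M \<in> rep_inj p n" "morphism p n M N f" "x \<in> {0}"
  then show "f v x \<in> {0}"
    using linear_between_zero[OF morphismD(1)[OF _ v] sp_subspace[OF rep_inj_rep v]] by blast
qed

lemma natural_Int:
  "natural p n v S \<Longrightarrow> natural p n v T \<Longrightarrow> natural p n v (\<lambda>M. S M \<inter> T M)"
  unfolding natural_def by blast

lemma natural_sum:
  assumes S: "natural p n v S" and T: "natural p n v T" and v: "v \<in> vertices p n"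
  shows "natural p n v (\<lambda>M. {x + y | x y. x \<in> S M \<and> y \<in> T M})"
proof (rule naturalI)
  fix M :: "'a quiver_rep" and x assume M: "M \<in> rep_inj p n" "x \<in> {x + y | x y. x \<in> S M \<and> y \<in> T M}"
  then show "x \<in> sp M v"
    using naturalD(1)[OF S] naturalD(1)[OF T] seqvs.subspace_add[OF sp_subspace[OF rep_inj_rep v]] by blast
next
  fix M N :: "'a quiver_rep" and f x
  assume M: "M \<in> rep_inj p n" "N \<in> rep_inj p n" "morphism p n M N f"
    and "x \<in> {x + y | x y. x \<in> S M \<and> y \<in> T M}"
  then obtain y z where yz: "y \<in> S M" "z \<in> T M" "x = y + z" by blast
  then have "f v x = f v y + f v z"
    using morphismD(1)[OF M(3) v] naturalD(1)[OF S M(1)] naturalD(1)[OF T M(1)]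
    by (simp add: linear_between_def)
  then show "f v x \<in> {x + y | x y. x \<in> S N \<and> y \<in> T N}"
    using naturalD(2)[OF S M(1) yz(1) M(2,3)] naturalD(2)[OF T M(1) yz(2) M(2,3)] by blast
qed

section \<open>Direct summands\<close>

lemma direct_sum_commute:
  assumes "direct_sum_of p n M U W"
  shows "direct_sum_of p n M W U"
proof -
  have "{u + w | u w. u \<in> U v \<and> w \<in> W v} = {w + u | w u. w \<in> W v \<and> u \<in> U v}" for v
  proof -
    have "u + w = w + u" for u w :: "nat \<Rightarrow> 'a" by (rule add.commute)
    then show ?thesis by blast
  qed
  moreover have "U v \<inter> W v = W v \<inter> U v" for v by (rule Int_commute)
  ultimately show ?thesis using assms unfolding direct_sum_of_def by simp
qed

lemma summand_in_rep_inj: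
  assumes M: "M \<in> rep_inj p n" and U: "subrep p n M U"
  shows "M\<lparr>sp := U\<rparr> \<in> rep_inj p n"
proof -
  note R = rep_inj_rep[OF M]
  have "fin_dim_subspace (U v)" if "v \<in> vertices p n" for v
    using fin_dim_subset[OF repD(1)[OF R that]] subrepD(1,2)[OF U that] by blast
  moreover have sub: "U (k, l) \<subseteq> sp M (k, l)" if "(k, l) \<in> harrows p n" for k l
    using subrepD(2)[OF U] harrows_vertices[OF that] by blast
  moreover have "inj_on (hor M (k, l)) (U (k, l))" if h: "(k, l) \<in> harrows p n" for k l
    using M h inj_on_subset[OF _ sub[OF h]] unfolding rep_inj_def by blast
  moreover have "ver M (k, l + 1) (hor M (k, l) x) = hor M (k + 1, l) (ver M (k, l) x)"
    if "(k, l) \<in> harrows p n" "(k, l) \<in> varrows p n" "x \<in> U (k, l)" for k l x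
    using repD_comm[OF R that(1,2)] sub[OF that(1)] that(3) by blast
  ultimately show ?thesis
    using subrep_linear[OF R U] unfolding rep_inj_def rep_def by auto
qed

lemma projection_morphism:
  assumes M: "M \<in> rep p n" and dir: "direct_sum_of p n M U W"
  shows "\<exists>e. morphism p n M (M\<lparr>sp := U\<rparr>) e \<and>
    (\<forall>v\<in>vertices p n. \<forall>u\<in>U v. \<forall>w\<in>W v. e v (u + w) = u)"
proof -
  have U: "subrep p n M U" and W: "subrep p n M W" using dir by (auto simp: direct_sum_of_def)
  have SU: "seqvs.subspace (U v)" and SW: "seqvs.subspace (W v)" if "v \<in> vertices p n" for v
    using subrepD(1)[OF U that] subrepD(1)[OF W that] by auto
  define e where "e v x = (THE u. u \<in> U v \<and> (\<exists>w\<in>W v. x = u + w))" for v x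
  have e: "e v (u + w) = u" if v: "v \<in> vertices p n" and u: "u \<in> U v" and w: "w \<in> W v" for v u w
    unfolding e_def
  proof (rule the_equality)
    show "u \<in> U v \<and> (\<exists>w'\<in>W v. u + w = u + w')" using u w by blast
    fix u' assume "u' \<in> U v \<and> (\<exists>w'\<in>W v. u + w = u' + w')"
    then obtain w' where u': "u' \<in> U v" "w' \<in> W v" "u + w = u' + w'" by blast
    have d: "u - u' = w' - w" using u'(3) by (metis add_diff_cancel_left' add_diff_cancel_right add_diff_eq diff_diff_eq2)
    have "u - u' \<in> U v" "w' - w \<in> W v"
      using SU[OF v] SW[OF v] u w u' by (auto intro: seqvs.subspace_diff)
    then have "u - u' \<in> U v \<inter> W v" using d by (metis IntI)
    moreover have "U v \<inter> W v = {0}" using dir v unfolding direct_sum_of_def by blast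
    ultimately have "u - u' = 0" by (metis singletonD)
    then show "u' = u" by simp
  qed
  have split: "\<exists>u w. u \<in> U v \<and> w \<in> W v \<and> x = u + w" if "v \<in> vertices p n" "x \<in> sp M v" for v x
    using dir that unfolding direct_sum_of_def by blast
  have "morphism p n M (M\<lparr>sp := U\<rparr>) e"
    unfolding morphism_def sp_upd_simps
  proof (intro conjI ballI; (clarify)?)
    fix a b assume v: "(a, b) \<in> vertices p n" (is "?v \<in> _")
    show "linear_between (sp M ?v) (U ?v) (e ?v)"
      unfolding linear_between_def
    proof (intro conjI ballI allI)
      fix x assume x: "x \<in> sp M ?v"
      obtain u w where uw: "u \<in> U ?v" "w \<in> W ?v" "x = u + w" using split[OF v x] by blast
      then show "e ?v x \<in> U ?v" using e[OF v] by simp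
      show "e ?v (c *\<^sub>s x) = c *\<^sub>s e ?v x" for c
      proof -
        have "c *\<^sub>s x = c *\<^sub>s u + c *\<^sub>s w" using uw(3) by (simp add: seqvs.scale_right_distrib)
        then show ?thesis
          using e[OF v] uw SU[OF v] SW[OF v] by (simp add: seqvs.subspace_scale)
      qed
      fix y assume y: "y \<in> sp M ?v"
      obtain u' w' where uw': "u' \<in> U ?v" "w' \<in> W ?v" "y = u' + w'" using split[OF v y] by blast
      have xy: "x + y = (u + u') + (w + w')" using uw(3) uw'(3) by (simp add: algebra_simps)
      have "e ?v ((u + u') + (w + w')) = u + u'"
        using uw uw' SU[OF v] SW[OF v] by (intro e[OF v] seqvs.subspace_add)
      moreover have "e ?v x = u" "e ?v y = u'" using e[OF v] uw uw' by simp_all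
      ultimately show "e ?v (x + y) = e ?v x + e ?v y" by (simp only: xy)
    qed
  next
    fix k l x assume h: "(k, l) \<in> harrows p n" and x: "x \<in> sp M (k, l)"
    have v: "(k, l) \<in> vertices p n" "(k, l + 1) \<in> vertices p n" using harrows_vertices[OF h] by auto
    obtain u w where uw: "u \<in> U (k, l)" "w \<in> W (k, l)" "x = u + w" using split[OF v(1) x] by blast
    have "hor M (k, l) x = hor M (k, l) u + hor M (k, l) w"
      using repD(2)[OF M h] uw subrepD(2)[OF U v(1)] subrepD(2)[OF W v(1)] unfolding linear_between_def by blast
    then show "e (k, l + 1) (hor M (k, l) x) = hor M (k, l) (e (k, l) x)"
      using e[OF v(1)] e[OF v(2)] uw subrepD(3)[OF U h] subrepD(3)[OF W h] by simp
  next
    fix k l x assume h: "(k, l) \<in> varrows p n" and x: "x \<in> sp M (k, l)"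
    have v: "(k, l) \<in> vertices p n" "(k + 1, l) \<in> vertices p n" using varrows_vertices[OF h] by auto
    obtain u w where uw: "u \<in> U (k, l)" "w \<in> W (k, l)" "x = u + w" using split[OF v(1) x] by blast
    have "ver M (k, l) x = ver M (k, l) u + ver M (k, l) w"
      using repD(3)[OF M h] uw subrepD(2)[OF U v(1)] subrepD(2)[OF W v(1)] unfolding linear_between_def by blast
    then show "e (k + 1, l) (ver M (k, l) x) = ver M (k, l) (e (k, l) x)"
      using e[OF v(1)] e[OF v(2)] uw subrepD(4)[OF U h] subrepD(4)[OF W h] by simp
  qed
  then show ?thesis using e by blast
qed

lemma inclusion_morphism:
  assumes "subrep p n M U"
  shows "morphism p n (M\<lparr>sp := U\<rparr>) M (\<lambda>_ x. x)"
  using subrepD(2)[OF assms] unfolding morphism_def by (auto simp: linear_between_def)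

lemma direct_sum_refine:
  assumes M: "M \<in> rep p n" and dir: "direct_sum_of p n M U W"
    and sub: "direct_sum_of p n (M\<lparr>sp := U\<rparr>) A B"
  shows "direct_sum_of p n M A (\<lambda>v. {b + w | b w. b \<in> B v \<and> w \<in> W v})"
proof -
  let ?C = "\<lambda>v. {b + w | b w. b \<in> B v \<and> w \<in> W v}"
  have U: "subrep p n M U" and W: "subrep p n M W"
    and UW: "\<And>v. v \<in> vertices p n \<Longrightarrow> sp M v = {u + w | u w. u \<in> U v \<and> w \<in> W v} \<and> U v \<inter> W v = {0}"
    using dir unfolding direct_sum_of_def by blast+
  have A': "subrep p n (M\<lparr>sp := U\<rparr>) A" and B': "subrep p n (M\<lparr>sp := U\<rparr>) B"
    and AB: "\<And>v. v \<in> vertices p n \<Longrightarrow> U v = {u + w | u w. u \<in> A v \<and> w \<in> B v} \<and> A v \<inter> B v = {0}"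
    using sub unfolding direct_sum_of_def sp_upd_simps by blast+
  have AU: "A v \<subseteq> U v" and BU: "B v \<subseteq> U v" if "v \<in> vertices p n" for v
    using subrepD(2)[OF A' that] subrepD(2)[OF B' that] by simp_all
  have UM: "U v \<subseteq> sp M v" and WM: "W v \<subseteq> sp M v" if "v \<in> vertices p n" for v
    using subrepD(2)[OF U that] subrepD(2)[OF W that] by simp_all
  have A: "subrep p n M A"
    using A' UM AU unfolding subrep_def sp_upd_simps by (meson order_trans)
  have S: "seqvs.subspace (sp M v)" "seqvs.subspace (A v)" "seqvs.subspace (B v)" "seqvs.subspace (W v)"
    "seqvs.subspace (U v)" if "v \<in> vertices p n" for v
    using sp_subspace[OF M that] subrepD(1)[OF A' that] subrepD(1)[OF B' that] subrepD(1)[OF W that]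
      subrepD(1)[OF U that] by auto
  have C: "subrep p n M ?C"
    unfolding subrep_def
  proof (intro conjI ballI; (clarify)?)
    fix a b assume v: "(a, b) \<in> vertices p n"
    show "seqvs.subspace (?C (a, b))" using S[OF v] by (intro seqvs.subspace_sums)
    fix x y assume "x \<in> B (a, b)" "y \<in> W (a, b)"
    then show "x + y \<in> sp M (a, b)"
      using S(1)[OF v] BU[OF v] UM[OF v] WM[OF v] by (meson seqvs.subspace_add subsetD)
  next
    fix k l b w assume h: "(k, l) \<in> harrows p n" and bw: "b \<in> B (k, l)" "w \<in> W (k, l)"
    have v: "(k, l) \<in> vertices p n" using harrows_vertices[OF h] by simp
    have "hor M (k, l) (b + w) = hor M (k, l) b + hor M (k, l) w"
      using repD(2)[OF M h] bw BU[OF v] UM[OF v] WM[OF v] unfolding linear_between_def by blast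
    then show "\<exists>b' w'. hor M (k, l) (b + w) = b' + w' \<and> b' \<in> B (k, l + 1) \<and> w' \<in> W (k, l + 1)"
      using subrepD(3)[OF B' h bw(1)] subrepD(3)[OF W h bw(2)] by auto
  next
    fix k l b w assume h: "(k, l) \<in> varrows p n" and bw: "b \<in> B (k, l)" "w \<in> W (k, l)"
    have v: "(k, l) \<in> vertices p n" using varrows_vertices[OF h] by simp
    have "ver M (k, l) (b + w) = ver M (k, l) b + ver M (k, l) w"
      using repD(3)[OF M h] bw BU[OF v] UM[OF v] WM[OF v] unfolding linear_between_def by blast
    then show "\<exists>b' w'. ver M (k, l) (b + w) = b' + w' \<and> b' \<in> B (k + 1, l) \<and> w' \<in> W (k + 1, l)"
      using subrepD(4)[OF B' h bw(1)] subrepD(4)[OF W h bw(2)] by auto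
  qed
  have sum: "sp M v = {u + w | u w. u \<in> A v \<and> w \<in> ?C v}" if v: "v \<in> vertices p n" for v
  proof
    show "sp M v \<subseteq> {u + w | u w. u \<in> A v \<and> w \<in> ?C v}"
    proof
      fix x assume "x \<in> sp M v"
      then obtain u w where uw: "u \<in> U v" "w \<in> W v" "x = u + w" using UW[OF v] by blast
      obtain a b where ab: "a \<in> A v" "b \<in> B v" "u = a + b" using AB[OF v] uw(1) by blast
      have "x = a + (b + w)" using uw(3) ab(3) by (simp add: add.assoc)
      then show "x \<in> {u + w | u w. u \<in> A v \<and> w \<in> ?C v}" using ab(1,2) uw(2) by blast
    qed
    show "{u + w | u w. u \<in> A v \<and> w \<in> ?C v} \<subseteq> sp M v"
      using S(1)[OF v] subrepD(2)[OF A v] subrepD(2)[OF C v] seqvs.subspace_add by blast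
  qed
  have "A v \<inter> ?C v = {0}" if v: "v \<in> vertices p n" for v
  proof
    show "A v \<inter> ?C v \<subseteq> {0}"
    proof
      fix x assume x: "x \<in> A v \<inter> ?C v"
      then obtain b w where bw: "b \<in> B v" "w \<in> W v" "x = b + w" by blast
      have "x - b \<in> U v" using x bw(1) AU[OF v] BU[OF v] S(5)[OF v] by (meson IntD1 seqvs.subspace_diff subsetD)
      moreover have "x - b = w" using bw(3) by simp
      ultimately have "w = 0" using UW[OF v] bw(2) by auto
      then have "x = b" using bw(3) by simp
      then show "x \<in> {0}" using x bw(1) AB[OF v] by auto
    qed
    show "{0} \<subseteq> A v \<inter> ?C v"
      using seqvs.subspace_0[OF S(2)[OF v]] seqvs.subspace_0[OF subrepD(1)[OF C v]] by simp
  qed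
  with A C sum show ?thesis unfolding direct_sum_of_def by blast
qed

section \<open>A plane with four natural lines\<close>

lemma plane_coordinates:
  fixes e1 e2 :: "nat \<Rightarrow> 'k::field"
  assumes indep: "\<And>a b. a *\<^sub>s e1 + b *\<^sub>s e2 = 0 \<Longrightarrow> a = 0 \<and> b = 0"
    and eq: "a *\<^sub>s e1 + b *\<^sub>s e2 = c *\<^sub>s e1 + d *\<^sub>s e2"
  shows "a = c \<and> b = d"
proof -
  have "(a - c) *\<^sub>s e1 + (b - d) *\<^sub>s e2 = (a *\<^sub>s e1 + b *\<^sub>s e2) - (c *\<^sub>s e1 + d *\<^sub>s e2)"
    by (simp add: seqvs.scale_left_diff_distrib algebra_simps)
  then show ?thesis using indep[of "a - c" "b - d"] eq by simp
qed

text \<open>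
  The projection onto a summand preserves the three lines, so it acts on the plane as a scalar, which is
  \<open>0\<close> or \<open>1\<close>.
\<close>

lemma plane_in_one_summand:
  assumes M: "M \<in> rep_inj p n" and dir: "direct_sum_of p n M U W" and v: "v \<in> vertices p n"
    and T: "natural p n v T1" "natural p n v T2" "natural p n v T3"
    and indep: "\<And>a b. a *\<^sub>s e1 + b *\<^sub>s e2 = 0 \<Longrightarrow> a = 0 \<and> b = 0"
    and lines: "e1 \<in> T1 M" "T1 M \<subseteq> seqvs.span {e1}" "e2 \<in> T2 M" "T2 M \<subseteq> seqvs.span {e2}"
      "e1 + e2 \<in> T3 M" "T3 M \<subseteq> seqvs.span {e1 + e2}"
  shows "e1 \<in> U v \<and> e2 \<in> U v \<or> e1 \<in> W v \<and> e2 \<in> W v"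
proof -
  have U: "subrep p n M U" and W: "subrep p n M W" using dir unfolding direct_sum_of_def by blast+
  obtain e where e: "morphism p n M (M\<lparr>sp := U\<rparr>) e" "\<And>u w. u \<in> U v \<Longrightarrow> w \<in> W v \<Longrightarrow> e v (u + w) = u"
    using projection_morphism[OF rep_inj_rep[OF M] dir] v by blast
  have e': "morphism p n M M e" using morphism_comp[OF e(1) inclusion_morphism[OF U]] by simp
  note in_line = naturalD(2)[OF _ M _ M e']
  have sp: "e1 \<in> sp M v" "e2 \<in> sp M v" using naturalD(1)[OF _ M] T lines by blast+
  obtain a where a: "e v e1 = a *\<^sub>s e1"
    using in_line[OF T(1) lines(1)] lines(2) by (auto simp: seqvs.span_singleton)
  obtain b where b: "e v e2 = b *\<^sub>s e2"
    using in_line[OF T(2) lines(3)] lines(4) by (auto simp: seqvs.span_singleton)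
  obtain c where c: "e v (e1 + e2) = c *\<^sub>s (e1 + e2)"
    using in_line[OF T(3) lines(5)] lines(6) by (auto simp: seqvs.span_singleton)
  have "e v (e1 + e2) = e v e1 + e v e2"
    using morphismD(1)[OF e' v] sp unfolding linear_between_def by blast
  then have "a *\<^sub>s e1 + b *\<^sub>s e2 = c *\<^sub>s e1 + c *\<^sub>s e2"
    using a b c by (simp add: seqvs.scale_right_distrib)
  then have ab: "a = c" "b = c" using plane_coordinates[OF indep] by blast+
  have SU: "0 \<in> U v" and SW: "0 \<in> W v"
    using seqvs.subspace_0[OF subrepD(1)[OF U v]] seqvs.subspace_0[OF subrepD(1)[OF W v]] by auto
  have split: "\<exists>u w. u \<in> U v \<and> w \<in> W v \<and> x = u + w" if "x \<in> sp M v" for x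
    using dir v that unfolding direct_sum_of_def by blast
  have inU: "e v x \<in> U v" if "x \<in> sp M v" for x using morphism_in[OF e(1) v that] by simp
  show ?thesis
  proof (cases "c = 0")
    case True
    have "x \<in> W v" if x: "x \<in> sp M v" "e v x = 0" for x
    proof -
      obtain u w where uw: "u \<in> U v" "w \<in> W v" "x = u + w" using split[OF x(1)] by blast
      then have "u = 0" using e(2) x(2) by metis
      then show ?thesis using uw by simp
    qed
    then show ?thesis using True ab a b sp by simp
  next
    case False
    have scaled: "x \<in> U v" if "x \<in> sp M v" "e v x = c *\<^sub>s x" for x
    proof -
      have "(1 / c) *\<^sub>s e v x \<in> U v" using inU[OF that(1)] subrepD(1)[OF U v] by (rule seqvs.subspace_scale[rotated])
      then show ?thesis using that(2) False by simp
    qed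
    then show ?thesis using ab a b sp by metis
  qed
qed

text \<open>
  A summand of least total dimension among those that contain the plane is indecomposable.
\<close>

lemma indecomposable_summand_with_plane:
  assumes M: "M \<in> rep_inj p n" and v: "v \<in> vertices p n"
    and T: "natural p n v T1" "natural p n v T2" "natural p n v T3"
    and indep: "\<And>a b. a *\<^sub>s e1 + b *\<^sub>s e2 = 0 \<Longrightarrow> a = 0 \<and> b = 0"
    and lines: "e1 \<in> T1 M" "T1 M \<subseteq> seqvs.span {e1}" "e2 \<in> T2 M" "T2 M \<subseteq> seqvs.span {e2}"
      "e1 + e2 \<in> T3 M" "T3 M \<subseteq> seqvs.span {e1 + e2}"
  shows "\<exists>U W. direct_sum_of p n M U W \<and> e1 \<in> U v \<and> e2 \<in> U v \<and> indecomposable p n (M\<lparr>sp := U\<rparr>)"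
proof -
  note R = rep_inj_rep[OF M]
  define d where "d U = (\<Sum>v\<in>vertices p n. seqvs.dim (U v))" for U :: "nat \<times> nat \<Rightarrow> (nat \<Rightarrow> 'a) set"
  define P where "P U \<longleftrightarrow> (\<exists>W. direct_sum_of p n M U W) \<and> e1 \<in> U v \<and> e2 \<in> U v" for U
  have zero: "subrep p n M (\<lambda>_. {0})"
    unfolding subrep_def
  proof (intro conjI ballI; (clarify)?)
    fix k l assume h: "(k, l) \<in> harrows p n"
    show "hor M (k, l) 0 = 0"
      using linear_between_zero[OF repD(2)[OF R h]] sp_subspace[OF R] harrows_vertices[OF h] by blast
  next
    fix k l assume h: "(k, l) \<in> varrows p n"
    show "ver M (k, l) 0 = 0"
      using linear_between_zero[OF repD(3)[OF R h]] sp_subspace[OF R] varrows_vertices[OF h] by blast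
  qed (use seqvs.subspace_0[OF sp_subspace[OF R]] in \<open>auto simp: seqvs.subspace_single_0\<close>)
  have "direct_sum_of p n M (sp M) (\<lambda>_. {0})"
    using zero subrep_self[OF R] seqvs.subspace_0[OF sp_subspace[OF R]] unfolding direct_sum_of_def by auto
  then have "P (sp M)" using naturalD(1)[OF _ M] T lines unfolding P_def by blast
  then obtain U where U: "P U" and min: "\<And>U'. P U' \<Longrightarrow> d U \<le> d U'"
    using arg_min_nat_lemma[of P "sp M" d] by blast
  obtain W where dir: "direct_sum_of p n M U W" using U unfolding P_def by blast
  have subU: "subrep p n M U" using dir unfolding direct_sum_of_def by blast
  have fU: "fin_dim_subspace (U v)" if "v \<in> vertices p n" for v
    using fin_dim_subset[OF repD(1)[OF R that]] subrepD(1,2)[OF subU that] by blast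
  have "e1 \<noteq> 0" using indep[of 1 0] by auto
  then have nz: "nonzero_on p n U" using U v unfolding P_def nonzero_on_def by blast
  have smaller: False
    if AB: "direct_sum_of p n (M\<lparr>sp := U\<rparr>) A B" "nonzero_on p n B" and e: "e1 \<in> A v" "e2 \<in> A v" for A B
  proof -
    have A: "subrep p n (M\<lparr>sp := U\<rparr>) A" and B: "subrep p n (M\<lparr>sp := U\<rparr>) B"
      using AB(1) unfolding direct_sum_of_def by blast+
    have "P A" using direct_sum_refine[OF R dir AB(1)] e unfolding P_def by blast
    then have "d U \<le> d A" by (rule min)
    moreover have "d A < d U"
      unfolding d_def
    proof (rule sum_strict_mono_ex1)
      show "finite (vertices p n)" by (simp add: vertices_def)
      show "\<forall>u\<in>vertices p n. seqvs.dim (A u) \<le> seqvs.dim (U u)"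
        using fin_dim_le[OF fU] subrepD(1,2)[OF A] by simp
      obtain u where u: "u \<in> vertices p n" "B u \<noteq> {0}" using AB(2) unfolding nonzero_on_def by blast
      then obtain x where x: "x \<in> B u" "x \<noteq> 0" using seqvs.subspace_0[OF subrepD(1)[OF B u(1)]] by blast
      have "A u \<inter> B u = {0}" using AB(1) u(1) unfolding direct_sum_of_def by blast
      then have "x \<notin> A u" using x by blast
      moreover have "x \<in> U u" using subrepD(2)[OF B u(1)] x(1) by auto
      moreover have "A u \<subseteq> U u" using subrepD(2)[OF A u(1)] by simp
      ultimately have "A u \<subset> U u" by blast
      then show "\<exists>u\<in>vertices p n. seqvs.dim (A u) < seqvs.dim (U u)"
        using fin_dim_psubset[OF fU[OF u(1)] subrepD(1)[OF A u(1)]] u(1) by blast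
    qed
    ultimately show False by simp
  qed
  have False if AB: "direct_sum_of p n (M\<lparr>sp := U\<rparr>) A B" "nonzero_on p n A" "nonzero_on p n B" for A B
  proof -
    have B: "subrep p n (M\<lparr>sp := U\<rparr>) B" using AB(1) unfolding direct_sum_of_def by blast
    let ?C = "\<lambda>v. {b + w | b w. b \<in> B v \<and> w \<in> W v}"
    have "e1 \<in> A v \<and> e2 \<in> A v \<or> e1 \<in> ?C v \<and> e2 \<in> ?C v"
      by (rule plane_in_one_summand[OF M direct_sum_refine[OF R dir AB(1)] v T indep lines])
    moreover have "x \<in> B v" if x: "x \<in> ?C v" "x \<in> U v" for x
    proof -
      obtain b w where bw: "b \<in> B v" "w \<in> W v" "x = b + w" using x(1) by blast
      have "b \<in> U v" using subrepD(2)[OF B v] bw(1) by auto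
      then have "x - b \<in> U v" using subrepD(1)[OF subU v] x(2) by (intro seqvs.subspace_diff)
      moreover have "x - b = w" using bw(3) by simp
      moreover have "U v \<inter> W v = {0}" using dir v unfolding direct_sum_of_def by blast
      ultimately have "w = 0" using bw(2) by (metis IntI singletonD)
      then show ?thesis using bw by simp
    qed
    ultimately have "e1 \<in> A v \<and> e2 \<in> A v \<or> e1 \<in> B v \<and> e2 \<in> B v" using U unfolding P_def by blast
    then show False using smaller[OF AB(1,3)] smaller[OF direct_sum_commute[OF AB(1)] AB(2)] by blast
  qed
  then have "indecomposable p n (M\<lparr>sp := U\<rparr>)" using nz unfolding indecomposable_def sp_upd_simps by blast
  then show ?thesis using dir U unfolding P_def by blast
qed

lemma infinite_indecs_if_four_lines:
  fixes F :: "'k::alg_closed_field \<Rightarrow> 'k quiver_rep"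
  assumes F: "\<And>c. F c \<in> rep_inj p n" and v: "v \<in> vertices p n"
    and T: "natural p n v T1" "natural p n v T2" "natural p n v T3" "natural p n v T4"
    and indep: "\<And>a b. a *\<^sub>s e1 + b *\<^sub>s e2 = 0 \<Longrightarrow> a = 0 \<and> b = 0"
    and l1: "\<And>c. e1 \<in> T1 (F c)" "\<And>c. T1 (F c) \<subseteq> seqvs.span {e1}"
    and l2: "\<And>c. e2 \<in> T2 (F c)" "\<And>c. T2 (F c) \<subseteq> seqvs.span {e2}"
    and l3: "\<And>c. e1 + e2 \<in> T3 (F c)" "\<And>c. T3 (F c) \<subseteq> seqvs.span {e1 + e2}"
    and l4: "\<And>c. e1 + c *\<^sub>s e2 \<in> T4 (F c)" "\<And>c. T4 (F c) \<subseteq> seqvs.span {e1 + c *\<^sub>s e2}"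
  shows "infinite ((indecs p n :: 'k quiver_rep set) // iso_rel p n)"
proof
  assume fin: "finite ((indecs p n :: 'k quiver_rep set) // iso_rel p n)"
  have "\<forall>c. \<exists>UW. direct_sum_of p n (F c) (fst UW) (snd UW) \<and> e1 \<in> fst UW v \<and> e2 \<in> fst UW v \<and>
      indecomposable p n ((F c)\<lparr>sp := fst UW\<rparr>)"
    using indecomposable_summand_with_plane[OF F v T(1-3) indep l1 l2 l3] by (metis fst_conv snd_conv)
  then obtain UW where UW: "\<And>c. direct_sum_of p n (F c) (fst (UW c)) (snd (UW c))"
    "\<And>c. e1 \<in> fst (UW c) v" "\<And>c. e2 \<in> fst (UW c) v"
    "\<And>c. indecomposable p n ((F c)\<lparr>sp := fst (UW c)\<rparr>)" by metis
  define U where "U c = fst (UW c)" for c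
  define X where "X c = (F c)\<lparr>sp := U c\<rparr>" for c
  have subU: "subrep p n (F c) (U c)" for c using UW(1)[of c] unfolding U_def direct_sum_of_def by blast
  have X: "X c \<in> indecs p n" for c
    using summand_in_rep_inj[OF F subU] UW(4) unfolding X_def U_def by blast
  have "\<not> inj (\<lambda>c. iso_rel p n `` {X c})"
  proof
    assume "inj (\<lambda>c. iso_rel p n `` {X c})"
    moreover have "range (\<lambda>c. iso_rel p n `` {X c}) \<subseteq> indecs p n // iso_rel p n"
      using X unfolding quotient_def by blast
    ultimately show False using fin infinite_alg_closed_field finite_subset finite_imageD by blast
  qed
  then obtain c d where cd: "c \<noteq> d" "iso_rel p n `` {X c} = iso_rel p n `` {X d}" unfolding inj_def by blast
  have "X d \<in> rep p n" using X rep_inj_rep by blast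
  then have "(X c, X d) \<in> iso_rel p n" using eq_equiv_class[OF cd(2) equiv_iso_rel] by blast
  then obtain h where h: "morphism p n (X c) (X d) h" "bij_betw (h v) (sp (X c) v) (sp (X d) v)"
    using v unfolding iso_rel_def isomorphic_def by blast
  obtain e where e: "morphism p n (F c) (X c) e" "\<And>u w. u \<in> U c v \<Longrightarrow> w \<in> snd (UW c) v \<Longrightarrow> e v (u + w) = u"
    using projection_morphism[OF rep_inj_rep[OF F] UW(1)] v unfolding X_def U_def by blast
  define f where "f u x = h u (e u x)" for u x
  have f: "morphism p n (F c) (F d) f"
    using morphism_comp[OF morphism_comp[OF e(1) h(1)] inclusion_morphism[OF subU, of d, folded X_def]]
    unfolding f_def by simp
  have "0 \<in> snd (UW c) v"
    using UW(1)[of c] v subrepD(1) seqvs.subspace_0 unfolding direct_sum_of_def by blast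
  then have ee: "e v x = x" if "x \<in> U c v" for x using e(2)[OF that] by (metis add.right_neutral)
  have sp: "e1 \<in> sp (F c) v" "e2 \<in> sp (F c) v" using naturalD(1)[OF _ F] T l1 l2 by blast+
  note L = morphismD(1)[OF f v, unfolded linear_between_def]
  have S: "c *\<^sub>s e2 \<in> sp (F c) v" using sp(2) sp_subspace[OF rep_inj_rep[OF F] v] by (simp add: seqvs.subspace_scale)
  note in_line = naturalD(2)[OF _ F _ F f]
  obtain a1 where a1: "f v e1 = a1 *\<^sub>s e1"
    using in_line[OF T(1) l1(1)] l1(2)[of d] by (auto simp: seqvs.span_singleton)
  obtain a2 where a2: "f v e2 = a2 *\<^sub>s e2"
    using in_line[OF T(2) l2(1)] l2(2)[of d] by (auto simp: seqvs.span_singleton)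
  obtain a3 where a3: "f v (e1 + e2) = a3 *\<^sub>s (e1 + e2)"
    using in_line[OF T(3) l3(1)] l3(2)[of d] by (auto simp: seqvs.span_singleton)
  obtain a4 where a4: "f v (e1 + c *\<^sub>s e2) = a4 *\<^sub>s (e1 + d *\<^sub>s e2)"
    using in_line[OF T(4) l4(1)] l4(2)[of d] by (auto simp: seqvs.span_singleton)
  have "f v (e1 + e2) = f v e1 + f v e2" using L sp by blast
  then have "a1 *\<^sub>s e1 + a2 *\<^sub>s e2 = a3 *\<^sub>s e1 + a3 *\<^sub>s e2"
    using a1 a2 a3 by (simp add: seqvs.scale_right_distrib)
  then have a12: "a1 = a3" "a2 = a3" using plane_coordinates[OF indep] by blast+
  have "f v (e1 + c *\<^sub>s e2) = f v e1 + f v (c *\<^sub>s e2)" using L sp S by blast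
  moreover have "f v (c *\<^sub>s e2) = c *\<^sub>s f v e2" using L sp by blast
  ultimately have "a1 *\<^sub>s e1 + (c * a2) *\<^sub>s e2 = a4 *\<^sub>s e1 + (a4 * d) *\<^sub>s e2"
    using a1 a2 a4 by (simp add: seqvs.scale_right_distrib)
  then have "a1 = a4" "c * a2 = a4 * d" using plane_coordinates[OF indep] by blast+
  moreover have "a1 \<noteq> 0"
  proof
    assume "a1 = 0"
    have e1U: "e1 \<in> U c v" using UW(2) unfolding U_def by simp
    have S0: "seqvs.subspace (U c v)" using subrepD(1)[OF subU v] .
    have "h v e1 = 0" using \<open>a1 = 0\<close> a1 ee[OF e1U] unfolding f_def by simp
    also have "0 = h v 0"
      using linear_between_zero[OF morphismD(1)[OF h(1) v]] S0 unfolding X_def by simp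
    finally have "e1 = 0"
      using h(2) e1U seqvs.subspace_0[OF S0] unfolding X_def bij_betw_def sp_upd_simps by (meson inj_onD)
    then show False using indep[of 1 0] by simp
  qed
  ultimately have "c = d" using a12 by (simp add: mult.commute)
  then show False using cd(1) by simp
qed

section \<open>The three minimal infinite cases\<close>

definition coords :: "nat set \<Rightarrow> (nat \<Rightarrow> 'k::field) set"
  where "coords S = {x. \<forall>i. i \<notin> S \<longrightarrow> x i = 0}"

definition unit :: "nat \<Rightarrow> nat \<Rightarrow> 'k::field"
  where "unit j = (\<lambda>i. if i = j then 1 else 0)"

lemmas pointwise = fun_eq_iff seq_scale_apply plus_fun_apply zero_fun_apply

lemma fin_dim_coords:
  assumes "finite S"
  shows "fin_dim_subspace (coords S :: (nat \<Rightarrow> 'k::field) set)"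
proof -
  have sub: "seqvs.subspace (coords S :: (nat \<Rightarrow> 'k) set)"
    by (auto simp: seqvs.subspace_def coords_def pointwise)
  have "x \<in> seqvs.span (unit ` S)" if x: "x \<in> coords S" for x :: "nat \<Rightarrow> 'k"
  proof -
    have "(\<Sum>j\<in>S. x j *\<^sub>s unit j) i = x i" for i
    proof -
      have "(\<Sum>j\<in>S. x j *\<^sub>s unit j) i = (\<Sum>j\<in>S. if i = j then x j else 0)"
        using assms by (induction S) (auto simp: pointwise unit_def)
      then show ?thesis using x assms by (simp add: coords_def)
    qed
    then have "x = (\<Sum>j\<in>S. x j *\<^sub>s unit j)" by auto
    then show ?thesis by (metis (no_types, lifting) imageI seqvs.span_base seqvs.span_scale seqvs.span_sum)
  qed
  moreover have "seqvs.span (unit ` S) \<subseteq> (coords S :: (nat \<Rightarrow> 'k) set)"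
    using sub by (intro seqvs.span_minimal) (auto simp: coords_def unit_def)
  ultimately have "coords S = seqvs.span (unit ` S :: (nat \<Rightarrow> 'k) set)" by blast
  then show ?thesis using sub assms unfolding fin_dim_subspace_def by blast
qed

text \<open>
  Representations with inclusions as horizontal maps, in bases adapted to the flags: each space is spanned
  by the unit vectors in \<open>J k l\<close>, and the vertical maps of a row do not depend on the column.
\<close>

definition grid_rep :: "(nat \<Rightarrow> nat \<Rightarrow> nat set) \<Rightarrow> (nat \<Rightarrow> (nat \<Rightarrow> 'k::field) \<Rightarrow> (nat \<Rightarrow> 'k)) \<Rightarrow> 'k quiver_rep"
  where "grid_rep J A = \<lparr>sp = (\<lambda>(k, l). coords (J k l)), hor = (\<lambda>_ x. x), ver = (\<lambda>(k, l). A k)\<rparr>"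

lemma grid_rep_simps [simp]:
  "sp (grid_rep J A) (k, l) = coords (J k l)" "hor (grid_rep J A) v x = x" "ver (grid_rep J A) (k, l) = A k"
  by (simp_all add: grid_rep_def)

lemma to_last_grid_rep [simp]: "to_last p (grid_rep J A) k l x = x"
proof -
  have "push (grid_rep J A) k r l x = x" for r
    by (induction r arbitrary: l) simp_all
  then show ?thesis by (simp add: to_last_def)
qed

lemma grid_rep_in_rep_inj:
  assumes fin: "\<And>k l. finite (J k l)" and mono: "\<And>k l. J k l \<subseteq> J k (Suc l)"
    and A: "\<And>k. slin (A k)" "\<And>k l x. k \<ge> 1 \<Longrightarrow> x \<in> coords (J k l) \<Longrightarrow> A k x \<in> coords (J (Suc k) l)"
  shows "grid_rep J A \<in> rep_inj p n"
proof -
  have "linear_between (coords (J k l)) (coords (J k (Suc l))) (\<lambda>x. x :: nat \<Rightarrow> 'a)" for k l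
    using mono[of k l] by (auto simp: linear_between_def coords_def)
  moreover have "linear_between (coords (J k l)) (coords (J (Suc k) l)) (A k)" if "k \<ge> 1" for k l
    using A that by (intro slin_linear_between) auto
  ultimately show ?thesis
    using fin_dim_coords[OF fin]
    by (auto simp: rep_inj_def rep_def varrows_def grid_rep_def)
qed

lemma unit_plane: "a *\<^sub>s unit 0 + b *\<^sub>s unit 1 = (0 :: nat \<Rightarrow> 'k::field) \<Longrightarrow> a = 0 \<and> b = 0"
proof -
  assume "a *\<^sub>s unit 0 + b *\<^sub>s unit 1 = (0 :: nat \<Rightarrow> 'k)"
  then have "(a *\<^sub>s unit 0 + b *\<^sub>s unit 1) i = (0 :: nat \<Rightarrow> 'k) i" for i by simp
  from this[of 0] this[of 1] show ?thesis by (simp add: unit_def pointwise)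
qed

text \<open>
  The coordinate \<open>i\<close> is one in which \<open>e\<close> has the entry \<open>1\<close>.
\<close>

lemma subset_lineI:
  assumes "\<And>x. x \<in> S \<Longrightarrow> x = x i *\<^sub>s e"
  shows "S \<subseteq> seqvs.span {e}"
  using assms by (auto simp: seqvs.span_singleton)

text \<open>
  Row 3 is a plane; three of the lines come from vectors of row 2 that first appear in columns 2, 3 and 4,
  and the fourth is the first member of the flag of row 3. The vectors of row 2 in columns 3 and 4 are
  images from row 1, appearing there in columns 5 and 4, and this opposite order is what separates them.
\<close>

lemma infinite_five_columns_three_rows:
  assumes p: "p \<ge> 5" and n: "n \<ge> 3"
  shows "infinite ((indecs p n :: 'k::alg_closed_field quiver_rep set) // iso_rel p n)"
proof -
  define J :: "nat \<Rightarrow> nat \<Rightarrow> nat set" where "J k l =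
    (if k = 1 then (if l < 4 then {} else if l = 4 then {0} else {0, 1})
     else if k = 2 then (if l < 2 then {} else if l = 2 then {0} else if l = 3 then {0, 1} else {0, 1, 2})
     else if k = 3 then (if l \<le> 1 then {0} else {0, 1}) else {})" for k l
  define A :: "'k \<Rightarrow> nat \<Rightarrow> (nat \<Rightarrow> 'k) \<Rightarrow> nat \<Rightarrow> 'k" where "A c k x i =
    (if k = 1 then (if i = 1 then x 1 else if i = 2 then x 0 else 0)
     else if k = 2 then (if i = 0 then x 1 + x 2 else if i = 1 then x 0 + x 1 + c * x 2 else 0)
     else 0)" for c k x i
  define F where "F c = grid_rep J (A c)" for c
  let ?fl = "\<lambda>k l (M :: 'k quiver_rep). to_last p M k l ` sp M (k, l)"
  let ?im = "\<lambda>k T (M :: 'k quiver_rep). ver M (k, p) ` T M"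
  have F: "F c \<in> rep_inj p n" for c
    unfolding F_def
  proof (rule grid_rep_in_rep_inj)
    show "slin (A c k)" for k by (auto simp: slin_iff pointwise A_def algebra_simps)
    show "A c k x \<in> coords (J (Suc k) l)" if "k \<ge> 1" "x \<in> coords (J k l)" for k l x
      using that by (auto simp: coords_def J_def A_def split: if_splits)
  qed (auto simp: J_def)
  have 1: "natural p n (3, p) (?fl 3 1)" using p n by (intro natural_flag) auto
  have 2: "natural p n (3, p) (?im 2 (?fl 2 2))"
    using natural_image[OF natural_flag[of 2 n 2 p]] p n by (simp add: eval_nat_numeral)
  have 3: "natural p n (3, p) (?im 2 (\<lambda>M. ?im 1 (?fl 1 5) M \<inter> ?fl 2 3 M))"
  proof -
    have "natural p n (2, p) (?im 1 (?fl 1 5))"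
      using natural_image[OF natural_flag[of 1 n 5 p]] p n by (simp add: eval_nat_numeral)
    moreover have "natural p n (2, p) (?fl 2 3)" using p n by (intro natural_flag) auto
    ultimately have "natural p n (2, p) (\<lambda>M. ?im 1 (?fl 1 5) M \<inter> ?fl 2 3 M)" by (rule natural_Int)
    from natural_image[OF this] show ?thesis using p n by (simp add: eval_nat_numeral)
  qed
  have 4: "natural p n (3, p) (?im 2 (?im 1 (?fl 1 4)))"
    using natural_image[OF natural_image[OF natural_flag[of 1 n 4 p]]] p n
    by (simp add: eval_nat_numeral)
  have v: "(3, p) \<in> vertices p n" using p n by (simp add: vertices_def)
  show ?thesis
  proof (rule infinite_indecs_if_four_lines[OF F v 1 2 3 4 unit_plane])
    fix c
    show "unit 0 \<in> ?fl 3 1 (F c)" by (simp add: F_def J_def coords_def unit_def)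
    show "?fl 3 1 (F c) \<subseteq> seqvs.span {unit 0}"
      by (rule subset_lineI[of _ 0]) (auto simp: F_def J_def coords_def unit_def pointwise)
    have "unit 1 = A c 2 (unit 0)" by (auto simp: A_def unit_def pointwise)
    then show "unit 1 \<in> ?im 2 (?fl 2 2) (F c)" by (auto simp: F_def J_def coords_def unit_def)
    show "?im 2 (?fl 2 2) (F c) \<subseteq> seqvs.span {unit 1}"
      by (rule subset_lineI[of _ 1]) (auto simp: F_def J_def A_def coords_def unit_def pointwise)
    have "A c 1 (unit 1) = unit 1" and A2: "A c 2 (unit 1) = unit 0 + unit 1"
      by (auto simp: A_def unit_def pointwise)
    moreover have "unit 1 \<in> (coords {0, 1} :: (nat \<Rightarrow> 'k) set)" by (simp add: coords_def unit_def)
    ultimately have "unit 1 \<in> A c 1 ` coords {0, 1} \<inter> coords {0, 1}" by (metis IntI imageI)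
    then have "unit 0 + unit 1 \<in> A c 2 ` (A c 1 ` coords {0, 1} \<inter> coords {0, 1})"
      unfolding A2[symmetric] by (rule imageI)
    then show "unit 0 + unit 1 \<in> ?im 2 (\<lambda>M. ?im 1 (?fl 1 5) M \<inter> ?fl 2 3 M) (F c)"
      by (simp add: F_def J_def)
    show "?im 2 (\<lambda>M. ?im 1 (?fl 1 5) M \<inter> ?fl 2 3 M) (F c) \<subseteq> seqvs.span {unit 0 + unit 1}"
    proof (rule subset_lineI[of _ 0])
      fix x assume "x \<in> ?im 2 (\<lambda>M. ?im 1 (?fl 1 5) M \<inter> ?fl 2 3 M) (F c)"
      then have "x \<in> A c 2 ` (A c 1 ` coords {0, 1} \<inter> coords {0, 1})" by (simp add: F_def J_def)
      then obtain y z where y: "x = A c 2 y" "y = A c 1 z" "y \<in> coords {0, 1}" by blast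
      have "y 0 = 0" using y(2) by (simp add: A_def)
      moreover have "y 2 = 0" using y(3) by (simp add: coords_def)
      ultimately show "x = x 0 *\<^sub>s (unit 0 + unit 1)" unfolding y(1) by (auto simp: A_def unit_def pointwise)
    qed
    have A21: "A c 2 (A c 1 (unit 0)) = unit 0 + c *\<^sub>s unit 1"
      by (auto simp: A_def unit_def pointwise)
    have "A c 2 (A c 1 (unit 0)) \<in> A c 2 ` A c 1 ` coords {0}"
      by (intro imageI) (simp add: coords_def unit_def)
    then show "unit 0 + c *\<^sub>s unit 1 \<in> ?im 2 (?im 1 (?fl 1 4)) (F c)"
      unfolding A21 by (simp add: F_def J_def)
    show "?im 2 (?im 1 (?fl 1 4)) (F c) \<subseteq> seqvs.span {unit 0 + c *\<^sub>s unit 1}"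
    proof (rule subset_lineI[of _ 0])
      fix x assume "x \<in> ?im 2 (?im 1 (?fl 1 4)) (F c)"
      then have "x \<in> A c 2 ` A c 1 ` coords {0}" by (simp add: F_def J_def)
      then obtain y where "x = A c 2 (A c 1 y)" "y \<in> coords {0}" by blast
      then show "x = x 0 *\<^sub>s (unit 0 + c *\<^sub>s unit 1)" by (auto simp: A_def coords_def unit_def pointwise)
    qed
  qed
qed

text \<open>
  In the plane of row 3 the four lines are the first member of its flag, the image of the second member of
  the flag of row 2, the image of row 1, and the kernel of the map to row 4.
\<close>

lemma infinite_three_columns_four_rows:
  assumes p: "p \<ge> 3" and n: "n \<ge> 4"
  shows "infinite ((indecs p n :: 'k::alg_closed_field quiver_rep set) // iso_rel p n)"
proof -
  define J :: "nat \<Rightarrow> nat \<Rightarrow> nat set" where "J k l =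
    (if k = 1 then (if l < 3 then {} else {0})
     else if k = 2 then (if l < 2 then {} else if l = 2 then {0} else {0, 1})
     else if k = 3 then (if l \<le> 1 then {0} else {0, 1}) else if k = 4 then {0} else {})" for k l
  define A :: "'k \<Rightarrow> nat \<Rightarrow> (nat \<Rightarrow> 'k) \<Rightarrow> nat \<Rightarrow> 'k" where "A c k x i =
    (if k = 1 then (if i = 1 then x 0 else 0)
     else if k = 2 then (if i = 0 then x 1 else if i = 1 then x 0 + x 1 else 0)
     else if k = 3 then (if i = 0 then c * x 0 - x 1 else 0) else 0)" for c k x i
  define F where "F c = grid_rep J (A c)" for c
  let ?fl = "\<lambda>k l (M :: 'k quiver_rep). to_last p M k l ` sp M (k, l)"
  let ?im = "\<lambda>k T (M :: 'k quiver_rep). ver M (k, p) ` T M"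
  let ?ker = "\<lambda>k (M :: 'k quiver_rep). {x \<in> sp M (k, p). ver M (k, p) x \<in> {0}}"
  have F: "F c \<in> rep_inj p n" for c
    unfolding F_def
  proof (rule grid_rep_in_rep_inj)
    show "slin (A c k)" for k by (auto simp: slin_iff pointwise A_def algebra_simps)
    show "A c k x \<in> coords (J (Suc k) l)" if "k \<ge> 1" "x \<in> coords (J k l)" for k l x
      using that by (auto simp: coords_def J_def A_def split: if_splits)
  qed (auto simp: J_def)
  have 1: "natural p n (3, p) (?fl 3 1)" using p n by (intro natural_flag) auto
  have 2: "natural p n (3, p) (?im 2 (?fl 2 2))"
    using natural_image[OF natural_flag[of 2 n 2 p]] p n by (simp add: eval_nat_numeral)
  have 3: "natural p n (3, p) (?im 2 (?im 1 (?fl 1 3)))"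
    using natural_image[OF natural_image[OF natural_flag[of 1 n 3 p]]] p n
    by (simp add: eval_nat_numeral)
  have 4: "natural p n (3, p) (?ker 3)"
    using p n by (intro natural_preimage natural_zero) (auto simp: vertices_def)
  have v: "(3, p) \<in> vertices p n" using p n by (simp add: vertices_def)
  show ?thesis
  proof (rule infinite_indecs_if_four_lines[OF F v 1 2 3 4 unit_plane])
    fix c
    show "unit 0 \<in> ?fl 3 1 (F c)" by (simp add: F_def J_def coords_def unit_def)
    show "?fl 3 1 (F c) \<subseteq> seqvs.span {unit 0}"
      by (rule subset_lineI[of _ 0]) (auto simp: F_def J_def coords_def unit_def pointwise)
    have "unit 1 = A c 2 (unit 0)" by (auto simp: A_def unit_def pointwise)
    then show "unit 1 \<in> ?im 2 (?fl 2 2) (F c)" by (auto simp: F_def J_def coords_def unit_def)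
    show "?im 2 (?fl 2 2) (F c) \<subseteq> seqvs.span {unit 1}"
      by (rule subset_lineI[of _ 1]) (auto simp: F_def J_def A_def coords_def unit_def pointwise)
    have A21: "A c 2 (A c 1 (unit 0)) = unit 0 + unit 1"
      by (auto simp: A_def unit_def pointwise)
    have "A c 2 (A c 1 (unit 0)) \<in> A c 2 ` A c 1 ` coords {0}"
      by (intro imageI) (simp add: coords_def unit_def)
    then show "unit 0 + unit 1 \<in> ?im 2 (?im 1 (?fl 1 3)) (F c)"
      unfolding A21 by (simp add: F_def J_def)
    show "?im 2 (?im 1 (?fl 1 3)) (F c) \<subseteq> seqvs.span {unit 0 + unit 1}"
    proof (rule subset_lineI[of _ 0])
      fix x assume "x \<in> ?im 2 (?im 1 (?fl 1 3)) (F c)"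
      then have "x \<in> A c 2 ` A c 1 ` coords {0}" by (simp add: F_def J_def)
      then obtain y where "x = A c 2 (A c 1 y)" "y \<in> coords {0}" by blast
      then show "x = x 0 *\<^sub>s (unit 0 + unit 1)" by (auto simp: A_def coords_def unit_def pointwise)
    qed
    show "unit 0 + c *\<^sub>s unit 1 \<in> ?ker 3 (F c)"
      using p by (auto simp: F_def J_def A_def coords_def unit_def pointwise)
    show "?ker 3 (F c) \<subseteq> seqvs.span {unit 0 + c *\<^sub>s unit 1}"
      using p by (intro subset_lineI[of _ 0])
        (auto simp: F_def J_def A_def coords_def unit_def pointwise mult.commute split: if_splits)
  qed
qed

text \<open>
  Here the plane is the first member of the flag of the three-dimensional row 4. There are three complete
  flags in this row, in general position up to the parameter: the image of row 3's flag inside the plane,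
  the images of rows 1 and 2, and the kernels of the maps to rows 5 and 6. Intersecting the plane
  with the planes of the other two flags, and with the sum of their lines, gives the remaining three lines.
\<close>

lemma infinite_two_columns_six_rows:
  assumes p: "p \<ge> 2" and n: "n \<ge> 6"
  shows "infinite ((indecs p n :: 'k::alg_closed_field quiver_rep set) // iso_rel p n)"
proof -
  define J :: "nat \<Rightarrow> nat \<Rightarrow> nat set" where "J k l =
    (if k = 1 then (if l < 2 then {} else {2})
     else if k = 2 then (if l < 2 then {} else {1, 2})
     else if k = 3 then (if l < 2 then {0} else {0, 1, 2})
     else if k = 4 then (if l < 2 then {0, 1} else {0, 1, 2})
     else if k = 5 then {0, 1} else if k = 6 then {0} else {})" for k l
  define A :: "'k \<Rightarrow> nat \<Rightarrow> (nat \<Rightarrow> 'k) \<Rightarrow> nat \<Rightarrow> 'k" where "A c k x i =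
    (if k \<le> 3 then x i
     else if k = 4 then (if i = 0 then x 0 - x 2 else if i = 1 then x 1 - c * x 2 else 0)
     else if k = 5 then (if i = 0 then x 0 - x 1 else 0) else 0)" for c k x i
  define F where "F c = grid_rep J (A c)" for c
  let ?fl = "\<lambda>k l (M :: 'k quiver_rep). to_last p M k l ` sp M (k, l)"
  let ?im = "\<lambda>k T (M :: 'k quiver_rep). ver M (k, p) ` T M"
  let ?pre = "\<lambda>k T (M :: 'k quiver_rep). {x \<in> sp M (k, p). ver M (k, p) x \<in> T M}"
  let ?zero = "\<lambda>M :: 'k quiver_rep. {0 :: nat \<Rightarrow> 'k}"
  let ?T1 = "?im 3 (?fl 3 1)"
  let ?T2 = "\<lambda>M. ?fl 4 1 M \<inter> ?im 3 (?im 2 (?fl 2 2)) M"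
  let ?T3 = "\<lambda>M. ?fl 4 1 M \<inter> ?pre 4 (?pre 5 ?zero) M"
  let ?T4 = "\<lambda>M. ?fl 4 1 M \<inter> {x + y | x y. x \<in> ?im 3 (?im 2 (?im 1 (?fl 1 2))) M \<and> y \<in> ?pre 4 ?zero M}"
  have F: "F c \<in> rep_inj p n" for c
    unfolding F_def
  proof (rule grid_rep_in_rep_inj)
    show "slin (A c k)" for k by (auto simp: slin_iff pointwise A_def algebra_simps)
    show "A c k x \<in> coords (J (Suc k) l)" if "k \<ge> 1" "x \<in> coords (J k l)" for k l x
      using that by (auto simp: coords_def J_def A_def split: if_splits)
  qed (auto simp: J_def)
  have v: "(4, p) \<in> vertices p n" using p n by (simp add: vertices_def)
  have fl: "natural p n (4, p) (?fl 4 1)" using p n by (intro natural_flag) auto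
  have 1: "natural p n (4, p) ?T1"
    using natural_image[OF natural_flag[of 3 n 1 p]] p n by (simp add: eval_nat_numeral)
  have "natural p n (4, p) (?im 3 (?im 2 (?fl 2 2)))"
    using natural_image[OF natural_image[OF natural_flag[of 2 n 2 p]]] p n by (simp add: eval_nat_numeral)
  then have 2: "natural p n (4, p) ?T2" by (rule natural_Int[OF fl])
  have "natural p n (4, p) (?pre 4 (?pre 5 ?zero))"
  proof -
    have "natural p n (5, p) (?pre 5 ?zero)"
      using p n by (intro natural_preimage natural_zero) (auto simp: vertices_def)
    then show ?thesis using p n by (intro natural_preimage) auto
  qed
  then have 3: "natural p n (4, p) ?T3" by (rule natural_Int[OF fl])
  have "natural p n (4, p) (?im 3 (?im 2 (?im 1 (?fl 1 2))))"
    using natural_image[OF natural_image[OF natural_image[OF natural_flag[of 1 n 2 p]]]] p n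
    by (simp add: eval_nat_numeral)
  moreover have "natural p n (4, p) (?pre 4 ?zero)"
    using p n by (intro natural_preimage natural_zero) (auto simp: vertices_def)
  ultimately have 4: "natural p n (4, p) ?T4" by (intro natural_Int[OF fl] natural_sum v)
  show ?thesis
  proof (rule infinite_indecs_if_four_lines[OF F v 1 2 3 4 unit_plane])
    fix c
    have id: "A c k = (\<lambda>x. x)" if "k \<le> 3" for k using that by (simp add: fun_eq_iff A_def)
    show "unit 0 \<in> ?T1 (F c)" by (simp add: F_def id J_def coords_def unit_def)
    show "?T1 (F c) \<subseteq> seqvs.span {unit 0}"
      by (rule subset_lineI[of _ 0]) (auto simp: F_def id J_def coords_def unit_def pointwise)
    show "unit 1 \<in> ?T2 (F c)" by (simp add: F_def id J_def coords_def unit_def)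
    show "?T2 (F c) \<subseteq> seqvs.span {unit 1}"
    proof (rule subset_lineI[of _ 1])
      fix x assume "x \<in> ?T2 (F c)"
      then have "x \<in> coords {0, 1} \<inter> coords {1, 2}" by (simp add: F_def id J_def)
      then have "x i = 0" if "i \<noteq> 1" for i
        using that by (cases "i = 0") (simp_all add: coords_def)
      then show "x = x 1 *\<^sub>s unit 1" by (simp add: unit_def pointwise)
    qed
    show "unit 0 + unit 1 \<in> ?T3 (F c)"
      using p by (auto simp: F_def J_def A_def coords_def unit_def pointwise)
    show "?T3 (F c) \<subseteq> seqvs.span {unit 0 + unit 1}"
    proof (rule subset_lineI[of _ 0])
      fix x assume "x \<in> ?T3 (F c)"
      then have x: "\<And>i. i \<noteq> 0 \<Longrightarrow> i \<noteq> 1 \<Longrightarrow> x i = 0" "A c 5 (A c 4 x) 0 = 0"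
        by (auto simp: F_def J_def coords_def pointwise)
      then have "x 0 = x 1" by (simp add: A_def)
      then show "x = x 0 *\<^sub>s (unit 0 + unit 1)" using x(1) by (auto simp: unit_def pointwise)
    qed
    \<comment> \<open>The kernel of the map to row 5 is spanned by \<open>(1, c, 1)\<close> and the image of row 1 by \<open>(0, 0, 1)\<close>.\<close>
    have sum: "unit 0 + c *\<^sub>s unit 1 = (- 1) *\<^sub>s unit 2 + (unit 0 + c *\<^sub>s unit 1 + unit 2)"
      by (auto simp: unit_def pointwise)
    have "(- 1) *\<^sub>s unit 2 \<in> ?im 3 (?im 2 (?im 1 (?fl 1 2))) (F c)"
      by (simp add: F_def id J_def coords_def unit_def pointwise)
    moreover have "unit 0 + c *\<^sub>s unit 1 + unit 2 \<in> ?pre 4 ?zero (F c)"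
      using p by (auto simp: F_def J_def A_def coords_def unit_def pointwise)
    moreover have "unit 0 + c *\<^sub>s unit 1 \<in> ?fl 4 1 (F c)"
      by (simp add: F_def J_def coords_def unit_def pointwise)
    ultimately show "unit 0 + c *\<^sub>s unit 1 \<in> ?T4 (F c)" using sum by blast
    show "?T4 (F c) \<subseteq> seqvs.span {unit 0 + c *\<^sub>s unit 1}"
    proof (rule subset_lineI[of _ 0])
      fix z assume z: "z \<in> ?T4 (F c)"
      then obtain x y where xy: "z = x + y" "x \<in> ?im 3 (?im 2 (?im 1 (?fl 1 2))) (F c)" "y \<in> ?pre 4 ?zero (F c)"
        by blast
      have z': "\<And>i. i \<noteq> 0 \<Longrightarrow> i \<noteq> 1 \<Longrightarrow> z i = 0" using z by (auto simp: F_def J_def coords_def)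
      have x: "x 0 = 0" "x 1 = 0" using xy(2) by (auto simp: F_def id J_def coords_def)
      have "A c 4 y 0 = 0" "A c 4 y 1 = 0" using xy(3) by (auto simp: F_def pointwise)
      then have "y 0 = y 2" "y 1 = c * y 2" by (auto simp: A_def)
      then have "z 1 = z 0 * c" using x xy(1) by (simp add: pointwise mult.commute)
      then show "z = z 0 *\<^sub>s (unit 0 + c *\<^sub>s unit 1)" using z' by (auto simp: unit_def pointwise)
    qed
  qed
qed

theorem proposition4p11:
  fixes p n :: nat
  assumes "p \<ge> 1" and "n \<ge> 1"
  shows "finite ({M \<in> (rep_inj p n :: 'k::alg_closed_field quiver_rep set).
              indecomposable p n M} // iso_rel p n)
     \<longleftrightarrow> p = 1 \<or> n \<le> 2 \<or> (p, n) \<in> {(2, 3), (3, 3), (4, 3), (2, 4), (2, 5)}"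
    (is "?finite \<longleftrightarrow> ?cases")
proof
  assume ?finite
  then have "\<not> (p \<ge> 5 \<and> n \<ge> 3)" "\<not> (p \<ge> 3 \<and> n \<ge> 4)" "\<not> (p \<ge> 2 \<and> n \<ge> 6)"
    using infinite_five_columns_three_rows infinite_three_columns_four_rows
      infinite_two_columns_six_rows by blast+
  then have "p = 1 \<or> n \<le> 2 \<or> n = 3 \<and> (p = 2 \<or> p = 3 \<or> p = 4) \<or> p = 2 \<and> (n = 4 \<or> n = 5)"
    using assms by presburger
  then show ?cases by auto
next
  assume ?cases
  then have "p = 1 \<or> n \<le> 2 \<or> n = 3 \<and> (p = 2 \<or> p = 3 \<or> p = 4) \<or> p = 2 \<and> (n = 4 \<or> n = 5)"
    by auto
  then have "p = 1 \<or> (n = 1 \<or> n = 2) \<or> (p = 2 \<and> n \<in> {1..5}) \<or> (p = 3 \<and> n \<in> {1..3}) \<or>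
      (p = 4 \<and> n \<in> {1..3})"
    using assms(2) unfolding atLeastAtMost_iff by presburger
  then consider "p = 1" | "n = 1 \<or> n = 2" | "p = 2" "n \<in> {1..5}" | "p = 3" "n \<in> {1..3}" | "p = 4" "n \<in> {1..3}"
    by blast
  then show ?finite
  proof cases
    case 1 then show ?thesis using finite_one_column[OF assms(2)] by simp
  next
    case 2 then show ?thesis using finite_two_rows[OF assms(1)] by simp
  next
    case 3 then show ?thesis using finite_two_columns by simp
  next
    case 4 then show ?thesis using finite_three_columns by simp
  next
    case 5 then show ?thesis using finite_four_columns by simp
  qed
qed

end
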